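(* The condensed theory $\mathsf{F}^{-}_{c}$ is mutually interpretable with Robinson arithmetic $\mathsf{Q}$: each of the two theories is interpretable in the other.
   Context: **The theory $\mathsf{F}^{-}_{c}$** is the first-order theory with equality in the language $\{\emptyset,\langle\cdot\rangle,\uplus\}$ (constant, unary function, binary function) whose axioms (universally quantified) are: $\mathrm{F}_1$: $(x\uplus y)\uplus z=x\uplus(y\uplus z)$; $\mathrm{F}_2$: $x\uplus y=y\uplus x$; $\mathrm{F}_3$: $x\uplus\emptyset=x$; $\mathrm{F}_5$: $\langle x\rangle\ne\emptyset$; $\mathrm{F}_6$: $x\uplus y=\emptyset\rightarrow x=\emptyset$; $\mathrm{F}_7$: $\langle x\rangle=\langle y\rangle\rightarrow x=y$; $(\mathrm{Id})$: $x\uplus x=x$; $(\mathrm{M})$: $\forall x,y,u\;\bigl(u\in_1(x\uplus\langle y\rangle)\leftrightarrow u\in_1 x\vee u=y\bigr)$, where $u\in_1 z$ abbreviates $\exists w\,(z=w\uplus\langle u\rangle)$. **Robinson arithmetic $\mathsf{Q}$**: $Sx\ne0$; $Sx=Sy\rightarrow x=y$; $x\ne0\rightarrow\exists y\,(x=Sy)$; $x+0=x$; $x+Sy=S(x+y)$; $x\cdot0=0$; $x\cdot Sy=x\cdot y+x$ (with $x\le y$ abbreviating $\exists z\,(z+x=y)$). **Interpretability.** A (relative) interpretation of a theory $V$ in a theory $U$ is given by a translation $\tau$ of the language of $V$ into that of $U$: a formula $\delta(x)$ (the domain) with $U\vdash\exists x\,\delta(x)$; for each $n$-ary relation symbol of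 $V$ a formula in $n$ free variables; for each $n$-ary function symbol a formula in $n+1$ free variables which $U$ proves to be total and functional on $\delta$. Translations commute with connectives, and quantifiers are relativized to $\delta$. $V$ is interpretable in $U$ if for some such $\tau$, $U\vdash\varphi^{\tau}$ for every axiom $\varphi$ of $V$. *)

theory Defs
  imports Main
begin

section \<open>First-order logic with equality\<close>

text \<open>Variables are de Bruijn indices. A function symbol is applied to a list of arguments;
  a constant is a symbol applied to \<open>[]\<close>. Logic is classical, with primitive
  connectives falsity, implication and the universal quantifier.\<close>

datatype 'f tm = Var nat | Fun 'f "'f tm list"

datatype ('f, 'r) fm =
    Eq "'f tm" "'f tm"
  | Rel 'r "'f tm list"
  | Fls
  | Imp "('f, 'r) fm" "('f, 'r) fm"
  | Forall "('f, 'r) fm"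

abbreviation Tru :: "('f, 'r) fm" where "Tru \<equiv> Imp Fls Fls"
abbreviation Neg :: "('f, 'r) fm \<Rightarrow> ('f, 'r) fm" where "Neg p \<equiv> Imp p Fls"
abbreviation Con :: "('f, 'r) fm \<Rightarrow> ('f, 'r) fm \<Rightarrow> ('f, 'r) fm" where
  "Con p q \<equiv> Neg (Imp p (Neg q))"
abbreviation Dis :: "('f, 'r) fm \<Rightarrow> ('f, 'r) fm \<Rightarrow> ('f, 'r) fm" where
  "Dis p q \<equiv> Imp (Neg p) q"
abbreviation Iff :: "('f, 'r) fm \<Rightarrow> ('f, 'r) fm \<Rightarrow> ('f, 'r) fm" where
  "Iff p q \<equiv> Con (Imp p q) (Imp q p)"
abbreviation Exists :: "('f, 'r) fm \<Rightarrow> ('f, 'r) fm" where "Exists p \<equiv> Neg (Forall (Neg p))"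

definition conjs :: "('f, 'r) fm list \<Rightarrow> ('f, 'r) fm" where
  "conjs ps = foldr Con ps Tru"

definition alls :: "nat \<Rightarrow> ('f, 'r) fm \<Rightarrow> ('f, 'r) fm" where
  "alls n p = (Forall ^^ n) p"

definition exs :: "nat \<Rightarrow> ('f, 'r) fm \<Rightarrow> ('f, 'r) fm" where
  "exs n p = (Exists ^^ n) p"

primrec subst_tm :: "(nat \<Rightarrow> 'f tm) \<Rightarrow> 'f tm \<Rightarrow> 'f tm" where
  "subst_tm \<sigma> (Var i) = \<sigma> i"
| "subst_tm \<sigma> (Fun f ts) = Fun f (map (subst_tm \<sigma>) ts)"

definition lift_tm :: "'f tm \<Rightarrow> 'f tm" where
  "lift_tm = subst_tm (\<lambda>i. Var (Suc i))"

primrec subst_fm :: "(nat \<Rightarrow> 'f tm) \<Rightarrow> ('f, 'r) fm \<Rightarrow> ('f, 'r) fm" where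
  "subst_fm \<sigma> (Eq s t) = Eq (subst_tm \<sigma> s) (subst_tm \<sigma> t)"
| "subst_fm \<sigma> (Rel r ts) = Rel r (map (subst_tm \<sigma>) ts)"
| "subst_fm \<sigma> Fls = Fls"
| "subst_fm \<sigma> (Imp p q) = Imp (subst_fm \<sigma> p) (subst_fm \<sigma> q)"
| "subst_fm \<sigma> (Forall p) = Forall (subst_fm (case_nat (Var 0) (\<lambda>i. lift_tm (\<sigma> i))) p)"

definition lift_fm :: "('f, 'r) fm \<Rightarrow> ('f, 'r) fm" where
  "lift_fm = subst_fm (\<lambda>i. Var (Suc i))"

text \<open>The instance \<open>p[t]\<close> of the body \<open>p\<close> of a quantified formula: index \<open>0\<close> becomes \<open>t\<close>,
  the other indices are decremented.\<close>

definition inst :: "('f, 'r) fm \<Rightarrow> 'f tm \<Rightarrow> ('f, 'r) fm" where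
  "inst p t = subst_fm (case_nat t Var) p"

text \<open>Natural deduction from a set of hypotheses. Terms are not restricted to a language;
  by the usual conservativity of adding unconstrained symbols this does not affect which
  formulas of the language are provable.\<close>

inductive deriv :: "('f, 'r) fm set \<Rightarrow> ('f, 'r) fm \<Rightarrow> bool" (infix "\<turnstile>" 50) where
  Hyp: "p \<in> \<Gamma> \<Longrightarrow> \<Gamma> \<turnstile> p"
| ImpI: "insert p \<Gamma> \<turnstile> q \<Longrightarrow> \<Gamma> \<turnstile> Imp p q"
| ImpE: "\<Gamma> \<turnstile> Imp p q \<Longrightarrow> \<Gamma> \<turnstile> p \<Longrightarrow> \<Gamma> \<turnstile> q"
| Contr: "insert (Neg p) \<Gamma> \<turnstile> Fls \<Longrightarrow> \<Gamma> \<turnstile> p"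
| AllI: "lift_fm ` \<Gamma> \<turnstile> p \<Longrightarrow> \<Gamma> \<turnstile> Forall p"
| AllE: "\<Gamma> \<turnstile> Forall p \<Longrightarrow> \<Gamma> \<turnstile> inst p t"
| Refl: "\<Gamma> \<turnstile> Eq t t"
| Leibniz: "\<Gamma> \<turnstile> Eq s t \<Longrightarrow> \<Gamma> \<turnstile> inst p s \<Longrightarrow> \<Gamma> \<turnstile> inst p t"


section \<open>Languages and theories\<close>

text \<open>A language is a set of function symbols and a set of relation symbols, each symbol
  paired with its arity; equality is a logical symbol.\<close>

record ('f, 'r) language =
  funs :: "('f \<times> nat) set"
  rels :: "('r \<times> nat) set"

text \<open>\<open>wf_fm L n p\<close>: \<open>p\<close> is a formula of \<open>L\<close> whose free variables are among \<open>0, \<dots>, n - 1\<close>.\<close>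

primrec wf_tm :: "('f, 'r) language \<Rightarrow> nat \<Rightarrow> 'f tm \<Rightarrow> bool" where
  "wf_tm L n (Var i) \<longleftrightarrow> i < n"
| "wf_tm L n (Fun f ts) \<longleftrightarrow> (f, length ts) \<in> funs L \<and> list_all (wf_tm L n) ts"

primrec wf_fm :: "('f, 'r) language \<Rightarrow> nat \<Rightarrow> ('f, 'r) fm \<Rightarrow> bool" where
  "wf_fm L n (Eq s t) \<longleftrightarrow> wf_tm L n s \<and> wf_tm L n t"
| "wf_fm L n (Rel r ts) \<longleftrightarrow> (r, length ts) \<in> rels L \<and> list_all (wf_tm L n) ts"
| "wf_fm L n Fls \<longleftrightarrow> True"
| "wf_fm L n (Imp p q) \<longleftrightarrow> wf_fm L n p \<and> wf_fm L n q"
| "wf_fm L n (Forall p) \<longleftrightarrow> wf_fm L (Suc n) p"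

record ('f, 'r) fo_theory =
  lang :: "('f, 'r) language"
  axs :: "('f, 'r) fm set"


section \<open>Relative interpretations\<close>

text \<open>\<open>dom_fm\<close> has free variable \<open>0\<close>. For a symbol of arity \<open>n\<close>, variable \<open>i < n\<close> of the
  associated formula stands for the \<open>i\<close>-th argument, and variable \<open>n\<close> of \<open>fun_fm f n\<close> for
  the value. Equality is translated as equality.\<close>

record ('f, 'r, 'g, 's) translation =
  dom_fm :: "('g, 's) fm"
  fun_fm :: "'f \<Rightarrow> nat \<Rightarrow> ('g, 's) fm"
  rel_fm :: "'r \<Rightarrow> nat \<Rightarrow> ('g, 's) fm"

definition app :: "('f, 'r) fm \<Rightarrow> nat list \<Rightarrow> ('f, 'r) fm" where
  "app p ks = subst_fm (\<lambda>i. Var (ks ! i)) p"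

abbreviation in_dom :: "('f, 'r, 'g, 's) translation \<Rightarrow> nat \<Rightarrow> ('g, 's) fm" where
  "in_dom \<tau> k \<equiv> app (dom_fm \<tau>) [k]"

text \<open>Function symbols are translated by relations, so nested terms have to be unravelled.
  \<open>tr_tm \<tau> t k y\<close> says that the value of \<open>t\<close>, with all its variables shifted up by \<open>k\<close>, is
  variable \<open>y\<close>. For argument translations \<open>gs = [g\<^sub>0, \<dots>]\<close>, \<open>with_args \<tau> gs k p\<close> quantifies
  existentially over elements \<open>v\<^sub>0, \<dots>\<close> of the domain, the values of the arguments, of which
  \<open>p\<close> is then asserted; \<open>v\<^sub>i\<close> is index \<open>i\<close> in \<open>p\<close>.\<close>

definition with_args ::
  "('f, 'r, 'g, 's) translation \<Rightarrow> (nat \<Rightarrow> nat \<Rightarrow> ('g, 's) fm) list \<Rightarrow> nat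
    \<Rightarrow> ('g, 's) fm \<Rightarrow> ('g, 's) fm" where
  "with_args \<tau> gs k p =
    (let n = length gs in
      exs n (Con (conjs (map2 (\<lambda>g i. Con (in_dom \<tau> i) (g (k + n) i)) gs [0..<n])) p))"

primrec tr_tm :: "('f, 'r, 'g, 's) translation \<Rightarrow> 'f tm \<Rightarrow> nat \<Rightarrow> nat \<Rightarrow> ('g, 's) fm" where
  "tr_tm \<tau> (Var x) = (\<lambda>k y. Eq (Var (x + k)) (Var y))"
| "tr_tm \<tau> (Fun f ts) = (\<lambda>k y.
    with_args \<tau> (map (tr_tm \<tau>) ts) k
      (app (fun_fm \<tau> f (length ts)) ([0..<length ts] @ [y + length ts])))"

primrec tr_fm :: "('f, 'r, 'g, 's) translation \<Rightarrow> ('f, 'r) fm \<Rightarrow> ('g, 's) fm" where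
  "tr_fm \<tau> (Eq s t) = with_args \<tau> [tr_tm \<tau> s, tr_tm \<tau> t] 0 (Eq (Var 0) (Var 1))"
| "tr_fm \<tau> (Rel r ts) =
    with_args \<tau> (map (tr_tm \<tau>) ts) 0 (app (rel_fm \<tau> r (length ts)) [0..<length ts])"
| "tr_fm \<tau> Fls = Fls"
| "tr_fm \<tau> (Imp p q) = Imp (tr_fm \<tau> p) (tr_fm \<tau> q)"
| "tr_fm \<tau> (Forall p) = Forall (Imp (in_dom \<tau> 0) (tr_fm \<tau> p))"

definition wf_translation ::
  "('f, 'r, 'g, 's) translation \<Rightarrow> ('f, 'r) language \<Rightarrow> ('g, 's) language \<Rightarrow> bool" where
  "wf_translation \<tau> L K \<longleftrightarrow>
    wf_fm K 1 (dom_fm \<tau>) \<and>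
    (\<forall>(f, n) \<in> funs L. wf_fm K (Suc n) (fun_fm \<tau> f n)) \<and>
    (\<forall>(r, n) \<in> rels L. wf_fm K n (rel_fm \<tau> r n))"

definition total_functional ::
  "('f, 'r, 'g, 's) translation \<Rightarrow> 'f \<Rightarrow> nat \<Rightarrow> ('g, 's) fm" where
  "total_functional \<tau> f n =
    alls n (Imp (conjs (map (in_dom \<tau>) [0..<n]))
      (Con
        (Exists (Con (in_dom \<tau> 0) (app (fun_fm \<tau> f n) ([1..<n + 1] @ [0]))))
        (Forall (Forall (Imp
          (Con (Con (in_dom \<tau> 1) (app (fun_fm \<tau> f n) ([2..<n + 2] @ [1])))
               (Con (in_dom \<tau> 0) (app (fun_fm \<tau> f n) ([2..<n + 2] @ [0]))))
          (Eq (Var 1) (Var 0)))))))"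

definition interpretation_of ::
  "('f, 'r, 'g, 's) translation \<Rightarrow> ('f, 'r) fo_theory \<Rightarrow> ('g, 's) fo_theory \<Rightarrow> bool" where
  "interpretation_of \<tau> V U \<longleftrightarrow>
    wf_translation \<tau> (lang V) (lang U) \<and>
    axs U \<turnstile> Exists (dom_fm \<tau>) \<and>
    (\<forall>(f, n) \<in> funs (lang V). axs U \<turnstile> total_functional \<tau> f n) \<and>
    (\<forall>p \<in> axs V. axs U \<turnstile> tr_fm \<tau> p)"

definition interpretable_in :: "('f, 'r) fo_theory \<Rightarrow> ('g, 's) fo_theory \<Rightarrow> bool" where
  "interpretable_in V U \<longleftrightarrow> (\<exists>\<tau>. interpretation_of \<tau> V U)"

definition mutually_interpretable :: "('f, 'r) fo_theory \<Rightarrow> ('g, 's) fo_theory \<Rightarrow> bool" where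
  "mutually_interpretable U V \<longleftrightarrow> interpretable_in U V \<and> interpretable_in V U"


section \<open>The theory \<open>F\<^sup>-\<^sub>c\<close>\<close>

text \<open>Neither of the two languages has relation symbols; the type \<open>unit\<close> of relation
  symbols is a placeholder.\<close>

datatype F_sym = Emp_sym | Sing_sym | Un_sym

abbreviation emp :: "F_sym tm" where "emp \<equiv> Fun Emp_sym []"
abbreviation sing :: "F_sym tm \<Rightarrow> F_sym tm" where "sing t \<equiv> Fun Sing_sym [t]"
abbreviation un :: "F_sym tm \<Rightarrow> F_sym tm \<Rightarrow> F_sym tm" (infixl "\<squnion>" 65) where
  "s \<squnion> t \<equiv> Fun Un_sym [s, t]"

definition mem1 :: "F_sym tm \<Rightarrow> F_sym tm \<Rightarrow> (F_sym, unit) fm" where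
  "mem1 u z = Exists (Eq (lift_tm z) (Var 0 \<squnion> sing (lift_tm u)))"

definition F_lang :: "(F_sym, unit) language" where
  "F_lang = \<lparr>funs = {(Emp_sym, 0), (Sing_sym, 1), (Un_sym, 2)}, rels = {}\<rparr>"

definition F1_ax :: "(F_sym, unit) fm" where
  "F1_ax = (let x = Var 2; y = Var 1; z = Var 0 in
     alls 3 (Eq ((x \<squnion> y) \<squnion> z) (x \<squnion> (y \<squnion> z))))"
definition F2_ax :: "(F_sym, unit) fm" where
  "F2_ax = (let x = Var 1; y = Var 0 in alls 2 (Eq (x \<squnion> y) (y \<squnion> x)))"
definition F3_ax :: "(F_sym, unit) fm" where
  "F3_ax = (let x = Var 0 in alls 1 (Eq (x \<squnion> emp) x))"
definition F5_ax :: "(F_sym, unit) fm" where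
  "F5_ax = (let x = Var 0 in alls 1 (Neg (Eq (sing x) emp)))"
definition F6_ax :: "(F_sym, unit) fm" where
  "F6_ax = (let x = Var 1; y = Var 0 in alls 2 (Imp (Eq (x \<squnion> y) emp) (Eq x emp)))"
definition F7_ax :: "(F_sym, unit) fm" where
  "F7_ax = (let x = Var 1; y = Var 0 in alls 2 (Imp (Eq (sing x) (sing y)) (Eq x y)))"
definition Id_ax :: "(F_sym, unit) fm" where
  "Id_ax = (let x = Var 0 in alls 1 (Eq (x \<squnion> x) x))"
definition M_ax :: "(F_sym, unit) fm" where
  "M_ax = (let x = Var 2; y = Var 1; u = Var 0 in
     alls 3 (Iff (mem1 u (x \<squnion> sing y)) (Dis (mem1 u x) (Eq u y))))"

definition F_c_minus :: "(F_sym, unit) fo_theory" where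
  "F_c_minus = \<lparr>lang = F_lang,
     axs = {F1_ax, F2_ax, F3_ax, F5_ax, F6_ax, F7_ax, Id_ax, M_ax}\<rparr>"


section \<open>Robinson arithmetic\<close>

datatype Q_sym = Zero_sym | Succ_sym | Plus_sym | Times_sym

abbreviation q_zero :: "Q_sym tm" where "q_zero \<equiv> Fun Zero_sym []"
abbreviation q_succ :: "Q_sym tm \<Rightarrow> Q_sym tm" where "q_succ t \<equiv> Fun Succ_sym [t]"
abbreviation q_plus :: "Q_sym tm \<Rightarrow> Q_sym tm \<Rightarrow> Q_sym tm" (infixl "\<oplus>" 65) where
  "s \<oplus> t \<equiv> Fun Plus_sym [s, t]"
abbreviation q_times :: "Q_sym tm \<Rightarrow> Q_sym tm \<Rightarrow> Q_sym tm" (infixl "\<otimes>" 70) where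
  "s \<otimes> t \<equiv> Fun Times_sym [s, t]"

definition Q_lang :: "(Q_sym, unit) language" where
  "Q_lang =
    \<lparr>funs = {(Zero_sym, 0), (Succ_sym, 1), (Plus_sym, 2), (Times_sym, 2)}, rels = {}\<rparr>"

definition Q1_ax :: "(Q_sym, unit) fm" where
  "Q1_ax = (let x = Var 0 in alls 1 (Neg (Eq (q_succ x) q_zero)))"
definition Q2_ax :: "(Q_sym, unit) fm" where
  "Q2_ax = (let x = Var 1; y = Var 0 in alls 2 (Imp (Eq (q_succ x) (q_succ y)) (Eq x y)))"
definition Q3_ax :: "(Q_sym, unit) fm" where
  "Q3_ax = alls 1 (Imp (Neg (Eq (Var 0) q_zero)) (Exists (Eq (Var 1) (q_succ (Var 0)))))"
definition Q4_ax :: "(Q_sym, unit) fm" where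
  "Q4_ax = (let x = Var 0 in alls 1 (Eq (x \<oplus> q_zero) x))"
definition Q5_ax :: "(Q_sym, unit) fm" where
  "Q5_ax = (let x = Var 1; y = Var 0 in alls 2 (Eq (x \<oplus> q_succ y) (q_succ (x \<oplus> y))))"
definition Q6_ax :: "(Q_sym, unit) fm" where
  "Q6_ax = (let x = Var 0 in alls 1 (Eq (x \<otimes> q_zero) q_zero))"
definition Q7_ax :: "(Q_sym, unit) fm" where
  "Q7_ax = (let x = Var 1; y = Var 0 in alls 2 (Eq (x \<otimes> q_succ y) ((x \<otimes> y) \<oplus> x)))"

definition Q_arith :: "(Q_sym, unit) fo_theory" where
  "Q_arith = \<lparr>lang = Q_lang,
     axs = {Q1_ax, Q2_ax, Q3_ax, Q4_ax, Q5_ax, Q6_ax, Q7_ax}\<rparr>"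

end

theory Submission
  imports Defs "HOL-Library.Countable_Set"
begin

text \<open>By the completeness theorem, an interpretation amounts to a uniform definition, inside every
  model of one theory, of a model of the other. Since both theories have only infinite models,
  it is enough to consider models with universe \<^typ>\<open>nat\<close>.

  Both directions rest on Solovay's method of shortening cuts. From a structure with a zero, a successor
  and relations that satisfy the recursion equations of addition and multiplication, one passes
  to a definable class, closed under predecessors and the operations, in which addition and
  multiplication are total and satisfy the laws of a commutative semiring: each law that has an
  inductive proof holds on a definable class that contains zero and is closed under successors.

  In a model of \<open>F\<^sup>-\<^sub>c\<close> the successor of \<open>x\<close> is \<open>\<langle>x\<rangle>\<close>, and the graphs of addition and multiplication
  are defined by finite sets of pairs.

  In a model of \<open>Q\<close>, finite sets of numbers are coded by words in the free monoid of unimodular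
  \<open>2 \<times> 2\<close> matrices over the semiring, so that only polynomial growth is needed to add an element to a set.
  Equality has to be interpreted by equality, so the codes must be canonical: on a
  shorter cut the least number principle holds for the relation of having the same
  elements, and least codes are taken. Finally, the class of the sets whose union with
  every set exists is closed under singletons and unions.\<close>

section \<open>Semantics and completeness\<close>

text \<open>Without induction, two devices carry the arithmetic: fixed computations in an ordered
  semiring, and definable classes for which only zero and successor are checked and which are then
  shrunk. Shrinking is delicate because the final class must be closed downward, for the sake of the
  axiom on predecessors, and also under the operations; hence the intermediate classes record how an
  element below a sum or a product decomposes.

  Matrices avoid induction on words. Adjoining \<open>y\<close> passes from X to A^y B X, whose
  entries are polynomials in \<open>y\<close> and the entries of X. Whether a word begins with A or
  with B is decided by comparing the two rows of its matrix, so a first block can be split off by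
  cancelling in equations, whatever the length of the word.

  Membership always refers to one fixed cut, and only the codes are confined to shorter ones. It
  therefore keeps its meaning when least codes are selected.\<close>

primrec eval :: "('f \<Rightarrow> 'a list \<Rightarrow> 'a) \<Rightarrow> (nat \<Rightarrow> 'a) \<Rightarrow> 'f tm \<Rightarrow> 'a" where
  "eval F e (Var i) = e i"
| "eval F e (Fun f ts) = F f (map (eval F e) ts)"

text \<open>Quantifiers range over \<open>D\<close> while the functions act on the whole type. Thus
  the ambient model (\<open>D = UNIV\<close>) and a structure defined inside it live on one type and
  share their environments.\<close>

primrec sat :: "'a set \<Rightarrow> ('f \<Rightarrow> 'a list \<Rightarrow> 'a) \<Rightarrow> ('r \<Rightarrow> 'a list \<Rightarrow> bool) \<Rightarrow> (nat \<Rightarrow> 'a)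
    \<Rightarrow> ('f, 'r) fm \<Rightarrow> bool" where
  "sat D F R e (Eq s t) \<longleftrightarrow> eval F e s = eval F e t"
| "sat D F R e (Rel r ts) \<longleftrightarrow> R r (map (eval F e) ts)"
| "sat D F R e Fls \<longleftrightarrow> False"
| "sat D F R e (Imp p q) \<longleftrightarrow> (sat D F R e p \<longrightarrow> sat D F R e q)"
| "sat D F R e (Forall p) \<longleftrightarrow> (\<forall>x\<in>D. sat D F R (case_nat x e) p)"

lemma subst_tm_subst_tm: "subst_tm \<sigma> (subst_tm \<theta> t) = subst_tm (\<lambda>i. subst_tm \<sigma> (\<theta> i)) t"
  by (induction t) auto

lemma subst_tm_Var [simp]: "subst_tm Var t = t"
  by (induction t) (auto simp: map_idI)

lemma subst_tm_case_lift [simp]: "subst_tm (case_nat s \<sigma>) (lift_tm t) = subst_tm \<sigma> t"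
  by (simp add: lift_tm_def subst_tm_subst_tm)

lemma subst_fm_subst_fm: "subst_fm \<sigma> (subst_fm \<theta> p) = subst_fm (\<lambda>i. subst_tm \<sigma> (\<theta> i)) p"
proof (induction p arbitrary: \<sigma> \<theta>)
  case (Forall p)
  have "(\<lambda>i. subst_tm (case_nat (Var 0) (\<lambda>i. lift_tm (\<sigma> i))) (case i of 0 \<Rightarrow> Var 0 | Suc i \<Rightarrow> lift_tm (\<theta> i)))
      = case_nat (Var 0) (\<lambda>i. lift_tm (subst_tm \<sigma> (\<theta> i)))"
    by (auto simp: fun_eq_iff lift_tm_def subst_tm_subst_tm split: nat.split)
  then show ?case
    using Forall by simp
qed (auto simp: subst_tm_subst_tm)

lemma subst_fm_Var [simp]: "subst_fm Var p = p"
proof (induction p)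
  case (Forall p)
  have *: "case_nat (Var 0) (\<lambda>i. lift_tm (Var i)) = Var"
    by (auto simp: fun_eq_iff lift_tm_def split: nat.split)
  show ?case
    unfolding subst_fm.simps * Forall.IH ..
qed (auto simp: map_idI)

lemma subst_tm_cong_wf:
  "wf_tm L n t \<Longrightarrow> (\<And>i. i < n \<Longrightarrow> \<sigma> i = \<theta> i) \<Longrightarrow> subst_tm \<sigma> t = subst_tm \<theta> t"
  by (induction t) (auto simp: list_all_iff)

lemma subst_fm_cong_wf:
  "wf_fm L n p \<Longrightarrow> (\<And>i. i < n \<Longrightarrow> \<sigma> i = \<theta> i) \<Longrightarrow> subst_fm \<sigma> p = subst_fm \<theta> p"
proof (induction p arbitrary: n \<sigma> \<theta>)
  case (Forall p)
  have "subst_fm (case_nat (Var 0) (\<lambda>i. lift_tm (\<sigma> i))) p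
      = subst_fm (case_nat (Var 0) (\<lambda>i. lift_tm (\<theta> i))) p"
    using Forall.prems by (intro Forall.IH[of "Suc n"]) (auto split: nat.split)
  then show ?case
    by simp
next
  case (Eq s t)
  then show ?case
    by (auto intro: subst_tm_cong_wf[of L n])
next
  case (Rel r ts)
  then show ?case
    by (auto simp: list_all_iff intro: subst_tm_cong_wf[of L n])
next
  case (Imp p q)
  then show ?case
    by (metis subst_fm.simps(4) wf_fm.simps(4))
qed auto

lemma eval_subst: "eval F e (subst_tm \<sigma> t) = eval F (\<lambda>i. eval F e (\<sigma> i)) t"
  by (induction t) (auto simp: comp_def intro!: arg_cong[of _ _ "F _"])

lemma sat_subst: "sat D F R e (subst_fm \<sigma> p) \<longleftrightarrow> sat D F R (\<lambda>i. eval F e (\<sigma> i)) p"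
proof (induction p arbitrary: e \<sigma>)
  case (Forall p)
  have "(\<lambda>i. eval F (case_nat x e) (case i of 0 \<Rightarrow> Var 0 | Suc i \<Rightarrow> lift_tm (\<sigma> i)))
      = case_nat x (\<lambda>i. eval F e (\<sigma> i))" for x
    by (auto simp: fun_eq_iff lift_tm_def eval_subst split: nat.split)
  then show ?case
    using Forall by simp
qed (auto simp: eval_subst comp_def)

lemma eval_cong_wf:
  "wf_tm L n t \<Longrightarrow> (\<And>i. i < n \<Longrightarrow> e i = e' i) \<Longrightarrow> eval F e t = eval F e' t"
  by (induction t) (auto simp: list_all_iff intro!: arg_cong[of _ _ "F _"])

lemma sat_cong_wf:
  "wf_fm L n p \<Longrightarrow> (\<And>i. i < n \<Longrightarrow> e i = e' i) \<Longrightarrow> sat D F R e p \<longleftrightarrow> sat D F R e' p"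
proof (induction p arbitrary: n e e')
  case (Forall p)
  have "sat D F R (case_nat x e) p \<longleftrightarrow> sat D F R (case_nat x e') p" for x
    using Forall.prems by (intro Forall.IH[of "Suc n"]) (auto split: nat.split)
  then show ?case
    by simp
next
  case (Eq s t)
  then show ?case
    using eval_cong_wf[of L n _ e e' F] by auto
next
  case (Rel r ts)
  then have "map (eval F e) ts = map (eval F e') ts"
    using eval_cong_wf[of L n _ e e' F] by (auto simp: list_all_iff)
  then show ?case
    by (simp only: sat.simps)
next
  case (Imp p q)
  then show ?case
    by (metis sat.simps(4) wf_fm.simps(4))
qed auto

lemma wf_tm_mono: "wf_tm L n t \<Longrightarrow> n \<le> m \<Longrightarrow> funs L \<subseteq> funs L' \<Longrightarrow> wf_tm L' m t"
  by (induction t) (auto simp: list_all_iff)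

lemma wf_fm_mono:
  "wf_fm L n p \<Longrightarrow> n \<le> m \<Longrightarrow> funs L \<subseteq> funs L' \<Longrightarrow> rels L \<subseteq> rels L' \<Longrightarrow> wf_fm L' m p"
  by (induction p arbitrary: n m) (auto simp: list_all_iff intro: wf_tm_mono)

text \<open>Every symbol has every arity here, so \<open>wf_fm full_lang n p\<close> expresses just
  that the free variables of \<open>p\<close> are below \<open>n\<close>.\<close>

abbreviation full_lang :: "('f, 'r) language" where
  "full_lang \<equiv> \<lparr>funs = UNIV, rels = UNIV\<rparr>"

lemma wf_tm_full_mono: "wf_tm (full_lang :: ('f, 'r) language) n t \<Longrightarrow> n \<le> m
    \<Longrightarrow> wf_tm (full_lang :: ('f, 'r) language) m t"
  by (rule wf_tm_mono) auto

lemma wf_fm_full_mono: "wf_fm full_lang n p \<Longrightarrow> n \<le> m \<Longrightarrow> wf_fm full_lang m p"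
  by (rule wf_fm_mono) auto

lemma list_all_bounded:
  assumes "\<And>x. x \<in> set xs \<Longrightarrow> \<exists>n. P n x" "\<And>n m x. P n x \<Longrightarrow> n \<le> m \<Longrightarrow> P m x"
  shows "\<exists>n::nat. list_all (P n) xs"
  using assms(1)
proof (induction xs)
  case (Cons x xs)
  obtain n where "P n x"
    using Cons.prems by auto
  moreover obtain m where "list_all (P m) xs"
    using Cons by auto
  ultimately have "P (max n m) x" "list_all (P (max n m)) xs"
    using assms(2) by (auto simp: list_all_iff)
  then show ?case
    by auto
qed auto

lemma ex_wf_tm: "\<exists>n. wf_tm (full_lang :: ('f, 'r) language) n t"
proof (induction t)
  case (Fun f ts)
  have "\<exists>n. list_all (wf_tm (full_lang :: ('f, 'r) language) n) ts"
    by (rule list_all_bounded) (use Fun wf_tm_full_mono in blast)+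
  then show ?case
    by auto
qed auto

lemma ex_wf_fm: "\<exists>n. wf_fm full_lang n (p :: ('f, 'r) fm)"
proof (induction p)
  case (Eq s t)
  obtain n m where "wf_tm (full_lang :: ('f, 'r) language) n s" "wf_tm (full_lang :: ('f, 'r) language) m t"
    using ex_wf_tm by blast
  then have "wf_fm full_lang (max n m) (Eq s t :: ('f, 'r) fm)"
    by (auto intro: wf_tm_full_mono)
  then show ?case
    by blast
next
  case (Rel r ts)
  then show ?case
    using list_all_bounded[of ts "wf_tm (full_lang :: ('f, 'r) language)", OF ex_wf_tm wf_tm_full_mono]
    by simp
next
  case (Imp p q)
  then obtain n m where "wf_fm full_lang n p" "wf_fm full_lang m q"
    by blast
  then have "wf_fm full_lang (max n m) (Imp p q)"
    by (auto intro: wf_fm_full_mono)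
  then show ?case
    by blast
next
  case (Forall p)
  then obtain n where "wf_fm full_lang n p"
    by blast
  then have "wf_fm full_lang n (Forall p)"
    by (auto intro: wf_fm_full_mono)
  then show ?case
    by blast
qed auto

section \<open>Metatheory of the calculus: weakening, compactness, substitution,
  generalization\<close>

lemma deriv_mono: "\<Gamma> \<turnstile> p \<Longrightarrow> \<Gamma> \<subseteq> \<Delta> \<Longrightarrow> \<Delta> \<turnstile> p"
proof (induction arbitrary: \<Delta> rule: deriv.induct)
  case (ImpI p \<Gamma> q)
  then show ?case
    by (meson deriv.ImpI insert_mono)
next
  case (Contr p \<Gamma>)
  then show ?case
    by (meson deriv.Contr insert_mono)
next
  case (AllI \<Gamma> p)
  then show ?case
    by (meson deriv.AllI image_mono)
next
  case (Leibniz \<Gamma> s t p)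
  then show ?case
    by (blast intro: deriv.Leibniz)
qed (auto intro: deriv.intros)

lemma deriv_compact: "\<Gamma> \<turnstile> p \<Longrightarrow> \<exists>\<Delta>\<subseteq>\<Gamma>. finite \<Delta> \<and> \<Delta> \<turnstile> p"
proof (induction rule: deriv.induct)
  case (Hyp p \<Gamma>)
  then show ?case
    by (intro exI[of _ "{p}"]) (auto intro: deriv.Hyp)
next
  case (ImpI p \<Gamma> q)
  then obtain \<Delta> where "\<Delta> \<subseteq> insert p \<Gamma>" "finite \<Delta>" "\<Delta> \<turnstile> q"
    by auto
  then show ?case
    by (intro exI[of _ "\<Delta> - {p}"]) (auto intro!: deriv.ImpI intro: deriv_mono)
next
  case (ImpE \<Gamma> p q)
  then obtain \<Delta> \<Delta>' where "\<Delta> \<subseteq> \<Gamma>" "finite \<Delta>" "\<Delta> \<turnstile> Imp p q" "\<Delta>' \<subseteq> \<Gamma>" "finite \<Delta>'" "\<Delta>' \<turnstile> p"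
    by auto
  then show ?case
    by (intro exI[of _ "\<Delta> \<union> \<Delta>'"]) (auto intro!: deriv.ImpE[of _ p q] intro: deriv_mono)
next
  case (Contr p \<Gamma>)
  then obtain \<Delta> where \<Delta>: "\<Delta> \<subseteq> insert (Neg p) \<Gamma>" "finite \<Delta>" "\<Delta> \<turnstile> Fls"
    by auto
  have "insert (Neg p) (\<Delta> - {Neg p}) \<turnstile> Fls"
    using \<Delta>(3) by (rule deriv_mono) auto
  then have "\<Delta> - {Neg p} \<turnstile> p"
    by (rule deriv.Contr)
  then show ?case
    using \<Delta> by (intro exI[of _ "\<Delta> - {Neg p}"]) auto
next
  case (AllI \<Gamma> p)
  then obtain \<Delta> where "\<Delta> \<subseteq> \<Gamma>" "finite \<Delta>" "lift_fm ` \<Delta> \<turnstile> p"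
    using finite_subset_image by metis
  then show ?case
    by (auto intro: deriv.AllI)
next
  case (Leibniz \<Gamma> s t p)
  then obtain \<Delta> \<Delta>' where "\<Delta> \<subseteq> \<Gamma>" "finite \<Delta>" "\<Delta> \<turnstile> Eq s t" "\<Delta>' \<subseteq> \<Gamma>" "finite \<Delta>'" "\<Delta>' \<turnstile> inst p s"
    by auto
  then show ?case
    by (intro exI[of _ "\<Delta> \<union> \<Delta>'"]) (auto intro!: deriv.Leibniz[of _ s t p] intro: deriv_mono)
qed (auto intro: deriv.intros)

lemma subst_inst:
  "subst_fm \<sigma> (inst p t) = inst (subst_fm (case_nat (Var 0) (\<lambda>i. lift_tm (\<sigma> i))) p) (subst_tm \<sigma> t)"
proof -
  have "(\<lambda>i. subst_tm \<sigma> (case i of 0 \<Rightarrow> t | Suc x \<Rightarrow> Var x)) =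
     (\<lambda>i. subst_tm (case_nat (subst_tm \<sigma> t) Var)
           (case i of 0 \<Rightarrow> Var 0 | Suc i \<Rightarrow> lift_tm (\<sigma> i)))"
    by (auto simp: fun_eq_iff split: nat.split)
  then show ?thesis
    by (simp add: inst_def subst_fm_subst_fm)
qed

lemma inst_subst_up:
  "inst (subst_fm (case_nat (Var 0) (\<lambda>i. lift_tm (\<sigma> i))) p) t = subst_fm (case_nat t \<sigma>) p"
proof -
  have "(\<lambda>i. subst_tm (case_nat t Var) (case i of 0 \<Rightarrow> Var 0 | Suc i \<Rightarrow> lift_tm (\<sigma> i))) = case_nat t \<sigma>"
    by (auto simp: fun_eq_iff split: nat.split)
  then show ?thesis
    by (simp add: inst_def subst_fm_subst_fm)
qed

text \<open>Substitution under a quantifier commutes with lifting, which takes care of the lifted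
  hypotheses in \<open>AllI\<close>. The lemma makes it possible to rename free variables in a whole
  derivation.\<close>

lemma deriv_subst: "\<Gamma> \<turnstile> p \<Longrightarrow> subst_fm \<sigma> ` \<Gamma> \<turnstile> subst_fm \<sigma> p"
proof (induction arbitrary: \<sigma> rule: deriv.induct)
  case (AllI \<Gamma> p)
  let ?up = "case_nat (Var 0) (\<lambda>i. lift_tm (\<sigma> i))"
  have "subst_fm ?up (lift_fm q) = lift_fm (subst_fm \<sigma> q)" for q :: "('a, 'b) fm"
    by (simp add: lift_fm_def subst_fm_subst_fm) (simp add: lift_tm_def)
  then have "subst_fm ?up ` lift_fm ` \<Gamma> = lift_fm ` subst_fm \<sigma> ` \<Gamma>"
    by (simp add: image_image)
  then show ?case
    using AllI.IH[of ?up] by (auto intro: deriv.AllI)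
next
  case (AllE \<Gamma> p t)
  then show ?case
    by (auto simp: subst_inst intro: deriv.AllE)
next
  case (Leibniz \<Gamma> s t p)
  then show ?case
    by (auto simp: subst_inst intro: deriv.Leibniz)
qed (auto intro: deriv.intros)

text \<open>\<open>AllI\<close> lifts the hypotheses instead of using an eigenvariable. The renaming
  \<sigma> sends \<open>k\<close> to \<open>0\<close> and every other index to its successor. Since
  \<open>k\<close> does not occur in \<Gamma>, it acts there as lifting, and it turns the instance
  at \<open>k\<close> back into \<open>q\<close>.\<close>

lemma deriv_generalize:
  assumes "\<Gamma> \<turnstile> inst q (Var k)" "\<And>p. p \<in> \<Gamma> \<Longrightarrow> wf_fm full_lang k p" "wf_fm full_lang (Suc k) q"
  shows "\<Gamma> \<turnstile> Forall q"
proof -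
  define \<sigma> :: "nat \<Rightarrow> 'a tm" where "\<sigma> = (\<lambda>i. if i = k then Var 0 else Var (Suc i))"
  have "subst_fm \<sigma> p = lift_fm p" if "p \<in> \<Gamma>" for p
    using assms(2)[OF that] unfolding lift_fm_def by (rule subst_fm_cong_wf) (simp add: \<sigma>_def)
  then have "subst_fm \<sigma> ` \<Gamma> = lift_fm ` \<Gamma>"
    by auto
  moreover have "subst_fm \<sigma> (inst q (Var k)) = q"
  proof -
    have "subst_fm \<sigma> (inst q (Var k)) = subst_fm (\<lambda>i. subst_tm \<sigma> (case_nat (Var k) Var i)) q"
      by (simp add: inst_def subst_fm_subst_fm)
    also have "\<dots> = subst_fm Var q"
      using assms(3) by (rule subst_fm_cong_wf) (auto simp: \<sigma>_def split: nat.split)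
    finally show ?thesis
      by simp
  qed
  ultimately show ?thesis
    using deriv_subst[OF assms(1), of \<sigma>] by (auto intro: deriv.AllI)
qed

section \<open>Henkin completion and the term model\<close>

abbreviation consistent :: "('f, 'r) fm set \<Rightarrow> bool" where
  "consistent \<Gamma> \<equiv> \<not> \<Gamma> \<turnstile> Fls"

lemma deriv_Neg: "\<not> consistent (insert p \<Gamma>) \<Longrightarrow> \<Gamma> \<turnstile> Neg p"
  by (auto intro: deriv.ImpI)

lemma deriv_cut: "\<Gamma> \<turnstile> p \<Longrightarrow> insert p \<Gamma> \<turnstile> q \<Longrightarrow> \<Gamma> \<turnstile> q"
  by (meson deriv.ImpE deriv.ImpI)

definition fresh_for :: "('f, 'r) fm set \<Rightarrow> nat" where
  "fresh_for \<Gamma> = (SOME k. \<forall>p\<in>\<Gamma>. wf_fm full_lang k p)"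

definition henkin_step :: "('f, 'r) fm set \<Rightarrow> ('f, 'r) fm \<Rightarrow> ('f, 'r) fm set" where
  "henkin_step \<Gamma> p =
    (if consistent (insert p \<Gamma>)
     then insert p \<Gamma> \<union> {Neg (inst q (Var (fresh_for (insert p \<Gamma>)))) | q. p = Neg (Forall q)}
     else \<Gamma>)"

instance tm :: (countable) countable
  by countable_datatype

instance fm :: (countable, countable) countable
  by countable_datatype

primrec henkin_chain :: "('f::countable, 'r::countable) fm set \<Rightarrow> nat \<Rightarrow> ('f, 'r) fm set" where
  "henkin_chain \<Gamma> 0 = \<Gamma>"
| "henkin_chain \<Gamma> (Suc n) = henkin_step (henkin_chain \<Gamma> n) (from_nat n)"

definition bounded_vars :: "('f, 'r) fm set \<Rightarrow> bool" where
  "bounded_vars \<Gamma> \<longleftrightarrow> (\<exists>k. \<forall>p\<in>\<Gamma>. wf_fm full_lang k p)"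

lemma bounded_vars_insert: "bounded_vars \<Gamma> \<Longrightarrow> bounded_vars (insert p \<Gamma>)"
proof -
  assume "bounded_vars \<Gamma>"
  then obtain k where k: "\<forall>q\<in>\<Gamma>. wf_fm full_lang k q"
    by (auto simp: bounded_vars_def)
  obtain m where "wf_fm full_lang m p"
    using ex_wf_fm by blast
  then have "\<forall>q\<in>insert p \<Gamma>. wf_fm full_lang (max k m) q"
    using k by (auto intro: wf_fm_full_mono)
  then show ?thesis
    unfolding bounded_vars_def by blast
qed

lemma fresh_for: "bounded_vars \<Gamma> \<Longrightarrow> p \<in> \<Gamma> \<Longrightarrow> wf_fm full_lang (fresh_for \<Gamma>) p"
  unfolding bounded_vars_def fresh_for_def
  using someI_ex[of "\<lambda>k. \<forall>p\<in>\<Gamma>. wf_fm full_lang k p"] by blast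

lemma bounded_henkin_step: "bounded_vars \<Gamma> \<Longrightarrow> bounded_vars (henkin_step \<Gamma> p)"
proof -
  assume *: "bounded_vars \<Gamma>"
  show ?thesis
  proof (cases "\<exists>q. p = Neg (Forall q)")
    case True
    then obtain q where "p = Neg (Forall q)"
      by auto
    then have "insert p \<Gamma> \<union> {Neg (inst q (Var (fresh_for (insert p \<Gamma>)))) | q. p = Neg (Forall q)}
      = insert (Neg (inst q (Var (fresh_for (insert p \<Gamma>))))) (insert p \<Gamma>)"
      by auto
    then show ?thesis
      using * by (simp add: henkin_step_def bounded_vars_insert)
  next
    case False
    then show ?thesis
      using * by (auto simp: henkin_step_def bounded_vars_insert)
  qed
qed

text \<open>If the witness formula caused an inconsistency, \<Gamma> with \<open>p\<close> would
  prove the instance of \<open>q\<close> at a fresh variable, hence \<open>Forall q\<close> by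
  \<open>deriv_generalize\<close>, against \<open>p\<close> itself.\<close>

lemma consistent_henkin_step:
  assumes "bounded_vars \<Gamma>" "consistent \<Gamma>"
  shows "consistent (henkin_step \<Gamma> p)"
proof (cases "consistent (insert p \<Gamma>) \<and> (\<exists>q. p = Neg (Forall q))")
  case True
  then obtain q where q: "p = Neg (Forall q)"
    by auto
  let ?\<Gamma> = "insert p \<Gamma>"
  let ?k = "fresh_for ?\<Gamma>"
  have eq: "henkin_step \<Gamma> p = insert (Neg (inst q (Var ?k))) ?\<Gamma>"
    using True q by (auto simp: henkin_step_def)
  have b: "bounded_vars ?\<Gamma>"
    using assms(1) by (rule bounded_vars_insert)
  have "wf_fm full_lang (Suc ?k) q"
    using fresh_for[OF b, of p] q by simp
  moreover have "?\<Gamma> \<turnstile> Neg (Forall q)"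
    using q by (auto intro: deriv.Hyp)
  ultimately show ?thesis
    using True deriv_generalize[of ?\<Gamma> q ?k] fresh_for[OF b] unfolding eq
    by (metis deriv.Contr deriv.ImpE)
next
  case False
  then show ?thesis
    using assms by (auto simp: henkin_step_def)
qed

text \<open>A theory with an injective unary function that omits a value has only infinite models, so
  the countable term model can be taken to have all of \<^typ>\<open>nat\<close> as universe.\<close>

locale henkin =
  fixes \<Gamma> :: "('f::countable, 'r::countable) fm set" and f z :: 'f
  assumes bounded: "bounded_vars \<Gamma>"
    and consistent: "consistent \<Gamma>"
    and inj: "\<And>s t. \<Gamma> \<turnstile> Imp (Eq (Fun f [s]) (Fun f [t])) (Eq s t)"
    and omit: "\<And>t. \<Gamma> \<turnstile> Neg (Eq (Fun f [t]) (Fun z []))"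
begin

definition H :: "('f, 'r) fm set" where
  "H = (\<Union>n. henkin_chain \<Gamma> n)"

lemma chain: "bounded_vars (henkin_chain \<Gamma> n) \<and> consistent (henkin_chain \<Gamma> n)"
  by (induction n) (auto simp: bounded consistent bounded_henkin_step consistent_henkin_step)

lemma chain_mono: "m \<le> n \<Longrightarrow> henkin_chain \<Gamma> m \<subseteq> henkin_chain \<Gamma> n"
proof (induction rule: dec_induct)
  case (step n)
  then show ?case
    by (auto simp: henkin_step_def)
qed auto

lemma finite_subset_chain: "finite \<Delta> \<Longrightarrow> \<Delta> \<subseteq> H \<Longrightarrow> \<exists>n. \<Delta> \<subseteq> henkin_chain \<Gamma> n"
proof (induction rule: finite_induct)
  case (insert p \<Delta>)
  then obtain n m where "\<Delta> \<subseteq> henkin_chain \<Gamma> n" "p \<in> henkin_chain \<Gamma> m"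
    by (auto simp: H_def)
  then have "insert p \<Delta> \<subseteq> henkin_chain \<Gamma> (max n m)"
    using chain_mono[of n "max n m"] chain_mono[of m "max n m"] by auto
  then show ?case
    by blast
qed auto

lemma consistent_H: "consistent H"
proof
  assume "H \<turnstile> Fls"
  then obtain \<Delta> where \<Delta>: "\<Delta> \<subseteq> H" "finite \<Delta>" "\<Delta> \<turnstile> Fls"
    using deriv_compact by blast
  then obtain n where "\<Delta> \<subseteq> henkin_chain \<Gamma> n"
    using finite_subset_chain by blast
  with \<Delta>(3) have "henkin_chain \<Gamma> n \<turnstile> Fls"
    by (rule deriv_mono)
  then show False
    using chain[of n] by simp
qed

lemma chain_subset: "henkin_chain \<Gamma> n \<subseteq> H"
  by (auto simp: H_def)

lemma subset_H: "\<Gamma> \<subseteq> H"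
  using chain_subset[of 0] by simp

text \<open>Being consistent with all of \<open>H\<close>, \<open>p\<close> is also consistent with
  the stage at which it is enumerated; that stage adds \<open>p\<close> and, in the same step, a
  witness if \<open>p\<close> is a negated quantifier.\<close>

lemma H_maximal:
  assumes "consistent (insert p H)"
  shows "p \<in> H" and "p = Neg (Forall q) \<Longrightarrow> \<exists>t. Neg (inst q t) \<in> H"
proof -
  obtain n where n: "p = from_nat n"
    by (metis from_nat_to_nat)
  have "consistent (insert p (henkin_chain \<Gamma> n))"
    using assms deriv_mono[of "insert p (henkin_chain \<Gamma> n)" Fls "insert p H"] chain_subset[of n] by auto
  then have *: "insert p (henkin_chain \<Gamma> n)
      \<union> {Neg (inst q (Var (fresh_for (insert p (henkin_chain \<Gamma> n))))) | q. p = Neg (Forall q)} \<subseteq> H"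
    using chain_subset[of "Suc n"] by (simp only: henkin_chain.simps henkin_step_def n[symmetric]
        if_True not_False_eq_True)
  then show "p \<in> H"
    by (simp only: Un_insert_left insert_subset)
  show "\<exists>t. Neg (inst q t) \<in> H" if "p = Neg (Forall q)"
    using * that by blast
qed

lemma H_closed: "H \<turnstile> p \<Longrightarrow> p \<in> H"
  using H_maximal(1)[of p] consistent_H deriv_cut[of H p Fls] by metis

lemma H_Neg: "Neg p \<in> H \<longleftrightarrow> p \<notin> H"
proof
  assume "Neg p \<in> H"
  then have *: "H \<turnstile> Neg p"
    by (rule deriv.Hyp)
  show "p \<notin> H"
    using consistent_H deriv.ImpE[OF * deriv.Hyp] by metis
next
  assume "p \<notin> H"
  then have "\<not> consistent (insert p H)"
    using H_maximal(1) by metis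
  then show "Neg p \<in> H"
    by (intro H_closed deriv_Neg)
qed

lemma H_Imp: "Imp p q \<in> H \<longleftrightarrow> (p \<in> H \<longrightarrow> q \<in> H)"
proof
  assume "p \<in> H \<longrightarrow> q \<in> H"
  then have "Neg p \<in> H \<or> q \<in> H"
    using H_Neg by auto
  then have "insert p H \<turnstile> q"
  proof
    assume "Neg p \<in> H"
    then have "insert (Neg q) (insert p H) \<turnstile> Fls"
      by (intro deriv.ImpE[of _ p Fls]) (auto intro: deriv.Hyp)
    then show ?thesis
      by (rule deriv.Contr)
  qed (auto intro: deriv.Hyp)
  then show "Imp p q \<in> H"
    by (intro H_closed deriv.ImpI)
qed (blast intro: H_closed deriv.Hyp deriv.ImpE)

lemma H_Forall: "Forall q \<in> H \<longleftrightarrow> (\<forall>t. inst q t \<in> H)"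
proof
  assume "\<forall>t. inst q t \<in> H"
  then have "\<forall>t. Neg (inst q t) \<notin> H"
    using H_Neg by auto
  then have "insert (Neg (Forall q)) H \<turnstile> Fls"
    using H_maximal(2) by blast
  then show "Forall q \<in> H"
    by (rule H_closed[OF deriv.Contr])
qed (blast intro: H_closed deriv.Hyp deriv.AllE)

definition eqv :: "'f tm \<Rightarrow> 'f tm \<Rightarrow> bool" (infix "\<approx>" 50) where
  "s \<approx> t \<longleftrightarrow> Eq s t \<in> H"

lemma eqv_refl: "t \<approx> t"
  unfolding eqv_def by (intro H_closed deriv.Refl)

lemma eqv_Leibniz: "s \<approx> t \<Longrightarrow> inst p s \<in> H \<Longrightarrow> inst p t \<in> H"
  unfolding eqv_def by (blast intro: H_closed deriv.Hyp deriv.Leibniz)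

lemma inst_lift_tm [simp]: "subst_tm (case_nat t Var) \<circ> lift_tm = id"
  by (auto simp: fun_eq_iff)

lemma eqv_sym: "s \<approx> t \<Longrightarrow> t \<approx> s"
  using eqv_Leibniz[of s t "Eq (Var 0) (lift_tm s)"] eqv_refl[of s] by (simp add: inst_def eqv_def)

lemma eqv_trans: "s \<approx> t \<Longrightarrow> t \<approx> u \<Longrightarrow> s \<approx> u"
  using eqv_Leibniz[of t u "Eq (lift_tm s) (Var 0)"] by (simp add: inst_def eqv_def)

lemma eqv_Fun_one: "s \<approx> t \<Longrightarrow> Fun g (xs @ s # ys) \<approx> Fun g (xs @ t # ys)"
  using eqv_Leibniz[of s t
      "Eq (lift_tm (Fun g (xs @ s # ys))) (Fun g (map lift_tm xs @ Var 0 # map lift_tm ys))"]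
    eqv_refl[of "Fun g (xs @ s # ys)"]
  by (simp add: inst_def eqv_def del: subst_tm.simps(2)) (simp add: comp_def)

text \<open>The prefix \<open>xs\<close> collects the arguments already replaced, so that the
  induction replaces one argument at a time.\<close>

lemma eqv_Fun: "list_all2 (\<approx>) ss ts \<Longrightarrow> Fun g (xs @ ss) \<approx> Fun g (xs @ ts)"
proof (induction arbitrary: xs rule: list_all2_induct)
  case (Cons s ss t ts)
  then have "Fun g ((xs @ [t]) @ ss) \<approx> Fun g ((xs @ [t]) @ ts)"
    by blast
  then show ?case
    using eqv_trans[OF eqv_Fun_one[OF Cons(1), of g xs ss]] by simp
qed (simp add: eqv_refl)

lemma eqv_Rel: "list_all2 (\<approx>) ss ts \<Longrightarrow> Rel r (xs @ ss) \<in> H \<Longrightarrow> Rel r (xs @ ts) \<in> H"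
proof (induction arbitrary: xs rule: list_all2_induct)
  case (Cons s ss t ts)
  have "Rel r (xs @ t # ss) \<in> H"
    using eqv_Leibniz[OF Cons(1), of "Rel r (map lift_tm xs @ Var 0 # map lift_tm ss)"] Cons.prems
    by (simp add: inst_def comp_def)
  then show ?case
    using Cons.IH[of "xs @ [t]"] by simp
qed simp

text \<open>\<open>h\<close> numbers the classes of \<open>\<approx>\<close>. Terms are countable,
  and the numerals \<open>num n\<close> lie in distinct classes, so the classes are in bijection
  with the natural numbers.\<close>

lemma ex_enumeration:
  "\<exists>h :: 'f tm \<Rightarrow> nat. surj h \<and> (\<forall>s t. h s = h t \<longleftrightarrow> s \<approx> t)"
proof -
  define r where "r = {(s, t). s \<approx> t}"
  have "equiv UNIV r"
    unfolding r_def equiv_def refl_on_def sym_def trans_def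
    by (auto intro: eqv_refl eqv_sym eqv_trans)
  then have r: "r `` {s} = r `` {t} \<longleftrightarrow> s \<approx> t" for s t
    using eq_equiv_class_iff[of UNIV r s t] by (simp add: r_def)
  define num where "num n = ((\<lambda>t. Fun f [t]) ^^ n) (Fun z [])" for n
  have num_eq: "num m \<approx> num n \<longleftrightarrow> m = n" for m n
  proof
    show "num m \<approx> num n \<Longrightarrow> m = n"
    proof (induction m arbitrary: n)
      case 0
      have "\<not> Fun f [t] \<approx> Fun z []" for t
        using H_closed[OF deriv_mono[OF omit subset_H]] H_Neg by (auto simp: eqv_def)
      then show ?case
        using 0 eqv_sym by (cases n) (auto simp: num_def)
    next
      case (Suc m)
      have *: "\<not> Fun f [t] \<approx> Fun z []" for t
        using H_closed[OF deriv_mono[OF omit subset_H]] H_Neg by (auto simp: eqv_def)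
      have "s \<approx> t" if "Fun f [s] \<approx> Fun f [t]" for s t
        using H_closed[OF deriv_mono[OF inj subset_H]] that H_Imp by (auto simp: eqv_def)
      then show ?case
        using Suc * by (cases n) (auto simp: num_def)
    qed
  qed (simp add: eqv_refl)
  have "inj (\<lambda>n. r `` {num n})"
    by (auto simp: inj_def r num_eq)
  then have "infinite (range (\<lambda>n. r `` {num n}))"
    using finite_imageD infinite_UNIV_nat by blast
  moreover have "range (\<lambda>n. r `` {num n}) \<subseteq> UNIV // r"
    by (auto intro: quotientI)
  ultimately have "infinite (UNIV // r)"
    using finite_subset by blast
  moreover have "countable (UNIV // r)"
    by (auto simp: quotient_def)
  ultimately obtain b :: "'f tm set \<Rightarrow> nat" where b: "bij_betw b (UNIV // r) UNIV"
    using countableE_infinite by blast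
  define h where "h t = b (r `` {t})" for t
  have "h s = h t \<longleftrightarrow> s \<approx> t" for s t
    unfolding h_def r[symmetric]
    by (rule inj_on_eq_iff[OF bij_betw_imp_inj_on[OF b]]) (auto intro: quotientI)
  moreover have "surj h"
  proof -
    have "y \<in> range h" for y
    proof -
      obtain c where "c \<in> UNIV // r" "y = b c"
        using bij_betw_imp_surj_on[OF b] by blast
      then show ?thesis
        by (auto simp: h_def quotient_def)
    qed
    then show ?thesis
      by blast
  qed
  ultimately show ?thesis
    by blast
qed

theorem term_model:
  "\<exists>(F :: 'f \<Rightarrow> nat list \<Rightarrow> nat) R e. \<forall>p\<in>\<Gamma>. sat UNIV F R e p"
proof -
  obtain h :: "'f tm \<Rightarrow> nat" where h: "surj h" "\<And>s t. h s = h t \<longleftrightarrow> s \<approx> t"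
    using ex_enumeration by blast
  \<comment> \<open>\<open>g\<close> picks a term for each number; by congruence the interpretations
    of the symbols do not depend on the choice.\<close>
  define g where "g = inv h"
  have hg: "h (g n) = n" for n
    using h(1) by (simp add: g_def surj_f_inv_f)
  have gh: "list_all2 (\<approx>) (map (g \<circ> h) ts) ts" for ts
    by (auto simp: list_all2_conv_all_nth h(2)[symmetric] hg)
  have gh': "list_all2 (\<approx>) ts (map (g \<circ> h) ts)" for ts
    by (auto simp: list_all2_conv_all_nth h(2)[symmetric] hg)
  define F where "F k ns = h (Fun k (map g ns))" for k ns
  define R where "R k ns \<longleftrightarrow> Rel k (map g ns) \<in> H" for k ns
  have eval: "eval F (h \<circ> \<sigma>) t = h (subst_tm \<sigma> t)" for \<sigma> t
  proof (induction t)
    case (Fun k ts)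
    then have "map (eval F (h \<circ> \<sigma>)) ts = map h (map (subst_tm \<sigma>) ts)"
      by (simp add: comp_def)
    then have "eval F (h \<circ> \<sigma>) (Fun k ts) = h (Fun k (map (g \<circ> h) (map (subst_tm \<sigma>) ts)))"
      unfolding eval.simps F_def by (simp only: map_map comp_assoc)
    also have "\<dots> = h (Fun k (map (subst_tm \<sigma>) ts))"
      unfolding h(2) using eqv_Fun[OF gh, of k "[]"] by (simp only: append_Nil)
    finally show ?case
      by (simp only: subst_tm.simps)
  qed simp
  \<comment> \<open>Truth lemma for all substitutions at once: an environment is a substitution
    followed by \<open>h\<close>, and the quantifier case extends both by the same term.\<close>
  have "sat UNIV F R (h \<circ> \<sigma>) p \<longleftrightarrow> subst_fm \<sigma> p \<in> H" for p \<sigma>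
  proof (induction p arbitrary: \<sigma>)
    case (Eq s t)
    then show ?case
      unfolding sat.simps eval subst_fm.simps by (simp add: h(2) eqv_def)
  next
    case (Rel k ts)
    have "map g (map (eval F (h \<circ> \<sigma>)) ts) = map (g \<circ> h) (map (subst_tm \<sigma>) ts)"
      by (simp add: eval)
    then have "sat UNIV F R (h \<circ> \<sigma>) (Rel k ts) \<longleftrightarrow> Rel k (map (g \<circ> h) (map (subst_tm \<sigma>) ts)) \<in> H"
      unfolding sat.simps R_def by (rule arg_cong)
    also have "\<dots> \<longleftrightarrow> Rel k (map (subst_tm \<sigma>) ts) \<in> H"
      using eqv_Rel[OF gh, of k "[]"] eqv_Rel[OF gh', of k "[]"] unfolding append_Nil by (rule iffI)
    finally show ?case
      by (simp only: subst_fm.simps)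
  next
    case Fls
    then show ?case
      using consistent_H deriv.Hyp by auto
  next
    case (Imp p q)
    then show ?case
      by (simp add: H_Imp)
  next
    case (Forall p)
    have *: "case_nat (h t) (h \<circ> \<sigma>) = h \<circ> case_nat t \<sigma>" for t
      by (auto simp: fun_eq_iff split: nat.split)
    have "sat UNIV F R (h \<circ> \<sigma>) (Forall p) \<longleftrightarrow> (\<forall>t. sat UNIV F R (case_nat (h t) (h \<circ> \<sigma>)) p)"
      using h(1) by (metis UNIV_I sat.simps(5) surjD)
    also have "\<dots> \<longleftrightarrow> (\<forall>t. subst_fm (case_nat t \<sigma>) p \<in> H)"
      unfolding * Forall.IH ..
    also have "\<dots> \<longleftrightarrow> subst_fm \<sigma> (Forall p) \<in> H"
      by (simp add: H_Forall inst_subst_up)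
    finally show ?case .
  qed
  from this[of Var] show ?thesis
    using subset_H by (metis subst_fm_Var subsetD)
qed

end

text \<open>The term model of \<Gamma> with \<open>Neg p\<close> would be a countermodel. Closedness
  of \<Gamma> turns satisfaction in one environment into satisfaction in all, as the premise of
  \<open>valid\<close> demands.\<close>

theorem completeness:
  fixes p :: "('f::countable, 'r::countable) fm"
  assumes closed: "\<And>q. q \<in> \<Gamma> \<Longrightarrow> wf_fm full_lang 0 q"
    and inj: "\<And>s t. \<Gamma> \<turnstile> Imp (Eq (Fun f [s]) (Fun f [t])) (Eq s t)"
    and omit: "\<And>t. \<Gamma> \<turnstile> Neg (Eq (Fun f [t]) (Fun z []))"
    and valid: "\<And>(F :: 'f \<Rightarrow> nat list \<Rightarrow> nat) R e.
      (\<And>q e. q \<in> \<Gamma> \<Longrightarrow> sat UNIV F R e q) \<Longrightarrow> sat UNIV F R e p"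
  shows "\<Gamma> \<turnstile> p"
proof (rule ccontr)
  assume *: "\<not> \<Gamma> \<turnstile> p"
  have "henkin (insert (Neg p) \<Gamma>) f z"
  proof
    show "bounded_vars (insert (Neg p) \<Gamma>)"
      using closed by (intro bounded_vars_insert) (auto simp: bounded_vars_def)
    show "consistent (insert (Neg p) \<Gamma>)"
      using * deriv.Contr by blast
  qed (use inj omit in \<open>auto intro: deriv_mono\<close>)
  then obtain F :: "'f \<Rightarrow> nat list \<Rightarrow> nat" and R e where m: "\<And>q. q \<in> insert (Neg p) \<Gamma> \<Longrightarrow> sat UNIV F R e q"
    using henkin.term_model by blast
  have "sat UNIV F R e' q" if "q \<in> \<Gamma>" for q e'
    using m[of q] that sat_cong_wf[OF closed[OF that], of e e'] by auto
  then have "sat UNIV F R e p"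
    by (rule valid)
  then show False
    using m[of "Neg p"] by simp
qed

section \<open>Translations and definability\<close>

definition prepend :: "'a list \<Rightarrow> (nat \<Rightarrow> 'a) \<Rightarrow> nat \<Rightarrow> 'a" where
  "prepend vs e i = (if i < length vs then vs ! i else e (i - length vs))"

lemma prepend_Nil [simp]: "prepend [] e = e"
  by (simp add: prepend_def fun_eq_iff)

lemma prepend_less [simp]: "i < length vs \<Longrightarrow> prepend vs e i = vs ! i"
  by (simp add: prepend_def)

lemma prepend_ge [simp]: "prepend vs e (i + length vs) = e i"
  by (simp add: prepend_def)

text \<open>The outermost quantifier of a block binds its highest index, so splitting it off removes
  the last value of the list.\<close>

lemma prepend_snoc: "prepend (vs @ [x]) e = prepend vs (case_nat x e)"
proof
  fix i
  consider "i < length vs" | "i = length vs" | d where "i = Suc (length vs + d)"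
    using less_imp_Suc_add linorder_less_linear by blast
  then show "prepend (vs @ [x]) e i = prepend vs (case_nat x e) i"
    by cases (auto simp: prepend_def nth_append Suc_diff_le)
qed

lemma sat_exs:
  "sat UNIV F R e (exs n p) \<longleftrightarrow> (\<exists>vs. length vs = n \<and> sat UNIV F R (prepend vs e) p)"
proof (induction n arbitrary: e)
  case 0
  then show ?case
    by (auto simp: exs_def)
next
  case (Suc n)
  have "sat UNIV F R e (exs (Suc n) p) \<longleftrightarrow> (\<exists>x. sat UNIV F R (case_nat x e) (exs n p))"
    by (simp add: exs_def)
  also have "\<dots> \<longleftrightarrow> (\<exists>vs. length vs = Suc n \<and> sat UNIV F R (prepend vs e) p)"
    unfolding Suc prepend_snoc[symmetric] length_Suc_conv_rev by blast
  finally show ?case .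
qed

lemma sat_alls:
  "sat UNIV F R e (alls n p) \<longleftrightarrow> (\<forall>vs. length vs = n \<longrightarrow> sat UNIV F R (prepend vs e) p)"
proof (induction n arbitrary: e)
  case 0
  then show ?case
    by (auto simp: alls_def)
next
  case (Suc n)
  have "sat UNIV F R e (alls (Suc n) p) \<longleftrightarrow> (\<forall>x. sat UNIV F R (case_nat x e) (alls n p))"
    by (simp add: alls_def)
  also have "\<dots> \<longleftrightarrow> (\<forall>vs. length vs = Suc n \<longrightarrow> sat UNIV F R (prepend vs e) p)"
    unfolding Suc prepend_snoc[symmetric] length_Suc_conv_rev by blast
  finally show ?case .
qed

lemma sat_conjs: "sat D F R e (conjs ps) \<longleftrightarrow> (\<forall>p\<in>set ps. sat D F R e p)"
  by (induction ps) (auto simp: conjs_def)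

lemma sat_app:
  assumes "wf_fm K (length ks) p"
  shows "sat D F R e (app p ks) \<longleftrightarrow> sat D F R ((!) (map e ks)) p"
  unfolding app_def sat_subst by (rule sat_cong_wf[OF assms]) simp

text \<open>The semantic side of an interpretation: \<open>D\<close> and \<open>G\<close> are the
  domain and the operations that the formulas of \<tau> define in the ambient model.
  \<open>G\<close> is a function on the whole type but is constrained only for arguments in
  \<open>D\<close>.\<close>

locale translation_model =
  fixes \<tau> :: "('f, 'r, 'g, 's) translation" and L :: "('f, 'r) language" and K :: "('g, 's) language"
    and F :: "'g \<Rightarrow> 'a list \<Rightarrow> 'a" and R :: "'s \<Rightarrow> 'a list \<Rightarrow> bool" and G :: "'f \<Rightarrow> 'a list \<Rightarrow> 'a"
    and D :: "'a set"
  assumes wf: "wf_translation \<tau> L K"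
    and no_rels: "rels L = {}"
    and dom: "\<And>x. sat UNIV F R ((!) [x]) (dom_fm \<tau>) \<longleftrightarrow> x \<in> D"
    and closed: "\<And>f n xs. (f, n) \<in> funs L \<Longrightarrow> length xs = n \<Longrightarrow> set xs \<subseteq> D \<Longrightarrow> G f xs \<in> D"
    and graph: "\<And>f n xs y. (f, n) \<in> funs L \<Longrightarrow> length xs = n \<Longrightarrow> set xs \<subseteq> D \<Longrightarrow> y \<in> D \<Longrightarrow>
      sat UNIV F R ((!) (xs @ [y])) (fun_fm \<tau> f n) \<longleftrightarrow> y = G f xs"
begin

lemma wf_dom: "wf_fm K 1 (dom_fm \<tau>)"
  and wf_fun: "(f, n) \<in> funs L \<Longrightarrow> wf_fm K (Suc n) (fun_fm \<tau> f n)"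
  using wf by (auto simp: wf_translation_def)

lemma sat_in_dom: "sat UNIV F R e (in_dom \<tau> k) \<longleftrightarrow> e k \<in> D"
  by (subst sat_app[of K]) (use wf_dom dom in auto)

lemma sat_fun:
  "(f, n) \<in> funs L \<Longrightarrow> length ks = n \<Longrightarrow> e ` set ks \<subseteq> D \<Longrightarrow> e j \<in> D \<Longrightarrow>
    sat UNIV F R e (app (fun_fm \<tau> f n) (ks @ [j])) \<longleftrightarrow> e j = G f (map e ks)"
  by (subst sat_app[of K]) (use wf_fun graph[of f n "map e ks" "e j"] in auto)

lemma sat_with_args:
  assumes "length gs = n"
  shows "sat UNIV F R e (with_args \<tau> gs k p) \<longleftrightarrow>
    (\<exists>vs. length vs = n \<and> set vs \<subseteq> D \<and>
      (\<forall>i<n. sat UNIV F R (prepend vs e) ((gs ! i) (k + n) i)) \<and> sat UNIV F R (prepend vs e) p)"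
proof -
  have set: "set (map2 (\<lambda>g i. Con (in_dom \<tau> i) (g (k + n) i)) gs [0..<n])
      = (\<lambda>i. Con (in_dom \<tau> i) ((gs ! i) (k + n) i)) ` {..<n}"
    using assms by (force simp: set_conv_nth)
  show ?thesis
    unfolding with_args_def Let_def assms sat_exs
    by (rule ex_cong1, simp only: sat.simps sat_conjs set sat_in_dom)
      (auto simp: subset_iff in_set_conv_nth sat_in_dom)
qed

lemma eval_closed: "wf_tm L n t \<Longrightarrow> (\<And>i. i < n \<Longrightarrow> e i \<in> D) \<Longrightarrow> eval G e t \<in> D"
  by (induction t) (auto simp: list_all_iff intro!: closed)

text \<open>By \<open>graph\<close> and induction, each existentially quantified argument is forced
  to be the value of its subterm, so unravelling a term into relations preserves its
  meaning.\<close>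

lemma sat_tr_tm:
  "wf_tm L n t \<Longrightarrow> (\<And>i. i < n \<Longrightarrow> e (i + k) \<in> D) \<Longrightarrow> e y \<in> D \<Longrightarrow>
    sat UNIV F R e (tr_tm \<tau> t k y) \<longleftrightarrow> e y = eval G (\<lambda>i. e (i + k)) t"
proof (induction t arbitrary: e k y)
  case (Var x)
  then show ?case
    by auto
next
  case (Fun f ts)
  let ?n = "length ts" and ?e = "\<lambda>i. e (i + k)"
  have f: "(f, ?n) \<in> funs L" and ts: "\<And>t. t \<in> set ts \<Longrightarrow> wf_tm L n t"
    using Fun.prems(1) by (auto simp: list_all_iff)
  have shift: "prepend vs e (i + (k + ?n)) = e (i + k)" if "length vs = ?n" for vs i
    using prepend_ge[of vs e "i + k"] that by (simp add: add.assoc)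
  have args: "sat UNIV F R (prepend vs e) ((map (tr_tm \<tau>) ts ! i) (k + ?n) i) \<longleftrightarrow> vs ! i = eval G ?e (ts ! i)"
    if "length vs = ?n" "set vs \<subseteq> D" "i < ?n" for vs i
  proof -
    have "sat UNIV F R (prepend vs e) (tr_tm \<tau> (ts ! i) (k + ?n) i) \<longleftrightarrow>
        prepend vs e i = eval G (\<lambda>j. prepend vs e (j + (k + ?n))) (ts ! i)"
      using that Fun.prems ts by (intro Fun.IH) (auto simp: shift)
    then show ?thesis
      using that by (simp add: shift)
  qed
  have val: "sat UNIV F R (prepend vs e) (app (fun_fm \<tau> f ?n) ([0..<?n] @ [y + ?n])) \<longleftrightarrow> e y = G f vs"
    if "length vs = ?n" "set vs \<subseteq> D" for vs
  proof -
    have "map (prepend vs e) [0..<?n] = vs"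
      using that by (intro nth_equalityI) auto
    moreover have "prepend vs e (y + ?n) = e y"
      using prepend_ge[of vs e y] that by simp
    ultimately show ?thesis
      using sat_fun[of f ?n "[0..<?n]" "prepend vs e" "y + ?n"] f that Fun.prems(3)
      by (metis image_set length_upt minus_nat.diff_0)
  qed
  have "sat UNIV F R e (tr_tm \<tau> (Fun f ts) k y) \<longleftrightarrow>
      (\<exists>vs. length vs = ?n \<and> set vs \<subseteq> D \<and> (\<forall>i<?n. vs ! i = eval G ?e (ts ! i)) \<and> e y = G f vs)"
    unfolding tr_tm.simps sat_with_args[of "map (tr_tm \<tau>) ts" ?n, OF length_map]
    using args val by (intro ex_cong1) auto
  also have "\<dots> \<longleftrightarrow> e y = G f (map (eval G ?e) ts)"
  proof
    assume "\<exists>vs. length vs = ?n \<and> set vs \<subseteq> D \<and> (\<forall>i<?n. vs ! i = eval G ?e (ts ! i)) \<and> e y = G f vs"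
    then obtain vs where vs: "length vs = ?n" "\<forall>i<?n. vs ! i = eval G ?e (ts ! i)" "e y = G f vs"
      by auto
    from vs(1,2) have "vs = map (eval G ?e) ts"
      by (intro nth_equalityI) auto
    then show "e y = G f (map (eval G ?e) ts)"
      using vs(3) by simp
  next
    assume "e y = G f (map (eval G ?e) ts)"
    moreover have "set (map (eval G ?e) ts) \<subseteq> D"
      using Fun.prems ts by (auto intro: eval_closed)
    ultimately show "\<exists>vs. length vs = ?n \<and> set vs \<subseteq> D \<and> (\<forall>i<?n. vs ! i = eval G ?e (ts ! i)) \<and> e y = G f vs"
      by (intro exI[of _ "map (eval G ?e) ts"]) auto
  qed
  finally show ?case
    by simp
qed

text \<open>The relativized quantifiers match the range \<open>D\<close> of \<open>sat\<close>, and
  the arguments of an equation are forced to be the values of its terms by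
  \<open>sat_tr_tm\<close>.\<close>

lemma sat_tr_fm:
  "wf_fm L n p \<Longrightarrow> (\<And>i. i < n \<Longrightarrow> e i \<in> D) \<Longrightarrow> sat UNIV F R e (tr_fm \<tau> p) \<longleftrightarrow> sat D G R' e p"
proof (induction p arbitrary: n e)
  case (Eq s t)
  have shift: "prepend vs e (i + 2) = e i" if "length vs = 2" for vs i
    using prepend_ge[of vs e i] that by simp
  have args: "sat UNIV F R (prepend vs e) (([tr_tm \<tau> s, tr_tm \<tau> t] ! i) 2 i) \<longleftrightarrow>
      vs ! i = eval G e ([s, t] ! i)" if "length vs = 2" "set vs \<subseteq> D" "i < 2" for vs i
  proof -
    have eq: "[tr_tm \<tau> s, tr_tm \<tau> t] ! i = tr_tm \<tau> ([s, t] ! i)"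
      using that(3) by (simp add: nth_Cons')
    have "sat UNIV F R (prepend vs e) (tr_tm \<tau> ([s, t] ! i) 2 i) \<longleftrightarrow>
        prepend vs e i = eval G (\<lambda>j. prepend vs e (j + 2)) ([s, t] ! i)"
      using that Eq.prems by (intro sat_tr_tm[of n]) (auto simp: shift nth_Cons' simp del: add_2_eq_Suc')
    then show ?thesis
      unfolding eq using that by (simp add: shift del: add_2_eq_Suc')
  qed
  have "sat UNIV F R e (tr_fm \<tau> (Eq s t)) \<longleftrightarrow>
    (\<exists>vs. length vs = 2 \<and> set vs \<subseteq> D \<and> (\<forall>i<2. vs ! i = eval G e ([s, t] ! i)) \<and> vs ! 0 = vs ! 1)"
    unfolding tr_fm.simps
    by (subst sat_with_args[of _ 2], simp, intro ex_cong1) (use args in \<open>auto simp del: add_2_eq_Suc'\<close>)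
  also have "\<dots> \<longleftrightarrow> eval G e s = eval G e t"
  proof
    assume "eval G e s = eval G e t"
    then show "\<exists>vs. length vs = 2 \<and> set vs \<subseteq> D \<and> (\<forall>i<2. vs ! i = eval G e ([s, t] ! i)) \<and> vs ! 0 = vs ! 1"
      using Eq.prems by (intro exI[of _ "[eval G e s, eval G e t]"])
        (auto simp: less_2_cases_iff intro: eval_closed)
  next
    assume "\<exists>vs. length vs = 2 \<and> set vs \<subseteq> D \<and> (\<forall>i<2. vs ! i = eval G e ([s, t] ! i)) \<and> vs ! 0 = vs ! 1"
    then obtain vs where "\<forall>i<2. vs ! i = eval G e ([s, t] ! i)" "vs ! 0 = vs ! 1"
      by blast
    from this(1)[rule_format, of 0] this(1)[rule_format, of 1] this(2)
    show "eval G e s = eval G e t"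
      by simp
  qed
  finally show ?case
    by simp
next
  case (Rel r ts)
  then show ?case
    using no_rels by simp
next
  case (Imp p q)
  then show ?case
    using Imp.IH[of n e] by simp
next
  case (Forall p)
  have "sat UNIV F R (case_nat x e) (tr_fm \<tau> p) \<longleftrightarrow> sat D G R' (case_nat x e) p" if "x \<in> D" for x
    using Forall.prems that by (intro Forall.IH[of "Suc n"]) (auto split: nat.split)
  then show ?case
    by (auto simp: sat_in_dom)
qed simp

lemma sat_total_functional:
  assumes "(f, n) \<in> funs L"
  shows "sat UNIV F R e (total_functional \<tau> f n)"
proof -
  \<comment> \<open>Below one or two further quantifiers the arguments have moved from the indices
    \<open>[0..<n]\<close> to \<open>[1..<n + 1]\<close> or \<open>[2..<n + 2]\<close>.\<close>
  have eq0: "map (case_nat y (prepend vs e)) [1..<n + 1] = vs" if "length vs = n" for vs y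
    using that by (intro nth_equalityI) (auto simp del: upt_Suc)
  have eq1: "map (case_nat y' (case_nat y (prepend vs e))) [2..<n + 2] = vs" if "length vs = n" for vs y y'
    using that by (intro nth_equalityI) (auto simp: numeral_2_eq_2 simp del: upt_Suc)
  have ex: "sat UNIV F R (case_nat y (prepend vs e)) (app (fun_fm \<tau> f n) ([1..<n + 1] @ [0])) \<longleftrightarrow> y = G f vs"
    if "length vs = n" "set vs \<subseteq> D" "y \<in> D" for vs y
    using sat_fun[of f n "[1..<n + 1]" "case_nat y (prepend vs e)" 0] assms that eq0[of vs y]
    by (metis add_diff_cancel_right' image_set length_upt nat.case(1))
  have uniq: "sat UNIV F R (case_nat y' (case_nat y (prepend vs e)))
        (app (fun_fm \<tau> f n) ([2..<n + 2] @ [j])) \<longleftrightarrow> case_nat y' (case_nat y (prepend vs e)) j = G f vs"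
    if "length vs = n" "set vs \<subseteq> D" "case_nat y' (case_nat y (prepend vs e)) j \<in> D" for vs y y' j
    using sat_fun[of f n "[2..<n + 2]" "case_nat y' (case_nat y (prepend vs e))" j] assms that
      eq1[of vs y' y]
    by (metis add_diff_cancel_right' image_set length_upt)
  show ?thesis
    unfolding total_functional_def sat_alls
  proof (intro allI impI)
    fix vs :: "'a list"
    assume vs: "length vs = n"
    let ?f = "app (fun_fm \<tau> f n)"
    have "sat UNIV F R (prepend vs e) (Exists (Con (in_dom \<tau> 0) (?f ([1..<n + 1] @ [0]))))"
      if "set vs \<subseteq> D"
      using ex[of vs "G f vs"] vs that closed[OF assms vs]
      unfolding sat.simps sat_in_dom nat.case by blast
    moreover have "sat UNIV F R (prepend vs e) (Forall (Forall (Imp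
          (Con (Con (in_dom \<tau> 1) (?f ([2..<n + 2] @ [1]))) (Con (in_dom \<tau> 0) (?f ([2..<n + 2] @ [0]))))
          (Eq (Var 1) (Var 0)))))" if "set vs \<subseteq> D"
      using uniq[of vs _ _ 0] uniq[of vs _ _ 1] vs that by (simp only: sat.simps sat_in_dom eval.simps One_nat_def nat.case) metis
    moreover have "set vs \<subseteq> D" if "sat UNIV F R (prepend vs e) (conjs (map (in_dom \<tau>) [0..<n]))"
      using that vs by (auto simp: sat_conjs sat_in_dom in_set_conv_nth)
    ultimately show "sat UNIV F R (prepend vs e) (Imp (conjs (map (in_dom \<tau>) [0..<n]))
        (Con (Exists (Con (in_dom \<tau> 0) (?f ([1..<n + 1] @ [0]))))
          (Forall (Forall (Imp
            (Con (Con (in_dom \<tau> 1) (?f ([2..<n + 2] @ [1])))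
                 (Con (in_dom \<tau> 0) (?f ([2..<n + 2] @ [0]))))
            (Eq (Var 1) (Var 0)))))))"
      by (simp only: sat.simps) blast
  qed
qed

end

text \<open>One formula must serve all structures \<open>F\<close>, because an interpretation is a
  single translation. The closure rules below mirror the connectives, so definability is proved by
  following the HOL definition of a predicate, and the formula is never written out.\<close>

definition definable ::
  "('f, 'r) language \<Rightarrow> nat \<Rightarrow> (('f \<Rightarrow> 'a list \<Rightarrow> 'a) \<Rightarrow> (nat \<Rightarrow> 'a) \<Rightarrow> bool) \<Rightarrow> bool" where
  "definable L n P \<longleftrightarrow>
    (\<exists>p. wf_fm L n p \<and> (\<forall>F (R :: 'r \<Rightarrow> 'a list \<Rightarrow> bool) e. sat UNIV F R e p \<longleftrightarrow> P F e))"

definition definable_tm ::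
  "('f, 'r) language \<Rightarrow> nat \<Rightarrow> (('f \<Rightarrow> 'a list \<Rightarrow> 'a) \<Rightarrow> (nat \<Rightarrow> 'a) \<Rightarrow> 'a) \<Rightarrow> bool" where
  "definable_tm L n t \<longleftrightarrow> (\<exists>s. wf_tm L n s \<and> (\<forall>F e. eval F e s = t F e))"

lemma definable_tm_var: "i < n \<Longrightarrow> definable_tm L n (\<lambda>F e. e i)"
  unfolding definable_tm_def by (rule exI[of _ "Var i"]) simp

lemma definable_tm_Fun0: "(f, 0) \<in> funs L \<Longrightarrow> definable_tm L n (\<lambda>F e. F f [])"
  unfolding definable_tm_def by (rule exI[of _ "Fun f []"]) simp

lemma definable_tm_Fun1:
  "(f, 1) \<in> funs L \<Longrightarrow> definable_tm L n t \<Longrightarrow> definable_tm L n (\<lambda>F e. F f [t F e])"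
  unfolding definable_tm_def by (elim exE, rule exI[of _ "Fun f [_]"]) auto

lemma definable_tm_Fun2:
  assumes "(f, 2) \<in> funs L" "definable_tm L n t" "definable_tm L n u"
  shows "definable_tm L n (\<lambda>F e. F f [t F e, u F e])"
proof -
  obtain s s' where "wf_tm L n s" "\<forall>F e. eval F e s = t F e" "wf_tm L n s'" "\<forall>F e. eval F e s' = u F e"
    using assms unfolding definable_tm_def by blast
  then show ?thesis
    unfolding definable_tm_def using assms(1)
    by (intro exI[of _ "Fun f [s, s']"]) (auto simp: numeral_2_eq_2)
qed

lemma definable_eq:
  assumes "definable_tm L n t" "definable_tm L n u"
  shows "definable L n (\<lambda>F e. t F e = u F e)"
proof -
  obtain s s' where "wf_tm L n s" "\<forall>F e. eval F e s = t F e" "wf_tm L n s'" "\<forall>F e. eval F e s' = u F e"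
    using assms unfolding definable_tm_def by blast
  then show ?thesis
    unfolding definable_def by (intro exI[of _ "Eq s s'"]) auto
qed

lemma definable_False: "definable L n (\<lambda>F e. False)"
  unfolding definable_def by (rule exI[of _ Fls]) simp

lemma definable_imp:
  assumes "definable L n P" "definable L n Q"
  shows "definable L n (\<lambda>F e. P F e \<longrightarrow> Q F e)"
proof -
  obtain p q where "wf_fm L n p" "\<forall>F R e. sat UNIV F R e p \<longleftrightarrow> P F e"
    "wf_fm L n q" "\<forall>F R e. sat UNIV F R e q \<longleftrightarrow> Q F e"
    using assms unfolding definable_def by blast
  then show ?thesis
    unfolding definable_def by (intro exI[of _ "Imp p q"]) auto
qed

lemma definable_not: "definable L n P \<Longrightarrow> definable L n (\<lambda>F e. \<not> P F e)"
  using definable_imp[of L n P, OF _ definable_False] by simp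

lemma definable_conj:
  assumes "definable L n P" "definable L n Q"
  shows "definable L n (\<lambda>F e. P F e \<and> Q F e)"
  using definable_not[OF definable_imp[OF assms(1) definable_not[OF assms(2)]]] by simp

lemma definable_disj:
  assumes "definable L n P" "definable L n Q"
  shows "definable L n (\<lambda>F e. P F e \<or> Q F e)"
  using definable_imp[OF definable_not[OF assms(1)] assms(2)] by (simp add: imp_conv_disj)

lemma definable_iff:
  assumes "definable L n P" "definable L n Q"
  shows "definable L n (\<lambda>F e. P F e \<longleftrightarrow> Q F e)"
  using definable_conj[OF definable_imp[OF assms] definable_imp[OF assms(2,1)]]
  by (simp add: iff_conv_conj_imp)

lemma definable_all:
  assumes "definable L (Suc n) (\<lambda>F e. P F (\<lambda>i. e (Suc i)) (e 0))"
  shows "definable L n (\<lambda>F e. \<forall>x. P F e x)"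
proof -
  obtain p where "wf_fm L (Suc n) p"
    "\<forall>F R e. sat UNIV F R e p \<longleftrightarrow> P F (\<lambda>i. e (Suc i)) (e 0)"
    using assms unfolding definable_def by blast
  then show ?thesis
    unfolding definable_def by (intro exI[of _ "Forall p"]) auto
qed

lemma definable_ex:
  assumes "definable L (Suc n) (\<lambda>F e. P F (\<lambda>i. e (Suc i)) (e 0))"
  shows "definable L n (\<lambda>F e. \<exists>x. P F e x)"
  using definable_not[OF definable_all[of L n "\<lambda>F e x. \<not> P F e x", OF definable_not[OF assms]]]
  by simp

lemmas definable_intros =
  definable_eq definable_False definable_not definable_imp definable_conj definable_disj
  definable_iff definable_all definable_ex definable_tm_var

text \<open>It suffices to define a predicate at variables and to substitute terms afterwards.
  \<open>ts ! i\<close> is unspecified beyond the list, which is why \<open>P\<close> must depend on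
  its first \<open>m\<close> entries only.\<close>

lemma definable_subst:
  assumes "definable L m P" "length ts = m" "\<And>t. t \<in> set ts \<Longrightarrow> definable_tm L n t"
    "\<And>F e e'. (\<And>i. i < m \<Longrightarrow> e i = e' i) \<Longrightarrow> P F e = P F e'"
  shows "definable L n (\<lambda>F e. P F (\<lambda>i. (ts ! i) F e))"
proof -
  obtain p where p: "wf_fm L m p" "\<forall>F R e. sat UNIV F R e p \<longleftrightarrow> P F e"
    using assms(1) unfolding definable_def by blast
  obtain s where s: "\<And>t. t \<in> set ts \<Longrightarrow> wf_tm L n (s t)" "\<And>t F e. t \<in> set ts \<Longrightarrow> eval F e (s t) = t F e"
    using assms(3) unfolding definable_tm_def by metis
  have tm: "wf_tm L m t \<Longrightarrow> (\<And>i. i < m \<Longrightarrow> wf_tm L n' (\<sigma> i)) \<Longrightarrow> wf_tm L n' (subst_tm \<sigma> t)" for m n' \<sigma> t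
    by (induction t) (auto simp: list_all_iff)
  have fm: "wf_fm L m q \<Longrightarrow> (\<And>i. i < m \<Longrightarrow> wf_tm L n' (\<sigma> i)) \<Longrightarrow> wf_fm L n' (subst_fm \<sigma> q)" for m n' \<sigma> q
  proof (induction q arbitrary: m n' \<sigma>)
    case (Forall q)
    have "wf_tm L (Suc n') (case i of 0 \<Rightarrow> Var 0 | Suc i \<Rightarrow> lift_tm (\<sigma> i))" if "i < Suc m" for i
      using Forall.prems(2)[of "i - 1"] that tm[of n' _ "Suc n'"]
      by (auto simp: lift_tm_def split: nat.split)
    then show ?case
      using Forall.prems(1) Forall.IH[of "Suc m" "Suc n'"] by simp
  qed (auto simp: list_all_iff intro: tm)
  define q where "q = subst_fm (\<lambda>i. s (ts ! i)) p"
  have "wf_fm L n q"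
    unfolding q_def by (rule fm[OF p(1)]) (use s(1) assms(2) in auto)
  moreover have "sat UNIV F R e q \<longleftrightarrow> P F (\<lambda>i. (ts ! i) F e)" for F and R :: "'b \<Rightarrow> 'c list \<Rightarrow> bool" and e
  proof -
    have "P F (\<lambda>i. eval F e (s (ts ! i))) = P F (\<lambda>i. (ts ! i) F e)"
      by (rule assms(4)) (use s(2) assms(2) in auto)
    then show ?thesis
      unfolding q_def sat_subst using p(2) by blast
  qed
  ultimately show ?thesis
    unfolding definable_def by blast
qed

lemma definable_subst1:
  assumes "definable L 1 (\<lambda>F e. P F (e 0))" "definable_tm L n t"
  shows "definable L n (\<lambda>F e. P F (t F e))"
  using definable_subst[OF assms(1), of "[t]" n] assms(2) by simp

lemma definable_subst2:
  assumes "definable L 2 (\<lambda>F e. P F (e 0) (e 1))" "definable_tm L n t" "definable_tm L n u"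
  shows "definable L n (\<lambda>F e. P F (t F e) (u F e))"
  using definable_subst[OF assms(1), of "[t, u]" n] assms(2,3) by auto

lemma definable_subst3:
  assumes "definable L 3 (\<lambda>F e. P F (e 0) (e 1) (e 2))"
    "definable_tm L n t" "definable_tm L n u" "definable_tm L n v"
  shows "definable L n (\<lambda>F e. P F (t F e) (u F e) (v F e))"
  using definable_subst[OF assms(1), of "[t, u, v]" n] assms(2-4) by auto

definition models :: "('f \<Rightarrow> 'a list \<Rightarrow> 'a) \<Rightarrow> ('f, 'r) fo_theory \<Rightarrow> bool" where
  "models F U \<longleftrightarrow> (\<exists>R. \<forall>p\<in>axs U. \<forall>e. sat UNIV F R e p)"

text \<open>The syntactic obligations shrink to the definability of \<open>D\<close> and of the
  graphs \<open>P\<close>; the rest is checked in models over the natural numbers. \<open>c\<close>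
  and \<open>z\<close> are the injective function and the omitted value through which
  \<open>completeness\<close> excludes finite models.\<close>

theorem interpretable_inI:
  fixes U :: "('g::countable, 's::countable) fo_theory" and V :: "('f, 'r) fo_theory"
    and D :: "('g \<Rightarrow> nat list \<Rightarrow> nat) \<Rightarrow> nat set"
    and G :: "('g \<Rightarrow> nat list \<Rightarrow> nat) \<Rightarrow> 'f \<Rightarrow> nat list \<Rightarrow> nat"
    and P :: "'f \<Rightarrow> ('g \<Rightarrow> nat list \<Rightarrow> nat) \<Rightarrow> (nat \<Rightarrow> nat) \<Rightarrow> bool"
  assumes U: "\<And>q. q \<in> axs U \<Longrightarrow> wf_fm full_lang 0 q"
      "\<And>s t. axs U \<turnstile> Imp (Eq (Fun c [s]) (Fun c [t])) (Eq s t)"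
      "\<And>t. axs U \<turnstile> Neg (Eq (Fun c [t]) (Fun z []))"
    and V: "\<And>q. q \<in> axs V \<Longrightarrow> wf_fm (lang V) 0 q" "rels (lang V) = {}"
    and D: "definable (lang U) 1 (\<lambda>F e. e 0 \<in> D F)"
    and P: "\<And>f n. (f, n) \<in> funs (lang V) \<Longrightarrow> definable (lang U) (Suc n) (P f)"
    and graph: "\<And>F f n xs y. models F U \<Longrightarrow> (f, n) \<in> funs (lang V) \<Longrightarrow> length xs = n \<Longrightarrow>
      set xs \<subseteq> D F \<Longrightarrow> y \<in> D F \<Longrightarrow> P f F ((!) (xs @ [y])) \<longleftrightarrow> y = G F f xs"
    and closed: "\<And>F f n xs. models F U \<Longrightarrow> (f, n) \<in> funs (lang V) \<Longrightarrow> length xs = n \<Longrightarrow>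
      set xs \<subseteq> D F \<Longrightarrow> G F f xs \<in> D F"
    and nonempty: "\<And>F. models F U \<Longrightarrow> D F \<noteq> {}"
    and axioms: "\<And>F R e p. models F U \<Longrightarrow> p \<in> axs V \<Longrightarrow> sat (D F) (G F) R e p"
  shows "interpretable_in V U"
proof -
  obtain d where d: "wf_fm (lang U) 1 d"
    "\<And>F (R :: 's \<Rightarrow> nat list \<Rightarrow> bool) e. sat UNIV F R e d \<longleftrightarrow> e 0 \<in> D F"
    using D unfolding definable_def by blast
  obtain g where g: "\<And>f n. (f, n) \<in> funs (lang V) \<Longrightarrow> wf_fm (lang U) (Suc n) (g f n)"
    "\<And>f n F (R :: 's \<Rightarrow> nat list \<Rightarrow> bool) e. (f, n) \<in> funs (lang V) \<Longrightarrow> sat UNIV F R e (g f n) \<longleftrightarrow> P f F e"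
    using P unfolding definable_def by metis
  define \<tau> :: "('f, 'r, 'g, 's) translation" where
    "\<tau> = \<lparr>dom_fm = d, fun_fm = g, rel_fm = \<lambda>_ _. Fls\<rparr>"
  have wf: "wf_translation \<tau> (lang V) (lang U)"
    using d(1) g(1) V(2) by (auto simp: wf_translation_def \<tau>_def)
  have tm: "translation_model \<tau> (lang V) (lang U) F R (G F) (D F)" if "models F U"
    for F :: "'g \<Rightarrow> nat list \<Rightarrow> nat" and R :: "'s \<Rightarrow> nat list \<Rightarrow> bool"
    using that wf V(2) closed graph by unfold_locales (auto simp: \<tau>_def d(2) g(2))
  have derivI: "axs U \<turnstile> q" if "\<And>F (R :: 's \<Rightarrow> nat list \<Rightarrow> bool) e. models F U \<Longrightarrow> sat UNIV F R e q" for q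
    by (rule completeness[OF U], assumption+, rule that) (unfold models_def, blast)
  have "axs U \<turnstile> Exists (dom_fm \<tau>)"
  proof (rule derivI)
    fix F :: "'g \<Rightarrow> nat list \<Rightarrow> nat" and R :: "'s \<Rightarrow> nat list \<Rightarrow> bool" and e
    assume "models F U"
    then show "sat UNIV F R e (Exists (dom_fm \<tau>))"
      using nonempty[of F] d(2) by (auto simp: \<tau>_def)
  qed
  moreover have "axs U \<turnstile> total_functional \<tau> f n" if "(f, n) \<in> funs (lang V)" for f n
    using that by (intro derivI translation_model.sat_total_functional[OF tm])
  moreover have "axs U \<turnstile> tr_fm \<tau> q" if "q \<in> axs V" for q
  proof (rule derivI)
    fix F :: "'g \<Rightarrow> nat list \<Rightarrow> nat" and R :: "'s \<Rightarrow> nat list \<Rightarrow> bool" and e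
    assume m: "models F U"
    show "sat UNIV F R e (tr_fm \<tau> q)"
      using translation_model.sat_tr_fm[OF tm[OF m] V(1)[OF that], of e] axioms[OF m that] by simp
  qed
  ultimately have "interpretation_of \<tau> V U"
    using wf by (auto simp: interpretation_of_def)
  then show ?thesis
    by (auto simp: interpretable_in_def)
qed

section \<open>A commutative semiring inside a structure with relational addition and multiplication\<close>

locale rel_arith_sig =
  fixes Z :: 'a and S :: "'a \<Rightarrow> 'a" and A Mu :: "'a \<Rightarrow> 'a \<Rightarrow> 'a \<Rightarrow> bool"
begin

text \<open>The witness is the right summand, on which the recursion of addition runs; this yields
  the case distinction for elements below a successor.\<close>

definition le :: "'a \<Rightarrow> 'a \<Rightarrow> bool" where
  "le y x \<longleftrightarrow> (\<exists>z. A y z x)"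

text \<open>Besides totality, the clauses on zero and successor as left summands are what the
  inductive proof of commutativity needs.\<close>

definition plus_total :: "'a \<Rightarrow> bool" where
  "plus_total y \<longleftrightarrow> (\<forall>x. \<exists>z. \<forall>z'. A x y z' \<longleftrightarrow> z' = z) \<and> A Z y y \<and> (\<forall>x z. A x y z \<longrightarrow> A (S x) y (S z))"

text \<open>After associativity and commutativity, the last clause decomposes the elements below a
  sum. It will let a downward closed class inherit closure under addition.\<close>

definition plus_regular :: "'a \<Rightarrow> bool" where
  "plus_regular y \<longleftrightarrow> plus_total y \<and>
    (\<forall>x w p q. A x w p \<and> A p y q \<longrightarrow> (\<exists>t. A w y t \<and> A x t q)) \<and>
    (\<forall>x z. plus_total x \<and> A x y z \<longrightarrow> A y x z) \<and>
    (\<forall>x w u. A x y w \<and> le u w \<longrightarrow> le u x \<or> (\<exists>v. le v y \<and> A x v u))"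

text \<open>Solovay's step: requiring that adding \<open>y\<close> preserves the previous class
  makes the new class closed under addition, by associativity.\<close>

definition plus_cut :: "'a \<Rightarrow> bool" where
  "plus_cut y \<longleftrightarrow> plus_regular y \<and> (\<forall>x z. plus_regular x \<and> A x y z \<longrightarrow> plus_regular z)"

definition times_total :: "'a \<Rightarrow> bool" where
  "times_total y \<longleftrightarrow> plus_cut y \<and> (\<forall>x. plus_cut x \<longrightarrow> (\<exists>z. plus_cut z \<and> (\<forall>z'. Mu x y z' \<longleftrightarrow> z' = z))) \<and> Mu Z y Z \<and>
    (\<forall>x z z'. plus_cut x \<and> Mu x y z \<and> A z y z' \<longrightarrow> Mu (S x) y z')"

text \<open>The last clause is a division by \<open>x\<close> with remainder at most
  \<open>x\<close>. It plays for products the role that the decomposition below sums plays for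
  addition.\<close>

definition times_regular :: "'a \<Rightarrow> bool" where
  "times_regular y \<longleftrightarrow> times_total y \<and> (\<forall>x z. times_total x \<and> Mu x y z \<longrightarrow> Mu y x z) \<and>
    (\<forall>x p u. plus_cut x \<and> Mu x y p \<and> le u p \<longrightarrow>
      u = Z \<or> (\<exists>v w q. le v y \<and> le w x \<and> Mu x v q \<and> A q w u))"

definition distrib_cut :: "'a \<Rightarrow> bool" where
  "distrib_cut y \<longleftrightarrow> times_regular y \<and> (\<forall>w t. times_regular w \<and> A w y t \<longrightarrow> times_regular t \<and>
      (\<forall>x p q r. plus_cut x \<and> Mu x w p \<and> Mu x y q \<and> A p q r \<longrightarrow> Mu x t r))"

definition times_cut :: "'a \<Rightarrow> bool" where
  "times_cut y \<longleftrightarrow> distrib_cut y \<and> (\<forall>x p. distrib_cut x \<and> Mu x y p \<longrightarrow>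
    distrib_cut p \<and> (\<forall>v q r. plus_cut v \<and> Mu v x q \<and> Mu q y r \<longrightarrow> Mu v p r))"

text \<open>Downward closure supplies predecessors. Closure under the operations has to be regained
  afterwards, from the decompositions below sums and products.\<close>

definition N :: "'a \<Rightarrow> bool" where
  "N x \<longleftrightarrow> (\<forall>y. le y x \<longrightarrow> times_cut y)"

definition pl :: "'a \<Rightarrow> 'a \<Rightarrow> 'a" where
  "pl x y = (THE z. A x y z)"

definition ti :: "'a \<Rightarrow> 'a \<Rightarrow> 'a" where
  "ti x y = (THE z. Mu x y z)"

end

text \<open>The common interface of the cuts: the operations are functions on the whole type, with
  the semiring laws relativized to \<open>N\<close>. Shortening produces instances again, so it can
  be iterated.\<close>

locale comm_semiring_cut =
  fixes N :: "'a \<Rightarrow> bool" and Z :: 'a and S :: "'a \<Rightarrow> 'a" and pl ti :: "'a \<Rightarrow> 'a \<Rightarrow> 'a"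
  assumes N_Z: "N Z"
    and N_S: "N x \<Longrightarrow> N (S x)"
    and N_cases: "N x \<Longrightarrow> x = Z \<or> (\<exists>y. N y \<and> x = S y)"
    and N_pl: "N x \<Longrightarrow> N y \<Longrightarrow> N (pl x y)"
    and N_ti: "N x \<Longrightarrow> N y \<Longrightarrow> N (ti x y)"
    and S_inj: "S x = S y \<Longrightarrow> x = y"
    and S_neq_Z: "S x \<noteq> Z"
    and pl_Z: "pl x Z = x"
    and pl_S: "N y \<Longrightarrow> pl x (S y) = S (pl x y)"
    and ti_Z: "ti x Z = Z"
    and ti_S: "N x \<Longrightarrow> N y \<Longrightarrow> ti x (S y) = pl (ti x y) x"
    and pl_assoc: "N x \<Longrightarrow> N y \<Longrightarrow> N z \<Longrightarrow> pl (pl x y) z = pl x (pl y z)"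
    and pl_comm: "N x \<Longrightarrow> N y \<Longrightarrow> pl x y = pl y x"
    and ti_pl: "N x \<Longrightarrow> N y \<Longrightarrow> N z \<Longrightarrow> ti x (pl y z) = pl (ti x y) (ti x z)"
    and ti_assoc: "N x \<Longrightarrow> N y \<Longrightarrow> N z \<Longrightarrow> ti (ti x y) z = ti x (ti y z)"
    and ti_comm: "N x \<Longrightarrow> N y \<Longrightarrow> ti x y = ti y x"

text \<open>\<open>A_iff\<close> and \<open>Mu_iff\<close> are fixed-point equations only. They do
  not exclude elements at which a sum is missing or ambiguous, so even totality has to be secured by
  passing to a cut.\<close>

locale rel_arith = rel_arith_sig +
  assumes S_inj: "S x = S y \<Longrightarrow> x = y"
    and S_neq_Z: "S x \<noteq> Z"
    and A_iff: "A x y z \<longleftrightarrow> y = Z \<and> z = x \<or> (\<exists>y' z'. y = S y' \<and> z = S z' \<and> A x y' z')"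
    and Mu_iff: "Mu x y z \<longleftrightarrow> y = Z \<and> z = Z \<or> (\<exists>y' z'. y = S y' \<and> Mu x y' z' \<and> A z' x z)"
begin

lemma A_Z: "A x Z z \<longleftrightarrow> z = x"
  using A_iff[of x Z z] S_neq_Z by metis

lemma A_S: "A x (S y) z \<longleftrightarrow> (\<exists>z'. z = S z' \<and> A x y z')"
  using A_iff[of x "S y" z] S_neq_Z S_inj by metis

lemma A_SD: "A x (S y) z \<Longrightarrow> \<exists>z'. z = S z' \<and> A x y z'"
  by (simp only: A_S)

lemma A_SI: "A x y z \<Longrightarrow> A x (S y) (S z)"
  by (auto simp only: A_S)

lemma Mu_Z: "Mu x Z z \<longleftrightarrow> z = Z"
  using Mu_iff[of x Z z] S_neq_Z by metis

lemma Mu_S: "Mu x (S y) z \<longleftrightarrow> (\<exists>z'. Mu x y z' \<and> A z' x z)"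
  using Mu_iff[of x "S y" z] S_neq_Z S_inj by metis

lemma le_refl: "le x x"
  unfolding le_def using A_Z by blast

lemma le_S: "le y x \<Longrightarrow> le y (S x)"
  unfolding le_def using A_SI by blast

lemma le_Z: "le y Z \<longleftrightarrow> y = Z"
  unfolding le_def using A_iff[of y _ Z] S_neq_Z A_Z by metis

lemma le_S_cases: "le y (S x) \<Longrightarrow> y = S x \<or> le y x"
  unfolding le_def using A_iff[of y _ "S x"] S_inj by metis

section \<open>Addition on successive cuts\<close>

lemma plus_total_A: "plus_total y \<Longrightarrow> A x y z \<longleftrightarrow> z = pl x y"
  unfolding plus_total_def pl_def by (metis the_equality)

lemma plus_total_Z: "plus_total Z"
  unfolding plus_total_def A_Z by blast

lemma plus_total_S:
  assumes "plus_total y"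
  shows "plus_total (S y)"
proof -
  have "\<exists>z. \<forall>z'. A x (S y) z' \<longleftrightarrow> z' = z" for x
    unfolding A_S plus_total_A[OF assms] by blast
  moreover have "A Z (S y) (S y)"
    unfolding A_S using assms plus_total_def by blast
  moreover have "A (S x) (S y) (S z)" if "A x (S y) z" for x z
    using that assms A_SD A_SI unfolding plus_total_def by metis
  ultimately show ?thesis
    unfolding plus_total_def by blast
qed

lemma plus_regular_Z: "plus_regular Z"
  unfolding plus_regular_def A_Z using plus_total_Z plus_total_def by blast

lemma plus_regular_S:
  assumes "plus_regular y"
  shows "plus_regular (S y)"
  unfolding plus_regular_def
proof (intro conjI allI impI)
  have y1: "plus_total y"
    and y2: "A x w p \<Longrightarrow> A p y q \<Longrightarrow> \<exists>t. A w y t \<and> A x t q"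
    and y3: "plus_total x \<Longrightarrow> A x y z \<Longrightarrow> A y x z"
    and y4: "A x y w \<Longrightarrow> le u w \<Longrightarrow> le u x \<or> (\<exists>v. le v y \<and> A x v u)" for x w p q z u
    using assms unfolding plus_regular_def by auto
  show "plus_total (S y)"
    using y1 by (rule plus_total_S)
  show "\<exists>t. A w (S y) t \<and> A x t q" if "A x w p \<and> A p (S y) q" for x w p q
    using y2[of x w p] that A_SD A_SI by metis
  show "A (S y) x z" if asm: "plus_total x \<and> A x (S y) z" for x z
  proof -
    obtain z' where "z = S z'" "A x y z'"
      using asm A_SD by blast
    then show ?thesis
      using asm y3[of x z'] plus_total_def[of x] by simp
  qed
  show "le u x \<or> (\<exists>v. le v (S y) \<and> A x v u)" if asm: "A x (S y) w \<and> le u w" for x w u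
  proof -
    obtain w' where w': "w = S w'" "A x y w'"
      using asm A_SD by blast
    then consider "u = S w'" | "le u w'"
      using asm le_S_cases by blast
    then show ?thesis
    proof cases
      case 1
      then have "A x (S y) u"
        using w' A_SI by blast
      then show ?thesis
        using le_refl by blast
    next
      case 2
      then show ?thesis
        using y4[OF w'(2)] le_S by blast
    qed
  qed
qed

lemma plus_cut_Z: "plus_cut Z"
  unfolding plus_cut_def A_Z using plus_regular_Z by blast

lemma plus_cut_S: "plus_cut y \<Longrightarrow> plus_cut (S y)"
  unfolding plus_cut_def A_S using plus_regular_S by blast

lemma plus_cut_plus_regular: "plus_cut y \<Longrightarrow> plus_regular y"
  by (simp add: plus_cut_def)

lemma plus_regular_plus_total: "plus_regular y \<Longrightarrow> plus_total y"
  by (simp add: plus_regular_def)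

lemma plus_cut_plus_total: "plus_cut y \<Longrightarrow> plus_total y"
  by (simp add: plus_cut_def plus_regular_def)

lemma plus_regular_pl: "plus_regular x \<Longrightarrow> plus_cut y \<Longrightarrow> plus_regular (pl x y)"
  using plus_cut_def plus_cut_plus_total plus_total_A by blast

lemma assoc: "plus_total w \<Longrightarrow> plus_regular y \<Longrightarrow> plus_total (pl w y) \<Longrightarrow> pl (pl x w) y = pl x (pl w y)"
  unfolding plus_regular_def using plus_total_A by metis

lemma comm: "plus_total x \<Longrightarrow> plus_regular y \<Longrightarrow> pl x y = pl y x"
  unfolding plus_regular_def using plus_total_A by metis

text \<open>By associativity, adding \<open>pl x y\<close> to a regular element amounts to adding
  \<open>x\<close> and then \<open>y\<close>, and each step stays in the class.\<close>

lemma plus_cut_pl: "plus_cut x \<Longrightarrow> plus_cut y \<Longrightarrow> plus_cut (pl x y)"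
  unfolding plus_cut_def[of "pl x y"]
  by (metis plus_total_A plus_regular_plus_total plus_regular_pl plus_cut_plus_total plus_cut_plus_regular assoc)

lemma pl_Z: "pl x Z = x"
  using A_Z plus_total_A plus_total_Z by metis

lemma pl_S: "plus_total y \<Longrightarrow> pl x (S y) = S (pl x y)"
  using A_S plus_total_A plus_total_S by metis

lemma le_pl: "plus_regular y \<Longrightarrow> le u (pl x y) \<Longrightarrow> le u x \<or> (\<exists>v. le v y \<and> A x v u)"
  unfolding plus_regular_def using plus_total_A by metis

section \<open>Multiplication on successive cuts: totality, commutativity, distributivity,
  associativity\<close>

lemma times_total_Mu: "times_total y \<Longrightarrow> plus_cut x \<Longrightarrow> Mu x y z \<longleftrightarrow> z = ti x y"
  unfolding times_total_def ti_def by (metis the_equality)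

lemma plus_cut_ti: "plus_cut x \<Longrightarrow> times_total y \<Longrightarrow> plus_cut (ti x y)"
  unfolding times_total_def ti_def by (metis the_equality)

lemma times_total_plus_cut: "times_total y \<Longrightarrow> plus_cut y"
  by (simp add: times_total_def)

lemma times_total_Z: "times_total Z"
  unfolding times_total_def Mu_Z using plus_cut_Z A_Z by blast

lemma Z_pl: "plus_total y \<Longrightarrow> pl Z y = y"
  unfolding plus_total_def using plus_total_A plus_total_def by metis

lemma times_total_S:
  assumes "times_total y"
  shows "times_total (S y)"
  unfolding times_total_def
proof (intro conjI allI impI)
  have J: "plus_cut y" "plus_total y"
    using assms times_total_plus_cut plus_cut_plus_total by auto
  then show "plus_cut (S y)"
    using plus_cut_S by blast
  show "\<exists>z. plus_cut z \<and> (\<forall>z'. Mu x (S y) z' \<longleftrightarrow> z' = z)" if "plus_cut x" for x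
    unfolding Mu_S times_total_Mu[OF assms that] plus_total_A[OF plus_cut_plus_total[OF that]]
    using plus_cut_pl[OF plus_cut_ti[OF that assms] that] by blast
  show "Mu Z (S y) Z"
    unfolding Mu_S using assms A_Z unfolding times_total_def by blast
  show "Mu (S x) (S y) z'" if "plus_cut x \<and> Mu x (S y) z \<and> A z (S y) z'" for x z z'
  proof -
    have x: "plus_cut x" "plus_total x" "plus_cut (S x)" "plus_total (S x)"
      using that plus_cut_plus_total plus_cut_S by auto
    have t: "plus_cut (ti x y)"
      using plus_cut_ti x assms by blast
    \<comment> \<open>The computation is (xy + x) + Sy = (xy + y) + Sx, where commutativity of
      addition exchanges x and y.\<close>
    have "z' = pl (pl (ti x y) x) (S y)"
      using that x assms J plus_total_S by (auto simp: Mu_S times_total_Mu plus_total_A)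
    also have "\<dots> = S (pl (ti x y) (pl x y))"
      using J x t by (simp add: pl_S assoc plus_cut_plus_regular plus_cut_plus_total plus_cut_pl)
    also have "pl x y = pl y x"
      using J x comm plus_cut_plus_regular by blast
    also have "S (pl (ti x y) (pl y x)) = pl (pl (ti x y) y) (S x)"
      using J x t by (simp add: pl_S assoc plus_cut_plus_regular plus_cut_plus_total plus_cut_pl)
    finally have "A (pl (ti x y) y) (S x) z'"
      using x plus_total_A by blast
    moreover have "Mu (S x) y (pl (ti x y) y)"
      using assms x J unfolding times_total_def by (metis plus_total_A times_total_Mu assms)
    ultimately show ?thesis
      unfolding Mu_S by blast
  qed
qed

lemma ti_Z: "ti x Z = Z"
  unfolding ti_def Mu_Z by simp

lemma ti_S: "plus_cut x \<Longrightarrow> times_total y \<Longrightarrow> ti x (S y) = pl (ti x y) x"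
  using Mu_S[of x y] times_total_Mu[of y x] times_total_Mu[of "S y" x] times_total_S[of y] plus_total_A[OF plus_cut_plus_total] by metis

lemma S_ti: "plus_cut x \<Longrightarrow> times_total y \<Longrightarrow> ti (S x) y = pl (ti x y) y"
proof -
  assume *: "plus_cut x" "times_total y"
  then have "Mu (S x) y (pl (ti x y) y)"
    using times_total_def[of y] times_total_Mu[of y x] plus_total_A[of y] plus_cut_plus_total by metis
  then show ?thesis
    using * times_total_Mu plus_cut_S by metis
qed

lemma times_regular_Z: "times_regular Z"
proof -
  have "Mu Z x Z" if "times_total x" for x
    using that times_total_def by blast
  then show ?thesis
    unfolding times_regular_def using times_total_Z by (auto simp: Mu_Z le_Z)
qed

lemma times_regular_times_total: "times_regular y \<Longrightarrow> times_total y"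
  by (simp add: times_regular_def)

lemma times_regular_J: "times_regular y \<Longrightarrow> plus_cut y" "times_regular y \<Longrightarrow> plus_regular y" "times_regular y \<Longrightarrow> plus_total y"
  using times_regular_times_total times_total_plus_cut plus_cut_plus_total plus_cut_plus_regular by auto

lemma mult_comm: "times_total x \<Longrightarrow> times_regular y \<Longrightarrow> ti x y = ti y x"
  unfolding times_regular_def using times_total_Mu times_total_plus_cut by metis

lemma times_regular_S:
  assumes "times_regular y"
  shows "times_regular (S y)"
  unfolding times_regular_def
proof (intro conjI allI impI)
  have J: "times_total y" "plus_cut y" "plus_total y" "plus_total (S y)" "times_total (S y)"
    using times_regular_times_total[OF assms] times_total_plus_cut plus_cut_plus_total plus_total_S times_total_S by auto
  show "times_total (S y)"
    by (rule J)
  show "Mu (S y) x z" if "times_total x \<and> Mu x (S y) z" for x z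
  proof -
    have x: "times_total x" "plus_cut x" "plus_total x"
      using that times_total_plus_cut plus_cut_plus_total by auto
    have "z = pl (ti x y) x"
      using that x J by (simp add: times_total_Mu ti_S)
    also have "\<dots> = ti (S y) x"
      using x J mult_comm[OF x(1) assms] by (simp add: S_ti)
    finally show ?thesis
      using times_total_Mu x J plus_cut_S by metis
  qed
  show "u = Z \<or> (\<exists>v w q. le v (S y) \<and> le w x \<and> Mu x v q \<and> A q w u)"
    if "plus_cut x \<and> Mu x (S y) p \<and> le u p" for x p u
  proof -
    have x: "plus_cut x" "plus_regular x"
      using that plus_cut_plus_regular by auto
    have "le u (pl (ti x y) x)"
      using that J x by (auto simp: times_total_Mu ti_S)
    then consider "le u (ti x y)" | v where "le v x" "A (ti x y) v u"
      using le_pl x by blast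
    then show ?thesis
    proof cases
      case 1
      then show ?thesis
        using assms x J times_total_Mu[of y x "ti x y"] le_S unfolding times_regular_def by blast
    next
      case 2
      then show ?thesis
        using x J times_total_Mu[of y x] le_S[OF le_refl] by blast
    qed
  qed
qed

lemma distrib_cut_Z: "distrib_cut Z"
  unfolding distrib_cut_def using times_regular_Z by (auto simp: A_Z Mu_Z)

lemma distrib_cut_times_regular: "distrib_cut y \<Longrightarrow> times_regular y"
  by (simp add: distrib_cut_def)

lemma times_regular_pl: "times_regular w \<Longrightarrow> distrib_cut y \<Longrightarrow> times_regular (pl w y)"
  unfolding distrib_cut_def using plus_total_A times_regular_J by metis

lemma distrib:
  assumes "plus_cut x" "times_regular w" "distrib_cut y"
  shows "ti x (pl w y) = pl (ti x w) (ti x y)"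
proof -
  have "A w y (pl w y)"
    using assms plus_total_A times_regular_J distrib_cut_times_regular by metis
  moreover have "Mu x w (ti x w)" "Mu x y (ti x y)"
    using assms times_total_Mu distrib_cut_times_regular times_regular_times_total by metis+
  moreover have "A (ti x w) (ti x y) (pl (ti x w) (ti x y))"
    using assms plus_total_A plus_cut_plus_total plus_cut_ti distrib_cut_times_regular times_regular_times_total by metis
  ultimately have "Mu x (pl w y) (pl (ti x w) (ti x y))"
    using assms unfolding distrib_cut_def by blast
  then show ?thesis
    using times_total_Mu times_regular_times_total times_regular_pl assms by metis
qed

text \<open>Trades the relational definition for the functions \<open>pl\<close> and
  \<open>ti\<close>, with which the inductive steps become equational computations.\<close>

lemma distrib_cut_I:
  assumes "times_regular y" "\<And>w. times_regular w \<Longrightarrow> times_regular (pl w y)"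
    "\<And>x w. plus_cut x \<Longrightarrow> times_regular w \<Longrightarrow> ti x (pl w y) = pl (ti x w) (ti x y)"
  shows "distrib_cut y"
  unfolding distrib_cut_def
proof (intro conjI allI impI)
  show "times_regular t" if "times_regular w \<and> A w y t" for w t
    using that assms plus_total_A times_regular_J by metis
  show "Mu x t r" if "times_regular w \<and> A w y t" "plus_cut x \<and> Mu x w p \<and> Mu x y q \<and> A p q r" for w t x p q r
  proof -
    have w: "times_regular w" "times_total w" "times_total y" "plus_total y" and x: "plus_cut x"
      using that assms(1) times_regular_times_total times_regular_J by auto
    have eqs: "t = pl w y" "p = ti x w" "q = ti x y"
      using that w x plus_total_A times_total_Mu by simp_all
    have "r = pl p q"
      using that plus_total_A[OF plus_cut_plus_total[OF plus_cut_ti[OF x w(3)]]] by (simp add: eqs)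
    then have "r = ti x t"
      using assms(3)[OF x w(1)] by (simp add: eqs)
    then show ?thesis
      using assms(2)[OF w(1)] x times_regular_times_total times_total_Mu eqs(1) by blast
  qed
qed (rule assms(1))

lemma distrib_cut_S:
  assumes "distrib_cut y"
  shows "distrib_cut (S y)"
proof (rule distrib_cut_I)
  have y: "times_regular y" "plus_total y" "times_total y"
    using assms distrib_cut_times_regular times_regular_J times_regular_times_total by auto
  show "times_regular (S y)"
    using y times_regular_S by blast
  show "times_regular (pl w (S y))" if "times_regular w" for w
    using times_regular_S[OF times_regular_pl[OF that assms]] y by (simp add: pl_S)
  show "ti x (pl w (S y)) = pl (ti x w) (ti x (S y))" if x: "plus_cut x" and w: "times_regular w" for x w
  proof -
    have m: "plus_cut (ti x w)" "plus_cut (ti x y)" "times_total (pl w y)"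
      using x w y plus_cut_ti times_regular_times_total times_regular_pl assms by auto
    have "ti x (pl w (S y)) = pl (pl (ti x w) (ti x y)) x"
      using x w y m by (simp add: ti_S pl_S distrib assms)
    also have "\<dots> = pl (ti x w) (ti x (S y))"
      using m x y by (simp add: assoc plus_cut_plus_total plus_cut_plus_regular plus_cut_pl ti_S)
    finally show ?thesis .
  qed
qed

lemma distrib_cut_pl:
  assumes "distrib_cut y" "distrib_cut y'"
  shows "distrib_cut (pl y y')"
proof (rule distrib_cut_I)
  have J: "times_regular y" "times_regular y'"
    using assms distrib_cut_times_regular by auto
  show P: "times_regular (pl y y')"
    using times_regular_pl J assms by blast
  have eq: "pl w (pl y y') = pl (pl w y) y'" for w
    using J P assoc by (simp add: times_regular_J)
  show "times_regular (pl w (pl y y'))" if "times_regular w" for w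
    unfolding eq using that times_regular_pl assms by blast
  show "ti x (pl w (pl y y')) = pl (ti x w) (ti x (pl y y'))" if x: "plus_cut x" and w: "times_regular w" for x w
  proof -
    have m: "plus_cut (ti x w)" "plus_cut (ti x y)" "plus_cut (ti x y')"
      using x w J plus_cut_ti times_regular_times_total by auto
    have "ti x (pl w (pl y y')) = pl (pl (ti x w) (ti x y)) (ti x y')"
      unfolding eq using x w times_regular_pl[OF w] assms by (simp add: distrib)
    also have "\<dots> = pl (ti x w) (ti x (pl y y'))"
      using m x J assms by (simp add: distrib assoc plus_cut_plus_total plus_cut_plus_regular plus_cut_pl)
    finally show ?thesis .
  qed
qed

lemma times_cut_distrib_cut: "times_cut y \<Longrightarrow> distrib_cut y"
  by (simp add: times_cut_def)

lemma distrib_cut_ti: "distrib_cut x \<Longrightarrow> times_cut y \<Longrightarrow> distrib_cut (ti x y)"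
  unfolding times_cut_def using times_total_Mu times_regular_times_total times_regular_J distrib_cut_times_regular by metis

lemma mult_assoc:
  assumes "plus_cut v" "distrib_cut x" "times_cut y"
  shows "ti (ti v x) y = ti v (ti x y)"
proof -
  have y: "times_total y" and x: "times_total x" "plus_cut x"
    using assms times_cut_distrib_cut distrib_cut_times_regular times_regular_times_total times_regular_J by auto
  have "plus_cut (ti v x)"
    using assms x plus_cut_ti by blast
  then have "Mu v (ti x y) (ti (ti v x) y)"
    using assms x y times_total_Mu unfolding times_cut_def by blast
  then show ?thesis
    using distrib_cut_ti[OF assms(2,3)] assms(1) times_total_Mu distrib_cut_times_regular times_regular_times_total by metis
qed

lemma times_cut_I:
  assumes "distrib_cut y" "\<And>x. distrib_cut x \<Longrightarrow> distrib_cut (ti x y)"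
    "\<And>v x. plus_cut v \<Longrightarrow> distrib_cut x \<Longrightarrow> ti (ti v x) y = ti v (ti x y)"
  shows "times_cut y"
  unfolding times_cut_def
proof (intro conjI allI impI)
  have y: "times_total y"
    using assms distrib_cut_times_regular times_regular_times_total by auto
  show "distrib_cut p" if "distrib_cut x \<and> Mu x y p" for x p
    using that assms y times_total_Mu distrib_cut_times_regular times_regular_J by metis
  show "Mu v p r" if "distrib_cut x \<and> Mu x y p" "plus_cut v \<and> Mu v x q \<and> Mu q y r" for x p v q r
  proof -
    have x: "times_total x" "plus_cut x"
      using that distrib_cut_times_regular times_regular_times_total times_regular_J by auto
    have v: "plus_cut v" "distrib_cut x" "plus_cut (ti v x)"
      using that x plus_cut_ti by auto
    have eqs: "p = ti x y" "q = ti v x"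
      using that v x y times_total_Mu by simp_all
    have "r = ti q y"
      using that times_total_Mu[OF y v(3)] by (simp add: eqs)
    then have "r = ti v p"
      using assms(3)[OF v(1,2)] by (simp add: eqs)
    then show ?thesis
      using assms(2)[OF v(2)] v distrib_cut_times_regular times_regular_times_total times_total_Mu eqs(1) by blast
  qed
qed (rule assms(1))

lemma times_cut_Z: "times_cut Z"
  by (rule times_cut_I) (auto simp: ti_Z distrib_cut_Z)

lemma times_cut_S:
  assumes "times_cut y"
  shows "times_cut (S y)"
proof (rule times_cut_I)
  have y: "distrib_cut y" "times_total y"
    using assms times_cut_distrib_cut distrib_cut_times_regular times_regular_times_total by auto
  show "distrib_cut (S y)"
    using y distrib_cut_S by blast
  show "distrib_cut (ti x (S y))" if "distrib_cut x" for x
    using that y distrib_cut_pl distrib_cut_ti assms by (simp add: ti_S distrib_cut_times_regular times_regular_J)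
  show "ti (ti v x) (S y) = ti v (ti x (S y))" if "plus_cut v" "distrib_cut x" for v x
    using that y distrib_cut_ti[OF that(2) assms] plus_cut_ti[of v x]
    by (simp add: ti_S distrib_cut_times_regular times_regular_J times_regular_times_total distrib mult_assoc assms)
qed

lemma times_cut_pl:
  assumes "times_cut y" "times_cut y'"
  shows "times_cut (pl y y')"
proof (rule times_cut_I)
  have y: "distrib_cut y" "distrib_cut y'"
    using assms times_cut_distrib_cut by auto
  show "distrib_cut (pl y y')"
    using y distrib_cut_pl by blast
  show "distrib_cut (ti x (pl y y'))" if "distrib_cut x" for x
    using that y distrib_cut_pl distrib_cut_ti assms by (simp add: distrib distrib_cut_times_regular times_regular_J)
  show "ti (ti v x) (pl y y') = ti v (ti x (pl y y'))" if "plus_cut v" "distrib_cut x" for v x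
    using that y assms distrib_cut_ti[OF that(2)] plus_cut_ti[of v x]
    by (simp add: distrib_cut_times_regular times_regular_J times_regular_times_total distrib mult_assoc)
qed

lemma times_cut_ti:
  assumes "times_cut y" "times_cut y'"
  shows "times_cut (ti y y')"
proof (rule times_cut_I)
  have y: "distrib_cut y" "distrib_cut y'"
    using assms times_cut_distrib_cut by auto
  have eq: "ti x (ti y y') = ti (ti x y) y'" if "plus_cut x" for x
    using mult_assoc that y assms by simp
  show "distrib_cut (ti y y')"
    using y distrib_cut_ti assms by blast
  show "distrib_cut (ti x (ti y y'))" if "distrib_cut x" for x
    using that y distrib_cut_ti assms eq by (simp add: distrib_cut_times_regular times_regular_J)
  show "ti (ti v x) (ti y y') = ti v (ti x (ti y y'))" if "plus_cut v" "distrib_cut x" for v x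
    using that y assms distrib_cut_ti[OF that(2)] plus_cut_ti[of v x] eq[of "ti v x"]
    by (simp add: distrib_cut_times_regular times_regular_J times_regular_times_total mult_assoc)
qed

section \<open>The downward closed cut and its semiring laws\<close>

lemma N_times_cut: "N x \<Longrightarrow> times_cut x"
  unfolding N_def using le_refl by blast

lemma N_times_regular: "N x \<Longrightarrow> times_regular x"
  using N_times_cut times_cut_distrib_cut distrib_cut_times_regular by blast

lemma N_J: "N x \<Longrightarrow> plus_cut x" "N x \<Longrightarrow> plus_regular x" "N x \<Longrightarrow> plus_total x" "N x \<Longrightarrow> times_total x" "N x \<Longrightarrow> distrib_cut x"
  using N_times_regular times_regular_J times_regular_times_total N_times_cut times_cut_distrib_cut by auto

lemma N_pl: "N (pl x y)" if "N x" "N y"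
  unfolding N_def
proof (intro allI impI)
  fix u
  assume "le u (pl x y)"
  then consider "le u x" | v where "le v y" "A x v u"
    using le_pl[OF N_J(2)[OF \<open>N y\<close>]] by blast
  then show "times_cut u"
  proof cases
    case 2
    then have "times_cut v"
      using that N_def by blast
    moreover have "u = pl x v"
      using 2 \<open>times_cut v\<close> plus_total_A times_cut_distrib_cut distrib_cut_times_regular times_regular_J by metis
    ultimately show ?thesis
      using times_cut_pl N_times_cut that by blast
  qed (use that N_def in blast)
qed

lemma N_ti: "N (ti x y)" if "N x" "N y"
  unfolding N_def
proof (intro allI impI)
  fix u
  assume *: "le u (ti x y)"
  have "Mu x y (ti x y)"
    using that times_total_Mu N_J by metis
  moreover have "times_regular y" "plus_cut x"
    using that N_times_regular N_J by auto
  ultimately consider "u = Z" | v w q where "le v y" "le w x" "Mu x v q" "A q w u"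
    using * unfolding times_regular_def by blast
  then show "times_cut u"
  proof cases
    case 2
    have M: "times_cut v" "times_cut w"
      using that 2 N_def by auto
    then have "q = ti x v" "u = pl q w"
      using 2 times_total_Mu plus_total_A times_cut_distrib_cut distrib_cut_times_regular times_regular_J times_regular_times_total N_J that by metis+
    then show ?thesis
      using times_cut_pl times_cut_ti M N_times_cut that by blast
  qed (simp add: times_cut_Z)
qed

lemma N_S: "N x \<Longrightarrow> N (S x)"
  unfolding N_def using le_S_cases times_cut_S le_refl by metis

sublocale cut: comm_semiring_cut N Z S pl ti
proof
  show "N Z"
    unfolding N_def by (simp add: le_Z times_cut_Z)
  show "x = Z \<or> (\<exists>y. N y \<and> x = S y)" if "N x" for x
  proof -
    have "A Z x x"
      using that N_J plus_total_def by blast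
    then have "x = Z \<or> (\<exists>y. x = S y)"
      using A_iff by blast
    moreover have "N y" if "x = S y" for y
      using that \<open>N x\<close> le_S unfolding N_def by blast
    ultimately show ?thesis
      by blast
  qed
  show "pl (pl x y) z = pl x (pl y z)" if "N x" "N y" "N z" for x y z
    using that assoc N_J plus_cut_plus_total plus_cut_pl by metis
qed (use S_inj S_neq_Z N_S N_pl N_ti pl_Z ti_Z
    in \<open>auto simp: N_J N_times_cut pl_S ti_S distrib mult_assoc N_times_regular intro: comm mult_comm\<close>)

end

text \<open>The parameters are families indexed by the ambient structure, so that each cut is
  defined by one formula in all models.\<close>

locale rel_arith_definable =
  fixes L :: "('f, 'r) language" and Z :: "('f \<Rightarrow> 'a list \<Rightarrow> 'a) \<Rightarrow> 'a"
    and S :: "('f \<Rightarrow> 'a list \<Rightarrow> 'a) \<Rightarrow> 'a \<Rightarrow> 'a" and A Mu :: "('f \<Rightarrow> 'a list \<Rightarrow> 'a) \<Rightarrow> 'a \<Rightarrow> 'a \<Rightarrow> 'a \<Rightarrow> bool"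
  assumes Z: "\<And>n. definable_tm L n (\<lambda>F e. Z F)"
    and S: "\<And>n t. definable_tm L n t \<Longrightarrow> definable_tm L n (\<lambda>F e. S F (t F e))"
    and A: "\<And>n t u v. definable_tm L n t \<Longrightarrow> definable_tm L n u \<Longrightarrow> definable_tm L n v \<Longrightarrow>
      definable L n (\<lambda>F e. A F (t F e) (u F e) (v F e))"
    and Mu: "\<And>n t u v. definable_tm L n t \<Longrightarrow> definable_tm L n u \<Longrightarrow> definable_tm L n v \<Longrightarrow>
      definable L n (\<lambda>F e. Mu F (t F e) (u F e) (v F e))"
begin

lemma le:
  assumes "definable_tm L n t" "definable_tm L n u"
  shows "definable L n (\<lambda>F e. rel_arith_sig.le (A F) (t F e) (u F e))"
proof (rule definable_subst2[OF _ assms])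
  show "definable L 2 (\<lambda>F e. rel_arith_sig.le (A F) (e 0) (e 1))"
    unfolding rel_arith_sig.le_def by (intro definable_intros A) auto
qed

lemmas intros = definable_intros Z S A Mu le

lemma plus_total: "definable_tm L n t \<Longrightarrow> definable L n (\<lambda>F e. rel_arith_sig.plus_total (Z F) (S F) (A F) (t F e))"
  by (erule definable_subst1[rotated], unfold rel_arith_sig.plus_total_def, intro intros) auto

lemma plus_regular: "definable_tm L n t \<Longrightarrow> definable L n (\<lambda>F e. rel_arith_sig.plus_regular (Z F) (S F) (A F) (t F e))"
  by (erule definable_subst1[rotated], unfold rel_arith_sig.plus_regular_def, intro intros plus_total) auto

lemma plus_cut: "definable_tm L n t \<Longrightarrow> definable L n (\<lambda>F e. rel_arith_sig.plus_cut (Z F) (S F) (A F) (t F e))"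
  by (erule definable_subst1[rotated], unfold rel_arith_sig.plus_cut_def, intro intros plus_regular) auto

lemma times_total: "definable_tm L n t \<Longrightarrow> definable L n (\<lambda>F e. rel_arith_sig.times_total (Z F) (S F) (A F) (Mu F) (t F e))"
  by (erule definable_subst1[rotated], unfold rel_arith_sig.times_total_def, intro intros plus_cut) auto

lemma times_regular: "definable_tm L n t \<Longrightarrow> definable L n (\<lambda>F e. rel_arith_sig.times_regular (Z F) (S F) (A F) (Mu F) (t F e))"
  by (erule definable_subst1[rotated], unfold rel_arith_sig.times_regular_def, intro intros plus_cut times_total) auto

lemma distrib_cut: "definable_tm L n t \<Longrightarrow> definable L n (\<lambda>F e. rel_arith_sig.distrib_cut (Z F) (S F) (A F) (Mu F) (t F e))"
  by (erule definable_subst1[rotated], unfold rel_arith_sig.distrib_cut_def, intro intros plus_cut times_regular) auto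

lemma times_cut: "definable_tm L n t \<Longrightarrow> definable L n (\<lambda>F e. rel_arith_sig.times_cut (Z F) (S F) (A F) (Mu F) (t F e))"
  by (erule definable_subst1[rotated], unfold rel_arith_sig.times_cut_def, intro intros plus_cut distrib_cut) auto

lemma N: "definable_tm L n t \<Longrightarrow> definable L n (\<lambda>F e. rel_arith_sig.N (Z F) (S F) (A F) (Mu F) (t F e))"
  by (erule definable_subst1[rotated], unfold rel_arith_sig.N_def, intro intros times_cut) auto

end

section \<open>Robinson arithmetic in the condensed theory\<close>

locale fset_sig =
  fixes emp :: 'a and sg :: "'a \<Rightarrow> 'a" and un :: "'a \<Rightarrow> 'a \<Rightarrow> 'a"
begin

definition mem :: "'a \<Rightarrow> 'a \<Rightarrow> bool" where
  "mem u z \<longleftrightarrow> (\<exists>w. z = un w (sg u))"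

text \<open>The Kuratowski pair. It is a term of the language, so its existence needs no
  axiom.\<close>

definition pair :: "'a \<Rightarrow> 'a \<Rightarrow> 'a" where
  "pair a b = un (sg (sg a)) (sg (un (sg a) (sg b)))"

text \<open>There is no induction to define functions by recursion, but the finite approximations of a
  function satisfy its recursion equations; the successor of \<open>x\<close> is \<open>sg x\<close>.\<close>

definition rec_graph :: "'a \<Rightarrow> ('a \<Rightarrow> 'a \<Rightarrow> bool) \<Rightarrow> 'a \<Rightarrow> 'a \<Rightarrow> bool" where
  "rec_graph b R y z \<longleftrightarrow> (\<exists>f. (\<forall>p. mem p f \<longrightarrow> p = pair emp b \<or>
      (\<exists>y' z' z. p = pair (sg y') z \<and> R z' z \<and> mem (pair y' z') f)) \<and> mem (pair y z) f)"

definition plus_graph :: "'a \<Rightarrow> 'a \<Rightarrow> 'a \<Rightarrow> bool" where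
  "plus_graph x = rec_graph x (\<lambda>z' z. z = sg z')"

definition times_graph :: "'a \<Rightarrow> 'a \<Rightarrow> 'a \<Rightarrow> bool" where
  "times_graph x = rec_graph emp (\<lambda>z' z. plus_graph z' x z)"

end

locale fset = fset_sig +
  assumes un_assoc: "un (un x y) z = un x (un y z)"
    and un_comm: "un x y = un y x"
    and un_emp: "un x emp = x"
    and sg_neq_emp: "sg x \<noteq> emp"
    and un_eq_emp: "un x y = emp \<Longrightarrow> x = emp"
    and sg_inj: "sg x = sg y \<Longrightarrow> x = y"
    and mem_un_sg': "(\<exists>w. un x (sg y) = un w (sg u)) \<longleftrightarrow> (\<exists>w. x = un w (sg u)) \<or> u = y"
begin

lemma mem_un_sg: "mem u (un x (sg y)) \<longleftrightarrow> mem u x \<or> u = y"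
  unfolding mem_def by (rule mem_un_sg')

lemma not_mem_emp: "\<not> mem u emp"
  unfolding mem_def using un_eq_emp un_comm sg_neq_emp by metis

lemma mem_sg: "mem u (sg y) \<longleftrightarrow> u = y"
  using mem_un_sg[of u emp y] not_mem_emp un_comm un_emp by metis

lemma mem_pair: "mem p (pair a b) \<longleftrightarrow> p = sg a \<or> p = un (sg a) (sg b)"
  unfolding pair_def by (simp add: mem_un_sg mem_sg)

text \<open>No extensionality is assumed, but equal sets have equal elements, and comparing the
  elements of the two pairs is enough.\<close>

lemma pair_inject: "pair a b = pair c d \<longleftrightarrow> a = c \<and> b = d"
proof
  assume eq: "pair a b = pair c d"
  have un: "mem u (un (sg v) (sg w)) \<longleftrightarrow> u = v \<or> u = w" for u v w
    by (simp add: mem_un_sg mem_sg)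
  have "sg a = sg c \<or> sg a = un (sg c) (sg d)"
    using mem_pair[of "sg a" a b] mem_pair[of "sg a" c d] eq by simp
  then have a: "a = c"
    using sg_inj mem_sg un by metis
  have "un (sg a) (sg b) = sg c \<or> un (sg a) (sg b) = un (sg c) (sg d)"
    using mem_pair[of "un (sg a) (sg b)" a b] mem_pair[of "un (sg a) (sg b)" c d] eq by simp
  then have "b = c \<or> b = d"
    using un mem_sg by metis
  moreover have "un (sg c) (sg d) = sg a \<or> un (sg c) (sg d) = un (sg a) (sg b)"
    using mem_pair[of "un (sg c) (sg d)" a b] mem_pair[of "un (sg c) (sg d)" c d] eq by simp
  then have "d = a \<or> d = b"
    using un mem_sg by metis
  ultimately show "a = c \<and> b = d"
    using a by auto
qed simp

text \<open>Justification is local: each pair in an approximation \<open>f\<close> is initial or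
  rests on another pair of \<open>f\<close>. The same \<open>f\<close> therefore witnesses all its
  pairs, and adding one pair that rests on them preserves the property.\<close>

lemma rec_graph_iff:
  "rec_graph b R y z \<longleftrightarrow> y = emp \<and> z = b \<or> (\<exists>y' z'. y = sg y' \<and> R z' z \<and> rec_graph b R y' z')"
proof
  assume "rec_graph b R y z"
  then obtain f where f: "mem (pair y z) f"
    "\<And>p. mem p f \<Longrightarrow> p = pair emp b \<or> (\<exists>y' z' z. p = pair (sg y') z \<and> R z' z \<and> mem (pair y' z') f)"
    unfolding rec_graph_def by auto
  have "rec_graph b R y' z'" if "mem (pair y' z') f" for y' z'
    unfolding rec_graph_def using f(2) that by auto
  then show "y = emp \<and> z = b \<or> (\<exists>y' z'. y = sg y' \<and> R z' z \<and> rec_graph b R y' z')"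
    using f(2)[OF f(1)] unfolding pair_inject by blast
next
  assume "y = emp \<and> z = b \<or> (\<exists>y' z'. y = sg y' \<and> R z' z \<and> rec_graph b R y' z')"
  then show "rec_graph b R y z"
  proof
    assume "y = emp \<and> z = b"
    then show ?thesis
      unfolding rec_graph_def by (intro exI[of _ "sg (pair emp b)"]) (simp add: mem_sg)
  next
    assume "\<exists>y' z'. y = sg y' \<and> R z' z \<and> rec_graph b R y' z'"
    then obtain y' z' f where f: "y = sg y'" "R z' z" "mem (pair y' z') f"
      "\<And>p. mem p f \<Longrightarrow> p = pair emp b \<or> (\<exists>y' z' z. p = pair (sg y') z \<and> R z' z \<and> mem (pair y' z') f)"
      unfolding rec_graph_def by auto
    show ?thesis
      unfolding rec_graph_def mem_un_sg
    proof (intro exI[of _ "un f (sg (pair y z))"] conjI allI impI)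
      show "p = pair emp b \<or>
          (\<exists>y' z' z''. p = pair (sg y') z'' \<and> R z' z'' \<and> mem (pair y' z') (un f (sg (pair y z))))"
        if "mem p (un f (sg (pair y z)))" for p
        using that f unfolding mem_un_sg by blast
      show "mem (pair y z) (un f (sg (pair y z)))"
        unfolding mem_un_sg by simp
    qed
  qed
qed

sublocale arith: rel_arith emp sg plus_graph times_graph
proof
  show "plus_graph x y z \<longleftrightarrow> y = emp \<and> z = x \<or> (\<exists>y' z'. y = sg y' \<and> z = sg z' \<and> plus_graph x y' z')" for x y z
    unfolding plus_graph_def by (rule rec_graph_iff)
  show "times_graph x y z \<longleftrightarrow>
      y = emp \<and> z = emp \<or> (\<exists>y' z'. y = sg y' \<and> times_graph x y' z' \<and> plus_graph z' x z)" for x y z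
    unfolding times_graph_def using rec_graph_iff[of emp "\<lambda>z' z. plus_graph z' x z" y z] by blast
qed (use sg_inj sg_neq_emp in auto)

end

section \<open>Definability in models of the condensed theory, and the interpretation of
  arithmetic\<close>

instance F_sym :: countable
  by countable_datatype

instance Q_sym :: countable
  by countable_datatype

abbreviation F_emp :: "(F_sym \<Rightarrow> 'a list \<Rightarrow> 'a) \<Rightarrow> 'a" where
  "F_emp F \<equiv> F Emp_sym []"
abbreviation F_sg :: "(F_sym \<Rightarrow> 'a list \<Rightarrow> 'a) \<Rightarrow> 'a \<Rightarrow> 'a" where
  "F_sg F x \<equiv> F Sing_sym [x]"
abbreviation F_un :: "(F_sym \<Rightarrow> 'a list \<Rightarrow> 'a) \<Rightarrow> 'a \<Rightarrow> 'a \<Rightarrow> 'a" where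
  "F_un F x y \<equiv> F Un_sym [x, y]"

lemma definable_F_terms:
  "definable_tm F_lang n (\<lambda>F e. F_emp F)"
  "definable_tm F_lang n t \<Longrightarrow> definable_tm F_lang n (\<lambda>F e. F_sg F (t F e))"
  "definable_tm F_lang n t \<Longrightarrow> definable_tm F_lang n u \<Longrightarrow> definable_tm F_lang n (\<lambda>F e. F_un F (t F e) (u F e))"
  by (intro definable_tm_Fun0 definable_tm_Fun1 definable_tm_Fun2; simp add: F_lang_def)+

lemma definable_pair:
  "definable_tm F_lang n t \<Longrightarrow> definable_tm F_lang n u \<Longrightarrow>
    definable_tm F_lang n (\<lambda>F e. fset_sig.pair (F_sg F) (F_un F) (t F e) (u F e))"
  unfolding fset_sig.pair_def by (intro definable_F_terms)

lemma definable_mem: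
  assumes "definable_tm F_lang n t" "definable_tm F_lang n u"
  shows "definable F_lang n (\<lambda>F e. fset_sig.mem (F_sg F) (F_un F) (t F e) (u F e))"
proof (rule definable_subst2[OF _ assms])
  show "definable F_lang 2 (\<lambda>F e. fset_sig.mem (F_sg F) (F_un F) (e 0) (e 1))"
    unfolding fset_sig.mem_def by (intro definable_intros definable_F_terms) auto
qed

lemma definable_plus_graph:
  assumes "definable_tm F_lang n t" "definable_tm F_lang n u" "definable_tm F_lang n v"
  shows "definable F_lang n (\<lambda>F e. fset_sig.plus_graph (F_emp F) (F_sg F) (F_un F) (t F e) (u F e) (v F e))"
proof (rule definable_subst3[OF _ assms])
  show "definable F_lang 3 (\<lambda>F e. fset_sig.plus_graph (F_emp F) (F_sg F) (F_un F) (e 0) (e 1) (e 2))"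
    unfolding fset_sig.plus_graph_def fset_sig.rec_graph_def
    by (intro definable_intros definable_F_terms definable_pair definable_mem) auto
qed

lemma definable_times_graph:
  assumes "definable_tm F_lang n t" "definable_tm F_lang n u" "definable_tm F_lang n v"
  shows "definable F_lang n (\<lambda>F e. fset_sig.times_graph (F_emp F) (F_sg F) (F_un F) (t F e) (u F e) (v F e))"
proof (rule definable_subst3[OF _ assms])
  show "definable F_lang 3 (\<lambda>F e. fset_sig.times_graph (F_emp F) (F_sg F) (F_un F) (e 0) (e 1) (e 2))"
    unfolding fset_sig.times_graph_def fset_sig.rec_graph_def
    by (intro definable_intros definable_F_terms definable_pair definable_mem definable_plus_graph) auto
qed

interpretation F_definable: rel_arith_definable F_lang F_emp F_sg
  "\<lambda>F. fset_sig.plus_graph (F_emp F) (F_sg F) (F_un F)" "\<lambda>F. fset_sig.times_graph (F_emp F) (F_sg F) (F_un F)"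
  by unfold_locales (intro definable_F_terms definable_plus_graph definable_times_graph; assumption)+

lemmas F_axioms = F1_ax_def F2_ax_def F3_ax_def F5_ax_def F6_ax_def F7_ax_def Id_ax_def M_ax_def

lemmas Q_axioms = Q1_ax_def Q2_ax_def Q3_ax_def Q4_ax_def Q5_ax_def Q6_ax_def Q7_ax_def

lemma sat_alls_1: "sat D F R e (alls (Suc 0) p) \<longleftrightarrow> (\<forall>x\<in>D. sat D F R (case_nat x e) p)"
  by (simp add: alls_def)

lemma sat_alls_2: "sat D F R e (alls 2 p) \<longleftrightarrow> (\<forall>x\<in>D. \<forall>y\<in>D. sat D F R (case_nat y (case_nat x e)) p)"
  by (simp add: alls_def numeral_2_eq_2)

lemma sat_alls_3: "sat D F R e (alls 3 p) \<longleftrightarrow>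
    (\<forall>x\<in>D. \<forall>y\<in>D. \<forall>z\<in>D. sat D F R (case_nat z (case_nat y (case_nat x e))) p)"
  by (simp add: alls_def numeral_3_eq_3)

lemma sat_mem1: "sat D F R e (mem1 u z) \<longleftrightarrow> (\<exists>w\<in>D. eval F e z = F_un F w (F_sg F (eval F e u)))"
  by (simp add: mem1_def lift_tm_def eval_subst)

lemmas sat_alls_simps = sat_alls_1 sat_alls_2 sat_alls_3 sat_mem1 Let_def

lemma wf_F_axioms: "q \<in> axs F_c_minus \<Longrightarrow> wf_fm L 0 q" if "funs F_lang \<subseteq> funs L"
  using that
  by (auto simp: F_c_minus_def F_axioms F_lang_def alls_def mem1_def lift_tm_def numeral_2_eq_2 numeral_3_eq_3 Let_def)

lemma wf_Q_axioms: "q \<in> axs Q_arith \<Longrightarrow> wf_fm L 0 q" if "funs Q_lang \<subseteq> funs L"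
  using that
  by (auto simp: Q_arith_def Q_axioms Q_lang_def alls_def numeral_2_eq_2 numeral_3_eq_3 Let_def)

lemma forall2_elim: "\<Gamma> \<turnstile> Forall (Forall p) \<Longrightarrow> \<Gamma> \<turnstile> subst_fm (case_nat t (case_nat s Var)) p"
  using deriv.AllE[of \<Gamma> "subst_fm (case_nat (Var 0) (\<lambda>i. lift_tm (case_nat s Var i))) p" t]
    deriv.AllE[of \<Gamma> "Forall p" s] by (simp add: inst_subst_up) (simp add: inst_def)

text \<open>An injective operation and a value it omits, derived for arbitrary terms: the form in
  which \<open>completeness\<close> asks for infinite models.\<close>

lemma F_derivable:
  "axs F_c_minus \<turnstile> Imp (Eq (sing s) (sing t)) (Eq s t)"
  "axs F_c_minus \<turnstile> Neg (Eq (sing t) emp)"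
proof -
  have "axs F_c_minus \<turnstile> F7_ax" "axs F_c_minus \<turnstile> F5_ax"
    by (auto simp: F_c_minus_def intro: deriv.Hyp)
  then show "axs F_c_minus \<turnstile> Imp (Eq (sing s) (sing t)) (Eq s t)" "axs F_c_minus \<turnstile> Neg (Eq (sing t) emp)"
    using forall2_elim[of "axs F_c_minus" "Imp (Eq (sing (Var 1)) (sing (Var 0))) (Eq (Var 1) (Var 0))" t s]
      deriv.AllE[of "axs F_c_minus" "Neg (Eq (sing (Var 0)) emp)" t]
    by (auto simp: F_axioms alls_def numeral_2_eq_2 inst_def Let_def)
qed

lemma models_F:
  assumes "models F F_c_minus"
  shows "fset (F_emp F) (F_sg F) (F_un F)"
proof -
  obtain R where "\<forall>p\<in>axs F_c_minus. \<forall>e. sat UNIV F R e p"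
    using assms unfolding models_def by blast
  then have ax: "sat UNIV F R e F1_ax" "sat UNIV F R e F2_ax" "sat UNIV F R e F3_ax"
    "sat UNIV F R e F5_ax" "sat UNIV F R e F6_ax" "sat UNIV F R e F7_ax" "sat UNIV F R e M_ax" for e
    by (simp_all add: F_c_minus_def)
  show ?thesis
  proof
    show "F_un F (F_un F x y) z = F_un F x (F_un F y z)" for x y z
      using ax(1) by (simp add: F_axioms sat_alls_simps)
    show "F_un F x y = F_un F y x" for x y
      using ax(2) by (simp add: F_axioms sat_alls_simps)
    show "F_un F x (F_emp F) = x" for x
      using ax(3) by (simp add: F_axioms sat_alls_simps)
    show "F_sg F x \<noteq> F_emp F" for x
      using ax(4) by (simp add: F_axioms sat_alls_simps)
    show "F_un F x y = F_emp F \<Longrightarrow> x = F_emp F" for x y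
      using ax(5) by (auto simp: F_axioms sat_alls_simps)
    show "F_sg F x = F_sg F y \<Longrightarrow> x = y" for x y
      using ax(6) by (auto simp: F_axioms sat_alls_simps)
    show "(\<exists>w. F_un F x (F_sg F y) = F_un F w (F_sg F u)) \<longleftrightarrow> (\<exists>w. x = F_un F w (F_sg F u)) \<or> u = y" for x y u
      using ax(7) by (simp add: F_axioms sat_alls_simps) metis
  qed
qed

theorem Q_interpretable_in_F: "interpretable_in Q_arith F_c_minus"
proof -
  define D where "D F = {x. rel_arith_sig.N (F_emp F) (F_sg F) (fset_sig.plus_graph (F_emp F) (F_sg F) (F_un F))
      (fset_sig.times_graph (F_emp F) (F_sg F) (F_un F)) x}" for F :: "F_sym \<Rightarrow> nat list \<Rightarrow> nat"
  define P where "P f F e = (case f of Zero_sym \<Rightarrow> e 0 = F_emp F | Succ_sym \<Rightarrow> e 1 = F_sg F (e 0)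
      | Plus_sym \<Rightarrow> fset_sig.plus_graph (F_emp F) (F_sg F) (F_un F) (e 0) (e 1) (e 2)
      | Times_sym \<Rightarrow> fset_sig.times_graph (F_emp F) (F_sg F) (F_un F) (e 0) (e 1) (e 2))"
    for f and F :: "F_sym \<Rightarrow> nat list \<Rightarrow> nat" and e :: "nat \<Rightarrow> nat"
  define G where "G F f xs = (THE y. P f F ((!) (xs @ [y])))"
    for F :: "F_sym \<Rightarrow> nat list \<Rightarrow> nat" and f xs
  have length: "length xs = 2 \<longleftrightarrow> (\<exists>x y. xs = [x, y])" for xs :: "nat list"
    by (auto simp: numeral_2_eq_2 length_Suc_conv)
  have model: "D F \<noteq> {} \<and>
      (\<forall>(f, n)\<in>funs Q_lang. \<forall>xs. length xs = n \<and> set xs \<subseteq> D F \<longrightarrow>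
        G F f xs \<in> D F \<and> (\<forall>y\<in>D F. P f F ((!) (xs @ [y])) \<longleftrightarrow> y = G F f xs)) \<and>
      (\<forall>p\<in>axs Q_arith. \<forall>R e. sat (D F) (G F) R e p)" if "models F F_c_minus" for F
  proof -
    interpret fset "F_emp F" "F_sg F" "F_un F"
      using that by (rule models_F)
    have D: "x \<in> D F \<longleftrightarrow> arith.N x" for x
      by (simp add: D_def)
    have G: "G F Zero_sym [] = F_emp F" "G F Succ_sym [x] = F_sg F x"
        "y \<in> D F \<Longrightarrow> G F Plus_sym [x, y] = arith.pl x y"
        "x \<in> D F \<Longrightarrow> y \<in> D F \<Longrightarrow> G F Times_sym [x, y] = arith.ti x y" for x y
      by (auto simp: G_def P_def D arith.plus_total_A arith.times_total_Mu arith.N_J)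
    note cut = arith.cut.N_Z arith.cut.N_S arith.cut.N_pl arith.cut.N_ti
    \<comment> \<open>The quantifier in \<open>Q3_ax\<close> is relativized, so the predecessor
      itself must lie in the domain.\<close>
    have pred: "\<exists>y\<in>D F. x = F_sg F y" if "arith.N x" "x \<noteq> F_emp F" for x
      using arith.cut.N_cases[OF that(1)] that(2) D by blast
    have "sat (D F) (G F) R e p" if "p \<in> axs Q_arith" for R e p
      using that
      by (auto dest!: pred simp: Q_arith_def Q_axioms sat_alls_simps G D cut arith.cut.S_inj arith.cut.S_neq_Z
          arith.cut.pl_Z arith.cut.pl_S arith.cut.ti_Z arith.cut.ti_S)
    moreover have "D F \<noteq> {}"
      using cut(1) D by blast
    ultimately show ?thesis
      by (auto simp: Q_lang_def length length_Suc_conv G P_def D arith.plus_total_A arith.times_total_Mu arith.N_J cut)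
  qed
  show ?thesis
  proof (rule interpretable_inI[where D = D and G = G and P = P and c = Sing_sym and z = Emp_sym])
    show "definable (lang F_c_minus) 1 (\<lambda>F e. e 0 \<in> D F)"
      by (simp add: F_c_minus_def D_def) (intro F_definable.N definable_intros, simp)
    show "definable (lang F_c_minus) (Suc n) (P f)" if "(f, n) \<in> funs (lang Q_arith)" for f n
      using that unfolding P_def
      by (auto simp: F_c_minus_def Q_arith_def Q_lang_def
          intro!: definable_intros definable_F_terms definable_plus_graph definable_times_graph)
  qed (use model F_derivable wf_F_axioms wf_Q_axioms in \<open>auto simp: Q_arith_def Q_lang_def\<close>)
qed

section \<open>Finite sets in an ordered semiring\<close>

locale arith_sig =
  fixes N :: "'a \<Rightarrow> bool" and Z :: 'a and S :: "'a \<Rightarrow> 'a"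
    and pl :: "'a \<Rightarrow> 'a \<Rightarrow> 'a" (infixl "[+]" 65) and ti :: "'a \<Rightarrow> 'a \<Rightarrow> 'a" (infixl "[*]" 70)
begin

abbreviation ex_in (binder "\<exists>\<^sub>N" 10) where
  "ex_in P \<equiv> \<exists>x. N x \<and> P x"

text \<open>The difference must lie in \<open>N\<close>, so the order depends on the cut and has to
  be compared anew when the cut shrinks.\<close>

definition leq :: "'a \<Rightarrow> 'a \<Rightarrow> bool" where
  "leq x y \<longleftrightarrow> (\<exists>\<^sub>N z. y = x [+] z)"

text \<open>With the next two definitions, this shortens an arbitrary property that holds at zero
  and passes to successors: downward closure, then closure under addition, then under
  multiplication.\<close>

definition hereditary :: "('a \<Rightarrow> bool) \<Rightarrow> 'a \<Rightarrow> bool" where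
  "hereditary P x \<longleftrightarrow> N x \<and> (\<forall>y. N y \<and> leq y x \<longrightarrow> P y)"

definition plus_closed :: "('a \<Rightarrow> bool) \<Rightarrow> 'a \<Rightarrow> bool" where
  "plus_closed P x \<longleftrightarrow> hereditary P x \<and> (\<forall>y. hereditary P y \<longrightarrow> hereditary P (y [+] x))"

definition shorten :: "('a \<Rightarrow> bool) \<Rightarrow> 'a \<Rightarrow> bool" where
  "shorten P x \<longleftrightarrow> plus_closed P x \<and> (\<forall>y. plus_closed P y \<longrightarrow> plus_closed P (y [*] x))"

text \<open>Comparability and cancellation are stated for one fixed \<open>y\<close>, so that they
  form a property that can be propagated along the successor.\<close>

definition linear_at :: "'a \<Rightarrow> bool" where
  "linear_at y \<longleftrightarrow> (\<forall>x. N x \<longrightarrow> leq x y \<or> leq y x) \<and>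
    (\<forall>x z. N x \<and> N z \<and> x [+] y = z [+] y \<longrightarrow> x = z)"

definition one :: 'a where
  "one = S Z"

text \<open>Determinant one, with the negative term moved to the other side.\<close>

definition unimod :: "'a \<Rightarrow> 'a \<Rightarrow> 'a \<Rightarrow> 'a \<Rightarrow> bool" where
  "unimod a b c d \<longleftrightarrow> a [*] d = b [*] c [+] one"

text \<open>The pairs of sum s have values from s^2 to s^2 + s, which is below (s + 1)^2. The
  pairing is polynomial, so every cut is closed under it.\<close>

definition pr :: "'a \<Rightarrow> 'a \<Rightarrow> 'a" where
  "pr x y = (x [+] y) [*] (x [+] y) [+] x"

definition code :: "'a \<Rightarrow> 'a \<Rightarrow> 'a \<Rightarrow> 'a \<Rightarrow> 'a" where
  "code a b c d = pr (pr a b) (pr c d)"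

text \<open>Unimodular matrices with entries in the semiring play the role of words over the alphabet
  \<open>A = (1 1; 0 1)\<close>, \<open>B = (1 0; 1 1)\<close>. A matrix \<open>X\<close> is taken as a code of the set of all \<open>u\<close> such that
  \<open>B A\<^sup>u B\<close> is a subword of \<open>B X\<close>. Below \<open>X = (a b; c d)\<close>, \<open>(m n; k l) = A\<^sup>u B (e f; g h)\<close>, and
  the subword is preceded by \<open>(p q; r s)\<close>.\<close>

definition block_word :: "'a \<Rightarrow> 'a \<Rightarrow> 'a \<Rightarrow> 'a \<Rightarrow> 'a \<Rightarrow> bool" where
  "block_word u m n k l \<longleftrightarrow> (\<exists>\<^sub>N e. \<exists>\<^sub>N f. \<exists>\<^sub>N g. \<exists>\<^sub>N h. unimod e f g h \<and>
    k = e [+] g \<and> l = f [+] h \<and> m = e [+] u [*] k \<and> n = f [+] u [*] l)"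

text \<open>Entry by entry, the equations say B X = P B M for P = (p q; r s) and M = (m n; k l). The
  letter B put in front of X makes the first block look like every later one.\<close>

definition has_block :: "'a \<Rightarrow> 'a \<Rightarrow> 'a \<Rightarrow> 'a \<Rightarrow> 'a \<Rightarrow> bool" where
  "has_block u a b c d \<longleftrightarrow> (\<exists>\<^sub>N m. \<exists>\<^sub>N n. \<exists>\<^sub>N k. \<exists>\<^sub>N l. block_word u m n k l \<and>
    (\<exists>\<^sub>N p. \<exists>\<^sub>N q. \<exists>\<^sub>N r. \<exists>\<^sub>N s. unimod p q r s \<and>
      a = p [*] m [+] q [*] (m [+] k) \<and> b = p [*] n [+] q [*] (n [+] l) \<and>
      a [+] c = r [*] m [+] s [*] (m [+] k) \<and> b [+] d = r [*] n [+] s [*] (n [+] l)))"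

text \<open>A number that codes no unimodular matrix counts as a set without elements.\<close>

definition memb :: "'a \<Rightarrow> 'a \<Rightarrow> bool" where
  "memb u x \<longleftrightarrow> (\<exists>\<^sub>N a. \<exists>\<^sub>N b. \<exists>\<^sub>N c. \<exists>\<^sub>N d. x = code a b c d \<and> unimod a b c d \<and> has_block u a b c d)"

end

sublocale comm_semiring_cut \<subseteq> arith_sig N Z S pl ti .

context comm_semiring_cut
begin

notation pl (infixl "[+]" 65) and ti (infixl "[*]" 70)

section \<open>Algebra and order in a cut\<close>

lemmas N_closed [simp, intro] = N_Z N_S N_pl N_ti

lemma S_eq_iff [simp]: "S x = S y \<longleftrightarrow> x = y"
  using S_inj by blast

lemma N_one [simp, intro]: "N one"
  by (simp add: one_def)

lemma pl_one: "N x \<Longrightarrow> S x = x [+] one"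
  by (simp add: one_def pl_S pl_Z)

lemma Z_pl: "N x \<Longrightarrow> Z [+] x = x"
  using pl_comm[of Z x] pl_Z by simp

lemma Z_ti: "N x \<Longrightarrow> Z [*] x = Z"
  using ti_comm[of Z x] ti_Z by simp

lemma ti_one: "N x \<Longrightarrow> x [*] one = x"
  by (simp add: one_def ti_S ti_Z Z_pl)

lemma one_ti: "N x \<Longrightarrow> one [*] x = x"
  using ti_comm[of one x] ti_one by simp

lemma pl_left_comm: "N x \<Longrightarrow> N y \<Longrightarrow> N z \<Longrightarrow> x [+] (y [+] z) = y [+] (x [+] z)"
  using pl_assoc[of x y z] pl_assoc[of y x z] pl_comm[of x y] by simp

lemma ti_left_comm: "N x \<Longrightarrow> N y \<Longrightarrow> N z \<Longrightarrow> x [*] (y [*] z) = y [*] (x [*] z)"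
  using ti_assoc[of x y z] ti_assoc[of y x z] ti_comm[of x y] by simp

lemma pl_ti: "N x \<Longrightarrow> N y \<Longrightarrow> N z \<Longrightarrow> (x [+] y) [*] z = x [*] z [+] y [*] z"
  using ti_pl[of z x y] ti_comm[of z] by simp

lemmas alg = pl_assoc pl_comm pl_left_comm ti_assoc ti_comm ti_left_comm ti_pl pl_ti
  pl_Z Z_pl ti_Z Z_ti ti_one one_ti

lemma one_neq_Z: "one \<noteq> Z"
  by (simp add: one_def S_neq_Z)

lemma sum_eq_Z: "N x \<Longrightarrow> N y \<Longrightarrow> x [+] y = Z \<longleftrightarrow> x = Z \<and> y = Z"
  using N_cases[of y] pl_S[of _ x] S_neq_Z pl_Z by metis

lemma sum_eq_one:
  assumes "N x" "N y" "x [+] y = one"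
  shows "x = Z \<and> y = one \<or> x = one \<and> y = Z"
proof -
  consider "y = Z" | y' where "N y'" "y = S y'"
    using N_cases assms by blast
  then show ?thesis
  proof cases
    case 2
    then have "x [+] y' = Z"
      using assms by (simp add: pl_S one_def)
    then show ?thesis
      using sum_eq_Z[of x y'] 2 assms by (simp add: one_def)
  qed (use assms pl_Z in simp)
qed

lemma prod_eq_Z:
  assumes "N x" "N y" "x [*] y = Z"
  shows "x = Z \<or> y = Z"
proof -
  consider "y = Z" | y' where "N y'" "y = S y'"
    using N_cases assms by blast
  then show ?thesis
    using assms by cases (auto simp: ti_S sum_eq_Z)
qed

lemma prod_eq_one:
  assumes "N x" "N y" "x [*] y = one"
  shows "x = one \<and> y = one"
proof -
  consider "y = Z" | y' where "N y'" "y = S y'"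
    using N_cases assms by blast
  then show ?thesis
  proof cases
    case 2
    then have "x [*] y' [+] x = one"
      using assms by (simp add: ti_S)
    then have "x [*] y' = Z \<and> x = one \<or> x [*] y' = one \<and> x = Z"
      using sum_eq_one[of "x [*] y'" x] 2 assms by simp
    then show ?thesis
    proof
      assume *: "x [*] y' = Z \<and> x = one"
      then have "y' = Z"
        using 2 one_ti[of y'] by metis
      then show ?thesis
        using * 2 by (simp add: one_def)
    next
      assume "x [*] y' = one \<and> x = Z"
      then show ?thesis
        using 2 Z_ti one_neq_Z by metis
    qed
  qed (use assms one_neq_Z ti_Z in auto)
qed

lemma leq_N: "N x \<Longrightarrow> leq x x" "N x \<Longrightarrow> leq Z x"
  unfolding leq_def using pl_Z Z_pl N_Z by metis+

lemma leq_trans: "N x \<Longrightarrow> leq x y \<Longrightarrow> leq y z \<Longrightarrow> leq x z"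
  unfolding leq_def using pl_assoc N_pl by metis

lemma leq_pl: "N x \<Longrightarrow> N y \<Longrightarrow> leq x (x [+] y)" "N x \<Longrightarrow> N y \<Longrightarrow> leq y (x [+] y)"
  unfolding leq_def using pl_comm by metis+

lemma leq_Z: "N x \<Longrightarrow> leq x Z \<Longrightarrow> x = Z"
  unfolding leq_def using sum_eq_Z by metis

lemma leq_S_cases:
  assumes "N x" "N y" "leq y (S x)"
  shows "y = S x \<or> leq y x"
proof -
  obtain z where z: "N z" "S x = y [+] z"
    using assms leq_def by blast
  consider "z = Z" | z' where "N z'" "z = S z'"
    using N_cases z by blast
  then show ?thesis
  proof cases
    case 2
    then have "x = y [+] z'"
      using z assms(2) by (simp add: pl_S)
    then show ?thesis
      using 2 leq_def by blast
  qed (use z pl_Z in simp)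
qed

lemma leq_S: "N y \<Longrightarrow> N x \<Longrightarrow> leq y x \<Longrightarrow> leq y (S x)"
  using leq_trans[of y x "S x"] leq_pl(1)[of x one] by (simp add: pl_one)

lemma leq_pl_mono: "N x \<Longrightarrow> N y \<Longrightarrow> leq x y \<Longrightarrow> N z \<Longrightarrow> leq (z [+] x) (z [+] y)"
  unfolding leq_def using pl_assoc by metis

lemma leq_ti_mono: "N x \<Longrightarrow> N y \<Longrightarrow> leq x y \<Longrightarrow> N z \<Longrightarrow> leq (z [*] x) (z [*] y)"
  unfolding leq_def using ti_pl N_ti by metis

end

text \<open>\<open>shorten P\<close> will be a subcut on which \<open>P\<close> holds throughout;
  passing to it replaces an induction for \<open>P\<close>.\<close>

locale inductive_property = comm_semiring_cut +
  fixes P :: "'a \<Rightarrow> bool"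
  assumes P_Z: "P Z" and P_S: "N x \<Longrightarrow> P x \<Longrightarrow> P (S x)"
begin

lemma hereditary_N: "hereditary P x \<Longrightarrow> N x"
  unfolding hereditary_def by (rule conjunct1)

lemma plus_closed_hereditary: "plus_closed P x \<Longrightarrow> hereditary P x"
  unfolding plus_closed_def by (rule conjunct1)

lemma shorten_plus_closed: "shorten P x \<Longrightarrow> plus_closed P x"
  unfolding shorten_def by (rule conjunct1)

lemma hereditary_P: "hereditary P x \<Longrightarrow> P x"
  unfolding hereditary_def using leq_N by blast

lemma hereditary_down: "hereditary P x \<Longrightarrow> N y \<Longrightarrow> leq y x \<Longrightarrow> hereditary P y"
  unfolding hereditary_def using leq_trans by blast

lemma hereditary_Z: "hereditary P Z"
  unfolding hereditary_def using leq_Z P_Z N_Z by metis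

lemma hereditary_S:
  assumes "hereditary P x"
  shows "hereditary P (S x)"
  unfolding hereditary_def
proof (intro conjI allI impI)
  have x: "N x" "P x" "N y \<and> leq y x \<Longrightarrow> P y" for y
    using assms hereditary_P unfolding hereditary_def by auto
  then show "N (S x)"
    by simp
  show "P y" if "N y \<and> leq y (S x)" for y
    using leq_S_cases[of x y] that x P_S by blast
qed

lemma plus_closed_N: "plus_closed P x \<Longrightarrow> N x"
  using plus_closed_hereditary hereditary_N by blast

lemma plus_closed_Z: "plus_closed P Z"
  unfolding plus_closed_def using hereditary_Z by (simp add: pl_Z)

lemma plus_closed_S: "plus_closed P x \<Longrightarrow> plus_closed P (S x)"
  unfolding plus_closed_def by (simp add: hereditary_S hereditary_N pl_S)

lemma plus_closed_down:
  assumes "plus_closed P x" "N y" "leq y x"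
  shows "plus_closed P y"
  unfolding plus_closed_def
proof (intro conjI allI impI)
  show "hereditary P y"
    by (rule hereditary_down[OF plus_closed_hereditary[OF assms(1)] assms(2,3)])
  show "hereditary P (z [+] y)" if z: "hereditary P z" for z
  proof (rule hereditary_down)
    show "hereditary P (z [+] x)"
      using assms(1) z by (simp add: plus_closed_def)
    show "N (z [+] y)" "leq (z [+] y) (z [+] x)"
      using z assms hereditary_N plus_closed_N leq_pl_mono by simp_all
  qed
qed

lemma plus_closed_pl:
  assumes "plus_closed P x" "plus_closed P y"
  shows "plus_closed P (x [+] y)"
  unfolding plus_closed_def
proof (intro conjI allI impI)
  show "hereditary P (x [+] y)"
    using assms plus_closed_def by simp
  show "hereditary P (z [+] (x [+] y))" if z: "hereditary P z" for z
  proof -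
    have "hereditary P ((z [+] x) [+] y)"
      using assms z by (simp add: plus_closed_def)
    then show ?thesis
      using assms z by (simp add: pl_assoc plus_closed_N hereditary_N)
  qed
qed

lemma shorten_N: "shorten P x \<Longrightarrow> N x"
  using shorten_plus_closed plus_closed_N by blast

lemma shorten_P: "shorten P x \<Longrightarrow> P x"
  using shorten_plus_closed plus_closed_hereditary hereditary_P by blast

lemma shorten_Z: "shorten P Z"
  unfolding shorten_def using plus_closed_Z by (simp add: ti_Z)

lemma shorten_S: "shorten P x \<Longrightarrow> shorten P (S x)"
  unfolding shorten_def by (simp add: plus_closed_S plus_closed_N ti_S plus_closed_pl)

lemma shorten_down:
  assumes "shorten P x" "N y" "leq y x"
  shows "shorten P y"
  unfolding shorten_def
proof (intro conjI allI impI)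
  show "plus_closed P y"
    by (rule plus_closed_down[OF shorten_plus_closed[OF assms(1)] assms(2,3)])
  show "plus_closed P (z [*] y)" if z: "plus_closed P z" for z
  proof (rule plus_closed_down)
    show "plus_closed P (z [*] x)"
      using assms(1) z by (simp add: shorten_def)
    show "N (z [*] y)" "leq (z [*] y) (z [*] x)"
      using z assms plus_closed_N shorten_N leq_ti_mono by simp_all
  qed
qed

lemma shorten_pl:
  assumes "shorten P x" "shorten P y"
  shows "shorten P (x [+] y)"
  unfolding shorten_def
proof (intro conjI allI impI)
  show "plus_closed P (x [+] y)"
    using assms shorten_plus_closed plus_closed_pl by simp
  show "plus_closed P (z [*] (x [+] y))" if z: "plus_closed P z" for z
  proof -
    have "plus_closed P (z [*] x [+] z [*] y)"
      using assms z by (simp add: shorten_def plus_closed_pl)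
    then show ?thesis
      using assms z by (simp add: ti_pl shorten_N plus_closed_N)
  qed
qed

lemma shorten_ti:
  assumes "shorten P x" "shorten P y"
  shows "shorten P (x [*] y)"
  unfolding shorten_def
proof (intro conjI allI impI)
  show "plus_closed P (x [*] y)"
    using assms(2)[unfolded shorten_def] shorten_plus_closed[OF assms(1)] by simp
  show "plus_closed P (z [*] (x [*] y))" if z: "plus_closed P z" for z
  proof -
    have "plus_closed P ((z [*] x) [*] y)"
      using assms z by (simp add: shorten_def)
    then show ?thesis
      using assms z by (simp add: ti_assoc shorten_N plus_closed_N)
  qed
qed

text \<open>The laws restrict to a subclass. The predecessor is in the subclass because it lies
  below its successor.\<close>

lemma shorten_cut: "comm_semiring_cut (shorten P) Z S (pl) (ti)"
proof
  show "x = Z \<or> (\<exists>y. shorten P y \<and> x = S y)" if "shorten P x" for x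
  proof -
    have "shorten P y" if "N y" "x = S y" for y
      using shorten_down[OF \<open>shorten P x\<close> that(1)] leq_S[of y y] leq_N[of y] that by simp
    then show ?thesis
      using N_cases shorten_N that by blast
  qed
qed (use shorten_Z shorten_S shorten_pl shorten_ti S_inj S_neq_Z pl_Z ti_Z in
  \<open>auto simp: shorten_N pl_S ti_S pl_assoc ti_pl ti_assoc intro: pl_comm ti_comm\<close>)

end

locale ordered_cut = comm_semiring_cut +
  assumes linear: "N x \<Longrightarrow> N y \<Longrightarrow> leq x y \<or> leq y x"
    and cancel_right: "N x \<Longrightarrow> N y \<Longrightarrow> N z \<Longrightarrow> x [+] z = y [+] z \<Longrightarrow> x = y"

context comm_semiring_cut
begin

lemma linear_at_inductive: "inductive_property N Z S (pl) (ti) linear_at"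
proof (unfold_locales)
  show "linear_at Z"
    unfolding linear_at_def using leq_N pl_Z by auto
  show "linear_at (S y)" if y: "N y" "linear_at y" for y
    unfolding linear_at_def
  proof (intro conjI allI impI)
    show "x = z" if "N x \<and> N z \<and> x [+] S y = z [+] S y" for x z
      using that y unfolding linear_at_def by (simp add: pl_S)
    show "leq x (S y) \<or> leq (S y) x" if x: "N x" for x
    proof (cases "leq x y")
      case True
      then show ?thesis
        using leq_S x y by blast
    next
      case False
      then obtain z where z: "N z" "x = y [+] z"
        using x y unfolding linear_at_def leq_def by blast
      then consider "z = Z" | z' where "N z'" "z = S z'"
        using N_cases by blast
      then show ?thesis
      proof cases
        case 1
        then show ?thesis
          using False z leq_N x pl_Z by simp
      next
        case 2
        then have "x = S y [+] z'"
          using z y by (simp add: pl_one alg)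
        then show ?thesis
          using 2 leq_def by blast
      qed
    qed
  qed
qed

interpretation lin: inductive_property N Z S pl ti linear_at
  by (rule linear_at_inductive)

text \<open>Comparability in the larger cut suffices: the difference lies below the larger element,
  so downward closure puts it into the smaller cut, and the two orders agree there.\<close>

lemma shorten_linear_at: "ordered_cut (shorten linear_at) Z S (pl) (ti)"
proof -
  interpret sh: comm_semiring_cut "shorten linear_at" Z S pl ti
    by (rule lin.shorten_cut)
  show ?thesis
  proof
    fix x y assume x: "shorten linear_at x" and y: "shorten linear_at y"
    have "sh.leq v w" if vw: "shorten linear_at v" "shorten linear_at w" "leq v w" for v w
    proof -
      obtain z where z: "N z" "w = v [+] z"
        using vw(3) unfolding leq_def by blast
      then have "leq z w"
        using leq_pl vw lin.shorten_N by blast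
      then have "shorten linear_at z"
        using lin.shorten_down[OF vw(2) z(1)] by blast
      then show ?thesis
        unfolding sh.leq_def using z by blast
    qed
    moreover have "leq x y \<or> leq y x"
      using lin.shorten_P[OF y] lin.shorten_N[OF x] by (simp add: linear_at_def)
    ultimately show "sh.leq x y \<or> sh.leq y x"
      using x y by metis
    show "x = y" if "shorten linear_at z" "x [+] z = y [+] z" for z
      using lin.shorten_P[OF that(1)] lin.shorten_N[OF x] lin.shorten_N[OF y] that(2)
      by (simp add: linear_at_def)
  qed
qed

end

context ordered_cut
begin

section \<open>Words as unimodular matrices\<close>

lemma pl_right_cancel: "N x \<Longrightarrow> N y \<Longrightarrow> N z \<Longrightarrow> x [+] z = y [+] z \<longleftrightarrow> x = y"
  using cancel_right by blast

lemma pl_left_cancel: "N x \<Longrightarrow> N y \<Longrightarrow> N z \<Longrightarrow> z [+] x = z [+] y \<longleftrightarrow> x = y"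
  using pl_right_cancel[of x y z] pl_comm[of z x] pl_comm[of z y] by simp

lemma pl_eq_self: "N x \<Longrightarrow> N z \<Longrightarrow> x [+] z = x \<longleftrightarrow> z = Z"
  using pl_left_cancel[of z Z x] pl_Z by simp

lemma linear_cases:
  assumes "N x" "N y"
  obtains d where "N d" "y = x [+] d" | d where "N d" "x = y [+] d"
  using linear[OF assms] unfolding leq_def by blast

lemma N_cases':
  assumes "N x"
  obtains "x = Z" | y where "N y" "x = y [+] one"
  using N_cases[OF assms] pl_one by metis

lemma unimod_left_nonzero: "N b \<Longrightarrow> N c \<Longrightarrow> N d \<Longrightarrow> unimod a b c d \<Longrightarrow> a \<noteq> Z"
  using sum_eq_Z[of "b [*] c" one] one_neq_Z Z_ti unfolding unimod_def by (metis N_closed(4) N_one)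

lemma unimod_right_nonzero: "N b \<Longrightarrow> N c \<Longrightarrow> unimod a b c d \<Longrightarrow> d \<noteq> Z"
  using sum_eq_Z[of "b [*] c" one] one_neq_Z ti_Z unfolding unimod_def by (metis N_closed(4) N_one)

text \<open>A word is empty, begins with A (first row at least the second) or begins with B (second
  row at least the first). If the rows compare in opposite directions, the determinant is either
  below one or equal to re + dq + de with the differences d and e of the columns; the value one then
  leaves the identity, or d or e vanishes.\<close>

lemma unimod_dichotomy:
  assumes N: "N p" "N q" "N r" "N s" and det: "unimod p q r s"
  obtains "p = one \<and> q = Z \<and> r = Z \<and> s = one"
    | p' q' where "N p'" "N q'" "p = r [+] p'" "q = s [+] q'"
    | r' s' where "N r'" "N s'" "r = p [+] r'" "s = q [+] s'"
proof -
  note [simp] = N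
  note det = det[unfolded unimod_def]
  consider "\<exists>\<^sub>N d. r = p [+] d" | "\<exists>\<^sub>N d. p = r [+] d"
    using linear_cases N(1,3) by metis
  then show thesis
  proof cases
    case 1
    then obtain d where d: "N d" "r = p [+] d"
      by blast
    consider "\<exists>\<^sub>N e. s = q [+] e" | "\<exists>\<^sub>N e. q = s [+] e"
      using linear_cases N(2,4) by metis
    then show thesis
    proof cases
      case 1
      then show thesis
        using that(3) d by blast
    next
      case 2
      then obtain e where e: "N e" "q = s [+] e"
        by blast
      note [simp] = d(1) e(1)
      have "p [*] s [+] Z = p [*] s [+] (s [*] d [+] e [*] p [+] e [*] d [+] one)"
        using det unfolding d e by (simp add: alg)
      then have "s [*] d [+] e [*] p [+] e [*] d [+] one = Z"
        by (simp only: pl_left_cancel N_closed N_one N d(1) e(1))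
      then show thesis
        using one_neq_Z by (simp add: sum_eq_Z)
    qed
  next
    case 2
    then obtain d where d: "N d" "p = r [+] d"
      by blast
    consider "\<exists>\<^sub>N e. s = q [+] e" | "\<exists>\<^sub>N e. q = s [+] e"
      using linear_cases N(2,4) by metis
    then show thesis
    proof cases
      case 1
      then obtain e where e: "N e" "s = q [+] e"
        by blast
      note [simp] = d(1) e(1)
      have "q [*] r [+] (r [*] e [+] d [*] q [+] d [*] e) = q [*] r [+] one"
        using det unfolding d e by (simp add: alg)
      then have eq: "r [*] e [+] d [*] q [+] d [*] e = one"
        by (simp only: pl_left_cancel N_closed N_one N d(1) e(1))
      then consider "r [*] e [+] d [*] q = Z" "d [*] e = one" | "d [*] e = Z"
        using sum_eq_one[of "r [*] e [+] d [*] q" "d [*] e"] by auto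
      then show thesis
      proof cases
        case 1
        then have "d = one" "e = one"
          using prod_eq_one[of d e] by auto
        with 1 have "r = Z" "q = Z"
          by (simp_all add: sum_eq_Z ti_one one_ti)
        then show thesis
          using that(1) d(2) e(2) \<open>d = one\<close> \<open>e = one\<close> by (simp add: Z_pl)
      next
        case 2
        then consider "d = Z" | "e = Z"
          using prod_eq_Z[of d e] by auto
        then show thesis
        proof cases
          case 1
          then show thesis
            using that(3)[of Z e] d e by (simp add: pl_Z)
        next
          case 2
          then show thesis
            using that(2)[of d Z] d e by (simp add: pl_Z)
        qed
      qed
    next
      case 2
      then show thesis
        using that(2) d by blast
    qed
  qed
qed

text \<open>If the word with matrix \<open>A\<^sup>y V\<close> begins with \<open>P B\<close> then \<open>P\<close> begins with \<open>A\<^sup>y\<close>.\<close>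

lemma strip_block:
  assumes N: "N p" "N q" "N r" "N s" "N e" "N f" "N g" "N h" "N v" "N w" "N y"
    and P: "unimod p q r s" and W: "unimod e f g h"
    and v: "v [+] y [*] (r [*] e [+] s [*] (e [+] g)) = p [*] e [+] q [*] (e [+] g)"
    and w: "w [+] y [*] (r [*] f [+] s [*] (f [+] h)) = p [*] f [+] q [*] (f [+] h)"
  obtains p' q' where "N p'" "N q'" "unimod p' q' r s" "p = p' [+] y [*] r" "q = q' [+] y [*] s"
    "v = p' [*] e [+] q' [*] (e [+] g)" "w = p' [*] f [+] q' [*] (f [+] h)"
proof -
  note [simp] = N
  note Ns = N N_closed N_one
  note result = that
  note P = P[unfolded unimod_def]
  have nz: "e \<noteq> Z" "h \<noteq> Z"
    using unimod_left_nonzero unimod_right_nonzero N W by metis+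
  \<comment> \<open>It is enough that \<open>y\<close> times the second row of P can be subtracted
    from its first row; the claims then follow by cancellation. The cases below compare the entries
    and exclude the remaining possibilities.\<close>
  have main: thesis if d: "N d" "p = d [+] y [*] r" and d': "N d'" "q = d' [+] y [*] s" for d d'
  proof (rule result[OF d(1) d'(1) _ d(2) d'(2)])
    note [simp] = d(1) d'(1)
    have "y [*] r [*] s [+] d [*] s = y [*] r [*] s [+] (d' [*] r [+] one)"
      using P unfolding d d' by (simp add: alg)
    then show "unimod d d' r s"
      unfolding unimod_def by (simp only: pl_left_cancel Ns d(1) d'(1))
    have "y [*] (r [*] e [+] s [*] (e [+] g)) [+] v = y [*] (r [*] e [+] s [*] (e [+] g)) [+] (d [*] e [+] d' [*] (e [+] g))"
      using v unfolding d d' by (simp add: alg)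
    then show "v = d [*] e [+] d' [*] (e [+] g)"
      by (simp only: pl_left_cancel Ns d(1) d'(1))
    have "y [*] (r [*] f [+] s [*] (f [+] h)) [+] w = y [*] (r [*] f [+] s [*] (f [+] h)) [+] (d [*] f [+] d' [*] (f [+] h))"
      using w unfolding d d' by (simp add: alg)
    then show "w = d [*] f [+] d' [*] (f [+] h)"
      by (simp only: pl_left_cancel Ns d(1) d'(1))
  qed
  consider "\<exists>\<^sub>N d. p = y [*] r [+] d" | "\<exists>\<^sub>N d. y [*] r = p [+] d"
    using linear_cases[OF N(1) N_ti[OF N(11,3)]] by metis
  then show thesis
  proof cases
    case 1
    then obtain d where d: "N d" "p = y [*] r [+] d"
      by blast
    consider "\<exists>\<^sub>N d'. q = y [*] s [+] d'" | "\<exists>\<^sub>N d'. y [*] s = q [+] d'"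
      using linear_cases[OF N(2) N_ti[OF N(11,4)]] by metis
    then show thesis
    proof cases
      case 1
      then show thesis
        using main[OF d(1)] d pl_comm N(3,4,11) N_ti by metis
    next
      case 2
      then obtain d' where d': "N d'" "y [*] s = q [+] d'"
        by blast
      note [simp] = d(1) d'(1)
      have "p [*] s = r [*] (y [*] s) [+] d [*] s"
        unfolding d by (simp add: alg)
      also have "\<dots> = q [*] r [+] (r [*] d' [+] d [*] s)"
        unfolding d' by (simp add: alg)
      finally have eq: "r [*] d' [+] d [*] s = one"
        using P by (simp only: pl_left_cancel Ns d(1) d'(1))
      have "v [+] y [*] (r [*] e [+] s [*] (e [+] g))
          = (y [*] r [*] e [+] q [*] (e [+] g)) [+] (v [+] d' [*] (e [+] g))"
        using arg_cong[OF d'(2), of "\<lambda>x. v [+] (y [*] r [*] e [+] x [*] (e [+] g))"] by (simp add: alg)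
      moreover have "p [*] e [+] q [*] (e [+] g) = (y [*] r [*] e [+] q [*] (e [+] g)) [+] d [*] e"
        unfolding d by (simp add: alg)
      ultimately have v': "v [+] d' [*] (e [+] g) = d [*] e"
        using v by (simp only: pl_left_cancel Ns d(1) d'(1))
      have "w [+] y [*] (r [*] f [+] s [*] (f [+] h))
          = (y [*] r [*] f [+] q [*] (f [+] h)) [+] (w [+] d' [*] (f [+] h))"
        using arg_cong[OF d'(2), of "\<lambda>x. w [+] (y [*] r [*] f [+] x [*] (f [+] h))"] by (simp add: alg)
      moreover have "p [*] f [+] q [*] (f [+] h) = (y [*] r [*] f [+] q [*] (f [+] h)) [+] d [*] f"
        unfolding d by (simp add: alg)
      ultimately have w': "w [+] d' [*] (f [+] h) = d [*] f"
        using w by (simp only: pl_left_cancel Ns d(1) d'(1))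
      \<comment> \<open>The determinant leaves one unit to distribute. In the first case
        \<open>w'\<close> forces \<open>d' = Z\<close>, as \<open>h\<close> is nonzero; in the
        second \<open>v'\<close> is contradictory, as \<open>e\<close> is nonzero.\<close>
      consider "r [*] d' = Z" "d [*] s = one" | "r [*] d' = one" "d [*] s = Z"
        using sum_eq_one[OF _ _ eq] by auto
      then show thesis
      proof cases
        case 1
        then have d_one: "d = one"
          using prod_eq_one[of d s] by simp
        show thesis
        proof (cases rule: N_cases'[OF d'(1)])
          case 1
          then show thesis
            using main[of d Z] d d' pl_comm[of d] by (simp add: Z_pl pl_Z)
        next
          case (2 d'')
          note [simp] = 2(1)
          have "h [+] (w [+] d'' [*] (f [+] h)) [+] f = Z [+] f"
            using w' unfolding 2 d_one by (simp add: alg)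
          then have "h [+] (w [+] d'' [*] (f [+] h)) = Z"
            by (simp only: pl_right_cancel Ns 2(1))
          then show thesis
            using nz by (simp add: sum_eq_Z)
        qed
      next
        case 2
        then have one: "r = one" "d' = one"
          using prod_eq_one[of r d'] by simp_all
        then have "s \<noteq> Z"
          using d'(2) one_neq_Z by (auto simp: ti_Z dest!: sym[of Z] simp: sum_eq_Z)
        then have "d = Z"
          using 2 prod_eq_Z[of d s] by simp
        then show thesis
          using v' nz by (simp add: one sum_eq_Z Z_ti one_ti)
      qed
    qed
  next
    case 2
    then obtain d where d: "N d" "y [*] r = p [+] d"
      by blast
    note [simp] = d(1)
    consider "\<exists>\<^sub>N d'. q = y [*] s [+] d'" | "\<exists>\<^sub>N d'. y [*] s = q [+] d'"
      using linear_cases[OF N(2) N_ti[OF N(11,4)]] by metis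
    then show thesis
    proof cases
      case 1
      then obtain d' where d': "N d'" "q = y [*] s [+] d'"
        by blast
      note [simp] = d'(1)
      have "(y [*] r) [*] s = p [*] s [+] d [*] s"
        unfolding d by (simp add: alg)
      also have "\<dots> = (y [*] r) [*] s [+] (d' [*] r [+] one [+] d [*] s)"
        unfolding P unfolding d' by (simp add: alg)
      finally have "(y [*] r) [*] s [+] (d' [*] r [+] one [+] d [*] s) = (y [*] r) [*] s"
        by simp
      then have "d' [*] r [+] one [+] d [*] s = Z"
        by (simp only: pl_eq_self Ns d(1) d'(1))
      then show thesis
        using one_neq_Z by (simp add: sum_eq_Z)
    next
      case 2
      then obtain d' where d': "N d'" "y [*] s = q [+] d'"
        by blast
      note [simp] = d'(1)
      have "v [+] y [*] (r [*] e [+] s [*] (e [+] g)) = v [+] ((y [*] r) [*] e [+] (y [*] s) [*] (e [+] g))"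
        by (simp add: alg)
      also have "\<dots> = (p [*] e [+] q [*] (e [+] g)) [+] (v [+] d [*] e [+] d' [*] (e [+] g))"
        unfolding d d' by (simp add: alg)
      finally have "v [+] d [*] e [+] d' [*] (e [+] g) = Z"
        unfolding v by (metis pl_eq_self Ns d(1) d'(1))
      then have "d [*] e = Z" "d' [*] (e [+] g) = Z"
        by (simp_all add: sum_eq_Z)
      then have "d = Z" "d' = Z"
        using prod_eq_Z[of d e] prod_eq_Z[of d' "e [+] g"] nz by (auto simp: sum_eq_Z)
      then show thesis
        using main[of Z Z] d d' by (simp add: Z_pl pl_Z)
    qed
  qed
qed

text \<open>The determinant is multiplicative, and this is the matrix A^u B (e f; g h).\<close>

lemma block_word_unimod:
  assumes [simp]: "N u" "N e" "N f" "N g" "N h" and det: "unimod e f g h"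
  shows "unimod (e [+] u [*] (e [+] g)) (f [+] u [*] (f [+] h)) (e [+] g) (f [+] h)"
proof -
  have "(e [+] u [*] (e [+] g)) [*] (f [+] h) = (e [*] f [+] u [*] (e [+] g) [*] (f [+] h)) [+] e [*] h"
    by (simp add: alg)
  also have "\<dots> = (f [+] u [*] (f [+] h)) [*] (e [+] g) [+] one"
    using det unfolding unimod_def by (simp add: alg)
  finally show ?thesis
    unfolding unimod_def .
qed

lemma has_block_I:
  assumes "N m" "N n" "N k" "N l" "block_word u m n k l" "N p" "N q" "N r" "N s" "unimod p q r s"
    "a = p [*] m [+] q [*] (m [+] k)" "b = p [*] n [+] q [*] (n [+] l)"
    "a [+] c = r [*] m [+] s [*] (m [+] k)" "b [+] d = r [*] n [+] s [*] (n [+] l)"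
  shows "has_block u a b c d"
  unfolding has_block_def
  by (rule exI[of _ m], rule conjI[OF assms(1)], rule exI[of _ n], rule conjI[OF assms(2)],
      rule exI[of _ k], rule conjI[OF assms(3)], rule exI[of _ l], rule conjI[OF assms(4)],
      rule conjI[OF assms(5)], rule exI[of _ p], rule conjI[OF assms(6)], rule exI[of _ q],
      rule conjI[OF assms(7)], rule exI[of _ r], rule conjI[OF assms(8)], rule exI[of _ s],
      rule conjI[OF assms(9)]) (intro conjI assms)

text \<open>Let B A^y B X = P B A^u B Q. If P is empty, the exponents agree. P cannot begin with A,
  because the word begins with B. If P begins with B, this letter cancels and
  \<open>strip_block\<close> removes A^y, which leaves an occurrence of the block in B X.\<close>

lemma has_block_adjoin_D:
  assumes N: "N a" "N b" "N c" "N d" "N y" "N u" and X: "unimod a b c d"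
    and block: "has_block u (a [+] y [*] (a [+] c)) (b [+] y [*] (b [+] d)) (a [+] c) (b [+] d)"
  shows "u = y \<or> has_block u a b c d"
proof -
  note [simp] = N
  obtain m n k l p q r s where mn: "N m" "N n" "N k" "N l" "block_word u m n k l"
    and P: "N p" "N q" "N r" "N s" "unimod p q r s"
    and eq1: "a [+] y [*] (a [+] c) = p [*] m [+] q [*] (m [+] k)"
    and eq2: "b [+] y [*] (b [+] d) = p [*] n [+] q [*] (n [+] l)"
    and eq3: "a [+] y [*] (a [+] c) [+] (a [+] c) = r [*] m [+] s [*] (m [+] k)"
    and eq4: "b [+] y [*] (b [+] d) [+] (b [+] d) = r [*] n [+] s [*] (n [+] l)"
    using block unfolding has_block_def by blast
  obtain e f g h where Q: "N e" "N f" "N g" "N h" "unimod e f g h"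
    and word: "k = e [+] g" "l = f [+] h" "m = e [+] u [*] k" "n = f [+] u [*] l"
    using mn(5) unfolding block_word_def by blast
  note [simp] = mn(1-4) P(1-4) Q(1-4)
  note Ns = N mn(1-4) P(1-4) Q(1-4) N_closed N_one
  have W: "unimod m n k l"
    using block_word_unimod[of u e f g h] Q unfolding word by simp
  have a: "a \<noteq> Z" and e: "e \<noteq> Z"
    using unimod_left_nonzero N X Q by metis+
  show ?thesis
  proof (rule unimod_dichotomy[OF P])
    \<comment> \<open>Now A^u B Q = A^y B X. If the exponents differ by t, then a + tk = e or a = e
      + tk; since k = e + g = a + c, a positive t would make \<open>a\<close> or \<open>e\<close>
      zero.\<close>
    assume P_one: "p = one \<and> q = Z \<and> r = Z \<and> s = one"
    have m: "a [+] y [*] (a [+] c) = m"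
      using eq1 P_one by (simp add: alg)
    then have "m [+] (a [+] c) = m [+] k"
      using eq3 P_one by (simp add: one_ti Z_ti Z_pl)
    then have k: "a [+] c = k"
      by (simp only: pl_left_cancel Ns)
    consider "\<exists>\<^sub>N t. y = u [+] t" | "\<exists>\<^sub>N t. u = y [+] t"
      using linear_cases N(5,6) by metis
    then show ?thesis
    proof cases
      case 1
      then obtain t where t: "N t" "y = u [+] t"
        by blast
      note [simp] = t(1)
      have "u [*] k [+] (a [+] t [*] k) = u [*] k [+] e"
        using m unfolding k t(2) word(3) by (simp add: alg)
      then have *: "a [+] t [*] k = e"
        by (simp only: pl_left_cancel Ns t(1))
      show ?thesis
      proof (rule N_cases'[OF t(1)])
        assume "t = Z"
        then show ?thesis
          using t(2) by (simp add: pl_Z)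
      next
        fix t' assume t': "N t'" "t = t' [+] one"
        note [simp] = t'(1)
        have "e [+] (a [+] t' [*] k [+] g) = e"
          using * unfolding t'(2) word(1) by (simp add: alg)
        then have "a [+] t' [*] k [+] g = Z"
          by (simp only: pl_eq_self Ns t'(1))
        then show ?thesis
          using a by (simp add: sum_eq_Z)
      qed
    next
      case 2
      then obtain t where t: "N t" "u = y [+] t"
        by blast
      note [simp] = t(1)
      have "y [*] k [+] a = y [*] k [+] (e [+] t [*] k)"
        using m unfolding k word(3) unfolding t(2) by (simp add: alg)
      then have *: "a = e [+] t [*] k"
        by (simp only: pl_left_cancel Ns t(1))
      show ?thesis
      proof (rule N_cases'[OF t(1)])
        assume "t = Z"
        then show ?thesis
          using t(2) by (simp add: pl_Z)
      next
        fix t' assume t': "N t'" "t = t' [+] one"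
        note [simp] = t'(1)
        have "e [+] t [*] k = a [+] (e [+] t' [*] k [+] c)"
          unfolding t'(2) k[symmetric] by (simp add: alg)
        then have "a [+] (e [+] t' [*] k [+] c) = a"
          using * by simp
        then have "e [+] t' [*] k [+] c = Z"
          by (simp only: pl_eq_self Ns t'(1))
        then show ?thesis
          using e by (simp add: sum_eq_Z)
      qed
    qed
  next
    fix p' q' assume pq: "N p'" "N q'" "p = r [+] p'" "q = s [+] q'"
    note [simp] = pq(1,2)
    let ?t = "r [*] m [+] s [*] (m [+] k)"
    have x: "a [+] y [*] (a [+] c) = ?t [+] (p' [*] m [+] q' [*] (m [+] k))"
      unfolding eq1 pq by (simp add: alg)
    have "?t [+] (p' [*] m [+] q' [*] (m [+] k) [+] (a [+] c)) = ?t"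
      using eq3[unfolded x] pl_assoc[of ?t "p' [*] m [+] q' [*] (m [+] k)" "a [+] c"]
      by (simp only: Ns pq(1,2) simp_thms)
    then have "p' [*] m [+] q' [*] (m [+] k) [+] (a [+] c) = Z"
      by (simp only: pl_eq_self Ns pq(1,2))
    then show ?thesis
      using a by (simp add: sum_eq_Z)
  next
    \<comment> \<open>P = B P' with P' = (p q; r' s'); subtracting the first row from the second
      cancels B.\<close>
    fix r' s' assume rs: "N r'" "N s'" "r = p [+] r'" "s = q [+] s'"
    note [simp] = rs(1,2)
    have "a [+] y [*] (a [+] c) [+] (a [+] c) = a [+] y [*] (a [+] c) [+] (r' [*] m [+] s' [*] (m [+] k))"
      unfolding eq3 unfolding eq1 rs(3,4) by (simp add: alg)
    then have ac: "a [+] c = r' [*] m [+] s' [*] (m [+] k)"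
      by (simp only: pl_left_cancel Ns rs(1,2))
    have "b [+] y [*] (b [+] d) [+] (b [+] d) = b [+] y [*] (b [+] d) [+] (r' [*] n [+] s' [*] (n [+] l))"
      unfolding eq4 unfolding eq2 rs(3,4) by (simp add: alg)
    then have bd: "b [+] d = r' [*] n [+] s' [*] (n [+] l)"
      by (simp only: pl_left_cancel Ns rs(1,2))
    have "p [*] q [+] p [*] s' = p [*] q [+] (q [*] r' [+] one)"
      using P(5) unfolding unimod_def rs(3,4) by (simp add: alg)
    then have P': "unimod p q r' s'"
      unfolding unimod_def by (simp only: pl_left_cancel Ns rs(1,2))
    have v: "a [+] y [*] (r' [*] m [+] s' [*] (m [+] k)) = p [*] m [+] q [*] (m [+] k)"
      by (rule eq1[unfolded ac])
    have w: "b [+] y [*] (r' [*] n [+] s' [*] (n [+] l)) = p [*] n [+] q [*] (n [+] l)"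
      by (rule eq2[unfolded bd])
    obtain p' q' where p': "N p'" "N q'" "unimod p' q' r' s'"
      "a = p' [*] m [+] q' [*] (m [+] k)" "b = p' [*] n [+] q' [*] (n [+] l)"
      by (rule strip_block[OF P(1,2) rs(1,2) mn(1-4) N(1,2,5) P' W v w])
    have "has_block u a b c d"
      by (rule has_block_I[OF mn p'(1,2) rs(1,2) p'(3-5) ac bd])
    then show ?thesis ..
  qed
qed

text \<open>The new block stands at the beginning: P is the identity and Q is X.\<close>

lemma has_block_adjoin_I1:
  assumes [simp]: "N a" "N b" "N c" "N d" "N y" and X: "unimod a b c d"
  shows "has_block y (a [+] y [*] (a [+] c)) (b [+] y [*] (b [+] d)) (a [+] c) (b [+] d)"
proof -
  have "block_word y (a [+] y [*] (a [+] c)) (b [+] y [*] (b [+] d)) (a [+] c) (b [+] d)"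
    unfolding block_word_def using X assms(1-4) by blast
  then show ?thesis
    by (rule has_block_I[rotated 4, where p = one and q = Z and r = Z and s = one])
      (simp_all add: unimod_def one_ti Z_ti ti_one pl_Z Z_pl)
qed

text \<open>An occurrence with prefix P in B X has the prefix B A^y P in the longer word;
  \<open>?p\<close>, \<open>?q\<close> is the first row of A^y P.\<close>

lemma has_block_adjoin_I2:
  assumes N [simp]: "N a" "N b" "N c" "N d" "N y" and block: "has_block u a b c d"
  shows "has_block u (a [+] y [*] (a [+] c)) (b [+] y [*] (b [+] d)) (a [+] c) (b [+] d)"
proof -
  obtain m n k l p q r s where mn: "N m" "N n" "N k" "N l" "block_word u m n k l"
    and P: "N p" "N q" "N r" "N s" "unimod p q r s"
    and eqs: "a = p [*] m [+] q [*] (m [+] k)" "b = p [*] n [+] q [*] (n [+] l)"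
     "a [+] c = r [*] m [+] s [*] (m [+] k)" "b [+] d = r [*] n [+] s [*] (n [+] l)"
    using block unfolding has_block_def by blast
  note [simp] = mn(1-4) P(1-4)
  let ?p = "p [+] y [*] r" and ?q = "q [+] y [*] s"
  have "?p [*] (?q [+] s) = p [*] q [+] y [*] r [*] q [+] p [*] y [*] s [+] y [*] r [*] y [*] s [+] y [*] r [*] s [+] p [*] s"
    by (simp add: alg)
  also have "\<dots> = ?q [*] (?p [+] r) [+] one"
    using P(5) unfolding unimod_def by (simp add: alg)
  finally have det: "unimod ?p ?q (?p [+] r) (?q [+] s)"
    unfolding unimod_def .
  have 1: "a [+] y [*] (a [+] c) = ?p [*] m [+] ?q [*] (m [+] k)"
    unfolding eqs(3) unfolding eqs(1) by (simp add: alg)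
  have 2: "b [+] y [*] (b [+] d) = ?p [*] n [+] ?q [*] (n [+] l)"
    unfolding eqs(4) unfolding eqs(2) by (simp add: alg)
  have 3: "a [+] y [*] (a [+] c) [+] (a [+] c) = (?p [+] r) [*] m [+] (?q [+] s) [*] (m [+] k)"
    unfolding 1 unfolding eqs(3) by (simp add: alg)
  have 4: "b [+] y [*] (b [+] d) [+] (b [+] d) = (?p [+] r) [*] n [+] (?q [+] s) [*] (n [+] l)"
    unfolding 2 unfolding eqs(4) by (simp add: alg)
  have "N ?p" "N ?q" "N (?p [+] r)" "N (?q [+] s)"
    by simp_all
  then show ?thesis
    using has_block_I[OF mn _ _ _ _ det 1 2 3 4] by blast
qed

lemma has_block_adjoin:
  assumes "N a" "N b" "N c" "N d" "N y" "N u" "unimod a b c d"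
  shows "has_block u (a [+] y [*] (a [+] c)) (b [+] y [*] (b [+] d)) (a [+] c) (b [+] d) \<longleftrightarrow>
    u = y \<or> has_block u a b c d"
  using has_block_adjoin_D has_block_adjoin_I1 has_block_adjoin_I2 assms by metis

text \<open>The word B has one letter, while a block has at least two. In entries, the zero in the
  upper right corner forces \<open>q = Z\<close> and \<open>s = one\<close>, and then one would be a
  sum of two nonzero elements.\<close>

lemma no_block_one:
  assumes u: "N u"
  shows "\<not> has_block u one Z Z one"
proof
  assume "has_block u one Z Z one"
  then obtain m n k l p q r s where mn: "N m" "N n" "N k" "N l" "block_word u m n k l"
    and P: "N p" "N q" "N r" "N s" "unimod p q r s"
    and eqs: "one = p [*] m [+] q [*] (m [+] k)" "Z = p [*] n [+] q [*] (n [+] l)"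
     "one [+] Z = r [*] m [+] s [*] (m [+] k)" "Z [+] one = r [*] n [+] s [*] (n [+] l)"
    unfolding has_block_def by blast
  obtain e f g h where Q: "N e" "N f" "N g" "N h" "unimod e f g h"
    and word: "k = e [+] g" "l = f [+] h" "m = e [+] u [*] k" "n = f [+] u [*] l"
    using mn(5) unfolding block_word_def by blast
  note [simp] = mn(1-4) P(1-4) Q(1-4) u
  have nz: "e \<noteq> Z" "h \<noteq> Z" "p \<noteq> Z" "s \<noteq> Z"
    using unimod_left_nonzero unimod_right_nonzero Q P by metis+
  have "p [*] n = Z" "q [*] (n [+] l) = Z"
    using eqs(2)[symmetric] by (simp_all add: sum_eq_Z)
  then have "q = Z"
    using prod_eq_Z[of q "n [+] l"] nz by (auto simp: word sum_eq_Z)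
  then have "s = one"
    using P(5) prod_eq_one[of p s] unfolding unimod_def by (simp add: alg)
  then have "one = k [+] (r [*] m [+] m)"
    using eqs(3) by (simp add: alg)
  moreover have "k \<noteq> Z" "m \<noteq> Z"
    using nz by (auto simp: word sum_eq_Z)
  ultimately show False
    using sum_eq_one[of k "r [*] m [+] m"] by (auto simp: sum_eq_Z)
qed

section \<open>Pairing, codes, and the adjunction of an element\<close>

lemma pr_inject_left:
  assumes [simp]: "N x" "N y" "N x'" "N y'" "N d" and sum: "x' [+] y' = x [+] y [+] d" and eq: "pr x y = pr x' y'"
  shows "d = Z"
proof (rule N_cases'[OF \<open>N d\<close>])
  fix d' assume d': "N d'" "d = d' [+] one"
  note [simp] = d'(1)
  let ?t = "(x [+] y) [*] (x [+] y)"
  \<comment> \<open>With \<open>d = d' [+] one\<close>, the product \<open>(x [+] y) [*] d\<close>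
    contains a summand \<open>x\<close>; \<open>?rest\<close> is everything beyond it, and must
    vanish.\<close>
  let ?rest = "y [+] (x [+] y) [*] d' [+] d [*] (x [+] y) [+] d [*] d [+] x'"
  have "?t [+] x = (x [+] y [+] d) [*] (x [+] y [+] d) [+] x'"
    using eq unfolding pr_def sum .
  also have "\<dots> = ?t [+] ((x [+] y) [*] d [+] d [*] (x [+] y) [+] d [*] d [+] x')"
    by (simp add: alg)
  finally have "x = (x [+] y) [*] d [+] d [*] (x [+] y) [+] d [*] d [+] x'"
    by (simp only: pl_left_cancel N_closed assms(1-5))
  also have "\<dots> = x [+] ?rest"
    unfolding d'(2) by (simp add: alg)
  finally have "x [+] ?rest = x"
    by simp
  then have "?rest = Z"
    by (simp only: pl_eq_self N_closed assms(1-5) d'(1))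
  then have "d [*] d = Z"
    by (simp add: sum_eq_Z)
  then show ?thesis
    using prod_eq_Z[of d d] by simp
qed

lemma pr_inject:
  assumes [simp]: "N x" "N y" "N x'" "N y'" and eq: "pr x y = pr x' y'"
  shows "x = x' \<and> y = y'"
proof -
  have "x [+] y = x' [+] y'"
  proof (rule linear_cases[of "x [+] y" "x' [+] y'"])
    show "x [+] y = x' [+] y'" if "N d" "x' [+] y' = x [+] y [+] d" for d
      using pr_inject_left[OF assms(1-4) that eq] that by (simp add: pl_Z)
    show "x [+] y = x' [+] y'" if "N d" "x [+] y = x' [+] y' [+] d" for d
      using pr_inject_left[OF assms(3,4,1,2) that eq[symmetric]] that by (simp add: pl_Z)
  qed simp_all
  moreover from this have "x = x'"
    using eq unfolding pr_def by (simp add: pl_left_cancel)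
  ultimately show ?thesis
    by (simp add: pl_left_cancel)
qed

lemma N_pr [simp, intro]: "N x \<Longrightarrow> N y \<Longrightarrow> N (pr x y)"
  by (simp add: pr_def)

lemma code_inject:
  assumes "N a" "N b" "N c" "N d" "N a'" "N b'" "N c'" "N d'" "code a b c d = code a' b' c' d'"
  shows "a = a' \<and> b = b' \<and> c = c' \<and> d = d'"
  using assms pr_inject N_pr unfolding code_def by metis

lemma memb_code:
  assumes "N a" "N b" "N c" "N d" "unimod a b c d"
  shows "memb u (code a b c d) \<longleftrightarrow> has_block u a b c d"
  unfolding memb_def using assms code_inject by metis

text \<open>Zero codes no matrix, because the upper left entry of a unimodular matrix is nonzero.
  This provides the empty set in every cut.\<close>

lemma not_memb_Z:
  shows "\<not> memb u Z"
proof
  assume "memb u Z"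
  then obtain a b c d where N: "N a" "N b" "N c" "N d" and *: "Z = code a b c d" "unimod a b c d"
    unfolding memb_def by blast
  have "pr a b = Z"
    using *(1)[symmetric] N sum_eq_Z[of _ "pr a b"] unfolding code_def pr_def[of "pr a b"] by simp
  then have "a = Z"
    using N sum_eq_Z[of _ a] unfolding pr_def by simp
  then show False
    using unimod_left_nonzero N * by metis
qed

lemma leq_pr: "N x \<Longrightarrow> N y \<Longrightarrow> leq x (pr x y)" "N x \<Longrightarrow> N y \<Longrightarrow> leq y (pr x y)"
proof -
  assume [simp]: "N x" "N y"
  show "leq x (pr x y)"
    unfolding pr_def by (simp add: leq_pl)
  show "leq y (pr x y)"
  proof (rule N_cases'[OF \<open>N y\<close>])
    assume "y = Z"
    then show ?thesis
      by (simp add: leq_N)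
  next
    fix y' assume y': "N y'" "y = y' [+] one"
    note [simp] = y'(1)
    have "pr x y = y [+] ((x [+] y) [*] (x [+] y') [+] x [+] x)"
      unfolding pr_def y'(2) by (simp add: alg)
    then show ?thesis
      using leq_pl(1)[of y] by simp
  qed
qed

text \<open>\<open>H\<close> is to be a shorter cut. A code bounds the entries of its matrix, so
  these lie in \<open>H\<close> with it, and the new code is a polynomial in them and
  \<open>y\<close>. Membership remains that of \<open>N\<close>.\<close>

theorem adjunction:
  assumes H: "\<And>x. H x \<Longrightarrow> N x" "H Z" "\<And>x. H x \<Longrightarrow> H (S x)" "\<And>x y. H x \<Longrightarrow> H y \<Longrightarrow> H (x [+] y)"
      "\<And>x y. H x \<Longrightarrow> H y \<Longrightarrow> H (x [*] y)" "\<And>x y. H x \<Longrightarrow> N y \<Longrightarrow> leq y x \<Longrightarrow> H y"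
    and x: "H x" and y: "H y"
  shows "\<exists>z. H z \<and> (\<forall>u. N u \<longrightarrow> (memb u z \<longleftrightarrow> memb u x \<or> u = y))"
proof -
  have H_code: "H (code a b c d)" if "H a" "H b" "H c" "H d" for a b c d
    using that H(4,5) by (simp add: code_def pr_def)
  have adj: "\<exists>z. H z \<and> (\<forall>u. N u \<longrightarrow> (memb u z \<longleftrightarrow> has_block u a b c d \<or> u = y))"
    if abcd: "H a" "H b" "H c" "H d" and det: "unimod a b c d" for a b c d
  proof -
    let ?a = "a [+] y [*] (a [+] c)" and ?b = "b [+] y [*] (b [+] d)" and ?c = "a [+] c" and ?d = "b [+] d"
    have N [simp]: "N a" "N b" "N c" "N d" "N y"
      using abcd y H(1) by auto
    have "unimod ?a ?b ?c ?d"
    proof -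
      have "?a [*] ?d = (a [*] b [+] y [*] (a [+] c) [*] (b [+] d)) [+] a [*] d"
        by (simp add: alg)
      also have "\<dots> = ?b [*] ?c [+] one"
        using det unfolding unimod_def by (simp add: alg)
      finally show ?thesis
        unfolding unimod_def .
    qed
    then have "memb u (code ?a ?b ?c ?d) \<longleftrightarrow> has_block u a b c d \<or> u = y" if "N u" for u
      using memb_code[of ?a ?b ?c ?d] has_block_adjoin[OF N that det] by auto
    moreover have "H (code ?a ?b ?c ?d)"
      using abcd y H(4,5) by (intro H_code) simp_all
    ultimately show ?thesis
      by blast
  qed
  show ?thesis
  proof (cases "\<exists>\<^sub>N a. \<exists>\<^sub>N b. \<exists>\<^sub>N c. \<exists>\<^sub>N d. x = code a b c d \<and> unimod a b c d")
    case True
    then obtain a b c d where N: "N a" "N b" "N c" "N d" and *: "x = code a b c d" "unimod a b c d"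
      by blast
    have "leq a x" "leq b x" "leq c x" "leq d x"
      using N leq_pr leq_trans N_pr unfolding * code_def by metis+
    then show ?thesis
      using adj[of a b c d] H(6)[OF x] N * memb_code[OF N] by simp
  next
    \<comment> \<open>\<open>x\<close> codes no matrix and so has no elements; the code of A^y B,
      obtained from the empty word, is then the required singleton.\<close>
    case False
    then have "\<not> memb u x" for u
      unfolding memb_def by blast
    moreover have "unimod one Z Z one"
      unfolding unimod_def by (simp add: alg)
    ultimately show ?thesis
      using adj[of one Z Z one] no_block_one H(2,3) unfolding one_def by simp
  qed
qed

end

section \<open>The condensed theory in Robinson arithmetic\<close>

context arith_sig
begin

definition eqv :: "'a \<Rightarrow> 'a \<Rightarrow> bool" where
  "eqv x y \<longleftrightarrow> (\<forall>u. N u \<longrightarrow> (memb u x \<longleftrightarrow> memb u y))"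

text \<open>The least number principle for the codes of one set. The bound \<open>n\<close> turns it
  into a property that can be propagated along the successor.\<close>

definition least_at :: "'a \<Rightarrow> bool" where
  "least_at n \<longleftrightarrow> (\<forall>c. (\<exists>\<^sub>N x. leq x n \<and> eqv x c) \<longrightarrow>
    (\<exists>\<^sub>N x. leq x n \<and> eqv x c \<and> (\<forall>x'. N x' \<and> leq x' x \<and> eqv x' c \<longrightarrow> x' = x)))"

definition canon :: "'a \<Rightarrow> bool" where
  "canon x \<longleftrightarrow> shorten least_at x \<and> (\<forall>x'. N x' \<and> leq x' x \<and> eqv x' x \<longrightarrow> x' = x)"

definition is_union :: "'a \<Rightarrow> 'a \<Rightarrow> 'a \<Rightarrow> bool" where
  "is_union x y z \<longleftrightarrow> (\<forall>u. N u \<longrightarrow> (memb u z \<longleftrightarrow> memb u x \<or> memb u y))"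

text \<open>Sets with canonical codes need not have unions, but those whose union with every set exists
  form a class that is closed under unions.\<close>

definition union_dom :: "'a \<Rightarrow> bool" where
  "union_dom x \<longleftrightarrow> canon x \<and> (\<forall>y. canon y \<longrightarrow> (\<exists>z. canon z \<and> is_union x y z))"

end

context ordered_cut
begin

text \<open>If some member of the class is at most \<open>n\<close>, the least one for
  \<open>n\<close> remains least; otherwise \<open>S n\<close> is the only candidate.\<close>

lemma least_at_inductive: "inductive_property N Z S (pl) (ti) least_at"
proof (unfold_locales)
  show "least_at Z"
    unfolding least_at_def
  proof (intro allI impI)
    fix c
    assume "\<exists>\<^sub>N x. leq x Z \<and> eqv x c"
    then have "eqv Z c"
      using leq_Z by auto
    then show "\<exists>\<^sub>N x. leq x Z \<and> eqv x c \<and> (\<forall>x'. N x' \<and> leq x' x \<and> eqv x' c \<longrightarrow> x' = x)"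
      using leq_Z leq_N[of Z] by (intro exI[of _ Z]) auto
  qed
  show "least_at (S n)" if n: "N n" "least_at n" for n
    unfolding least_at_def
  proof (intro allI impI)
    fix c
    assume ex: "\<exists>\<^sub>N x. leq x (S n) \<and> eqv x c"
    show "\<exists>\<^sub>N x. leq x (S n) \<and> eqv x c \<and> (\<forall>x'. N x' \<and> leq x' x \<and> eqv x' c \<longrightarrow> x' = x)"
    proof (cases "\<exists>\<^sub>N x. leq x n \<and> eqv x c")
      case True
      then obtain x where "N x" "leq x n" "eqv x c" "\<forall>x'. N x' \<and> leq x' x \<and> eqv x' c \<longrightarrow> x' = x"
        using n(2) unfolding least_at_def by blast
      then show ?thesis
        using leq_S n(1) by blast
    next
      case False
      then have "x = S n" if "N x" "leq x (S n)" "eqv x c" for x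
        using leq_S_cases[OF n(1) that(1,2)] that by blast
      then show ?thesis
        using ex by blast
    qed
  qed
qed

interpretation least: inductive_property N Z S pl ti least_at
  by (rule least_at_inductive)

lemma canon_shorten: "canon x \<Longrightarrow> shorten least_at x"
  unfolding canon_def by (rule conjunct1)

lemma canon_N: "canon x \<Longrightarrow> N x"
  using canon_shorten least.shorten_N by blast

lemma eqv_sym: "eqv x y \<Longrightarrow> eqv y x"
  by (simp add: eqv_def)

lemma eqv_trans: "eqv x y \<Longrightarrow> eqv y z \<Longrightarrow> eqv x z"
  by (simp add: eqv_def)

text \<open>Two canonical codes are comparable, and minimality of the larger one makes them equal.
  This is where linearity of the order is needed.\<close>

lemma canon_unique:
  assumes "canon x" "canon y" "eqv x y"
  shows "x = y"
proof -
  have "leq x y \<or> leq y x"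
    using assms canon_N linear by blast
  then show ?thesis
    using assms canon_N eqv_sym[OF assms(3)] unfolding canon_def by auto
qed

lemma canon_ex:
  assumes "shorten least_at x"
  shows "\<exists>y. canon y \<and> eqv y x"
proof -
  have "N x" "least_at x"
    using assms least.shorten_N least.shorten_P by auto
  then obtain y where y: "N y" "leq y x" "eqv y x" "\<forall>x'. N x' \<and> leq x' y \<and> eqv x' x \<longrightarrow> x' = y"
  proof -
    have "\<exists>\<^sub>N x'. leq x' x \<and> eqv x' x"
      using \<open>N x\<close> leq_N by (intro exI[of _ x]) (simp add: eqv_def)
    then have "\<exists>\<^sub>N y. leq y x \<and> eqv y x \<and> (\<forall>x'. N x' \<and> leq x' y \<and> eqv x' x \<longrightarrow> x' = y)"
      using \<open>least_at x\<close> unfolding least_at_def by (elim allE[of _ x] impE)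
    then show ?thesis
      using that by blast
  qed
  have "x' = y" if "N x'" "leq x' y" "eqv x' y" for x'
    using y(4) that eqv_trans[OF that(3) y(3)] by simp
  then have "canon y"
    unfolding canon_def using least.shorten_down[OF assms y(1,2)] by simp
  then show ?thesis
    using y(3) by blast
qed

text \<open>\<open>adjunction\<close> gives some code in the shorter cut, and
  \<open>canon_ex\<close> exchanges it for the least code of the same set.\<close>

lemma canon_adjoin:
  assumes "canon x" "canon y"
  shows "\<exists>z. canon z \<and> (\<forall>u. N u \<longrightarrow> (memb u z \<longleftrightarrow> memb u x \<or> u = y))"
proof -
  have "\<exists>z. shorten least_at z \<and> (\<forall>u. N u \<longrightarrow> (memb u z \<longleftrightarrow> memb u x \<or> u = y))"
    by (rule adjunction)
      (rule assms[THEN canon_shorten] least.shorten_N least.shorten_Z least.shorten_S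
        least.shorten_pl least.shorten_ti least.shorten_down; assumption)+
  then obtain z where z: "shorten least_at z" "\<forall>u. N u \<longrightarrow> (memb u z \<longleftrightarrow> memb u x \<or> u = y)"
    by blast
  obtain z' where "canon z'" "eqv z' z"
    using canon_ex[OF z(1)] by blast
  then show ?thesis
    using z(2) unfolding eqv_def by auto
qed

lemma canon_emp: "\<exists>z. canon z \<and> (\<forall>u. N u \<longrightarrow> \<not> memb u z)"
  using canon_ex[OF least.shorten_Z] not_memb_Z unfolding eqv_def by auto

lemma canon_sg: "canon y \<Longrightarrow> \<exists>z. canon z \<and> (\<forall>u. N u \<longrightarrow> (memb u z \<longleftrightarrow> u = y))"
proof -
  assume y: "canon y"
  obtain z where z: "canon z" "\<forall>u. N u \<longrightarrow> \<not> memb u z"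
    using canon_emp by blast
  show ?thesis
    using canon_adjoin[OF z(1) y] z(2) by auto
qed

lemma dom_canon: "union_dom x \<Longrightarrow> canon x"
  by (simp add: union_dom_def)

lemma dom_N: "union_dom x \<Longrightarrow> N x"
  using dom_canon canon_N by blast

lemma dom_ext: "union_dom x \<Longrightarrow> union_dom y \<Longrightarrow> (\<And>u. N u \<Longrightarrow> memb u x \<longleftrightarrow> memb u y) \<Longrightarrow> x = y"
  using canon_unique dom_canon unfolding eqv_def by blast

lemma dom_emp: "\<exists>z. union_dom z \<and> (\<forall>u. N u \<longrightarrow> \<not> memb u z)"
proof -
  obtain z where z: "canon z" "\<forall>u. N u \<longrightarrow> \<not> memb u z"
    using canon_emp by blast
  then have "union_dom z"
    unfolding union_dom_def is_union_def by auto
  then show ?thesis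
    using z by blast
qed

text \<open>The union of a singleton with any set is an adjunction, so it exists among the canonical
  codes.\<close>

lemma dom_sg:
  assumes "union_dom y"
  shows "\<exists>z. union_dom z \<and> (\<forall>u. N u \<longrightarrow> (memb u z \<longleftrightarrow> u = y))"
proof -
  obtain z where z: "canon z" "\<forall>u. N u \<longrightarrow> (memb u z \<longleftrightarrow> u = y)"
    using canon_sg dom_canon assms by blast
  have "\<exists>v. canon v \<and> is_union z w v" if w: "canon w" for w
  proof -
    obtain v where "canon v" "\<forall>u. N u \<longrightarrow> (memb u v \<longleftrightarrow> memb u w \<or> u = y)"
      using canon_adjoin[OF w dom_canon[OF assms]] by blast
    then show ?thesis
      using z(2) unfolding is_union_def by auto
  qed
  then have "union_dom z"
    using z(1) by (simp add: union_dom_def)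
  then show ?thesis
    using z by blast
qed

text \<open>Solovay's associativity argument again: the union of \<open>z\<close> with
  \<open>w\<close> is obtained by uniting \<open>w\<close> with \<open>y\<close> and the result with
  \<open>x\<close>.\<close>

lemma dom_un:
  assumes "union_dom x" "union_dom y"
  shows "\<exists>z. union_dom z \<and> is_union x y z"
proof -
  obtain z where z: "canon z" "is_union x y z"
    using assms unfolding union_dom_def by blast
  have "\<exists>v. canon v \<and> is_union z w v" if "canon w" for w
  proof -
    obtain w' where w': "canon w'" "is_union y w w'"
      using assms(2) \<open>canon w\<close> unfolding union_dom_def by blast
    obtain v where "canon v" "is_union x w' v"
      using assms(1) w'(1) unfolding union_dom_def by blast
    then show ?thesis
      using z(2) w'(2) unfolding is_union_def by auto
  qed
  then have "union_dom z"
    using z(1) by (simp add: union_dom_def)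
  then show ?thesis
    using z by blast
qed

end

section \<open>Definability of the classes in models of Robinson arithmetic\<close>

lemma definable_subst5:
  assumes "definable L 5 (\<lambda>F e. P F (e 0) (e 1) (e 2) (e 3) (e 4))"
    "definable_tm L n t1" "definable_tm L n t2" "definable_tm L n t3" "definable_tm L n t4" "definable_tm L n t5"
  shows "definable L n (\<lambda>F e. P F (t1 F e) (t2 F e) (t3 F e) (t4 F e) (t5 F e))"
  using definable_subst[OF assms(1), of "[t1, t2, t3, t4, t5]" n] assms(2-6)
  by (auto simp: numeral_nat)

text \<open>Instantiated twice: with \<open>Q_cut\<close>, to define its ordered subcut, and with
  \<open>Q_ord\<close>, to define the sets over that subcut.\<close>

locale cut_definable =
  fixes L :: "('f, 'r) language" and N :: "('f \<Rightarrow> 'a list \<Rightarrow> 'a) \<Rightarrow> 'a \<Rightarrow> bool"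
    and Z :: "('f \<Rightarrow> 'a list \<Rightarrow> 'a) \<Rightarrow> 'a" and S :: "('f \<Rightarrow> 'a list \<Rightarrow> 'a) \<Rightarrow> 'a \<Rightarrow> 'a"
    and pl ti :: "('f \<Rightarrow> 'a list \<Rightarrow> 'a) \<Rightarrow> 'a \<Rightarrow> 'a \<Rightarrow> 'a"
  assumes N: "\<And>n t. definable_tm L n t \<Longrightarrow> definable L n (\<lambda>F e. N F (t F e))"
    and Z: "\<And>n. definable_tm L n (\<lambda>F e. Z F)"
    and S: "\<And>n t. definable_tm L n t \<Longrightarrow> definable_tm L n (\<lambda>F e. S F (t F e))"
    and pl: "\<And>n t u. definable_tm L n t \<Longrightarrow> definable_tm L n u \<Longrightarrow> definable_tm L n (\<lambda>F e. pl F (t F e) (u F e))"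
    and ti: "\<And>n t u. definable_tm L n t \<Longrightarrow> definable_tm L n u \<Longrightarrow> definable_tm L n (\<lambda>F e. ti F (t F e) (u F e))"
begin

lemma leq:
  "definable_tm L n t \<Longrightarrow> definable_tm L n u \<Longrightarrow>
    definable L n (\<lambda>F e. arith_sig.leq (N F) (pl F) (t F e) (u F e))"
  by (erule definable_subst2[rotated], assumption, unfold arith_sig.leq_def,
      intro definable_intros N pl) auto

lemmas intros = definable_intros N Z S pl ti leq

lemma shorten:
  assumes P: "\<And>n t. definable_tm L n t \<Longrightarrow> definable L n (\<lambda>F e. P F (t F e))"
    and t: "definable_tm L n t"
  shows "definable L n (\<lambda>F e. arith_sig.shorten (N F) (pl F) (ti F) (P F) (t F e))"
proof -
  have her: "definable L n (\<lambda>F e. arith_sig.hereditary (N F) (pl F) (P F) (t F e))"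
    if "definable_tm L n t" for n t
    by (rule definable_subst1[OF _ that], unfold arith_sig.hereditary_def, intro intros P) auto
  have plus: "definable L n (\<lambda>F e. arith_sig.plus_closed (N F) (pl F) (P F) (t F e))"
    if "definable_tm L n t" for n t
    by (rule definable_subst1[OF _ that], unfold arith_sig.plus_closed_def, intro intros her) auto
  show ?thesis
    by (rule definable_subst1[OF _ t], unfold arith_sig.shorten_def, intro intros plus) auto
qed

lemma linear_at:
  "definable_tm L n t \<Longrightarrow> definable L n (\<lambda>F e. arith_sig.linear_at (N F) (pl F) (t F e))"
  by (erule definable_subst1[rotated], unfold arith_sig.linear_at_def, intro intros) auto

lemma memb:
  assumes "definable_tm L n t" "definable_tm L n t'"
  shows "definable L n (\<lambda>F e. arith_sig.memb (N F) (Z F) (S F) (pl F) (ti F) (t F e) (t' F e))"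
proof -
  note defs = arith_sig.unimod_def arith_sig.one_def arith_sig.code_def arith_sig.pr_def
  have word: "definable L n (\<lambda>F e. arith_sig.block_word (N F) (Z F) (S F) (pl F) (ti F)
      (t1 F e) (t2 F e) (t3 F e) (t4 F e) (t5 F e))"
    if "definable_tm L n t1" "definable_tm L n t2" "definable_tm L n t3" "definable_tm L n t4"
      "definable_tm L n t5" for n t1 t2 t3 t4 t5
    by (rule definable_subst5[OF _ that], unfold arith_sig.block_word_def defs, intro intros) auto
  have block: "definable L n (\<lambda>F e. arith_sig.has_block (N F) (Z F) (S F) (pl F) (ti F)
      (t1 F e) (t2 F e) (t3 F e) (t4 F e) (t5 F e))"
    if "definable_tm L n t1" "definable_tm L n t2" "definable_tm L n t3" "definable_tm L n t4"
      "definable_tm L n t5" for n t1 t2 t3 t4 t5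
    by (rule definable_subst5[OF _ that], unfold arith_sig.has_block_def defs, intro intros word) auto
  show ?thesis
    by (rule definable_subst2[OF _ assms], unfold arith_sig.memb_def defs, intro intros block) auto
qed

lemma eqv:
  assumes "definable_tm L n t" "definable_tm L n t'"
  shows "definable L n (\<lambda>F e. arith_sig.eqv (N F) (Z F) (S F) (pl F) (ti F) (t F e) (t' F e))"
  by (rule definable_subst2[OF _ assms], unfold arith_sig.eqv_def, intro intros memb) auto

lemma least_at:
  "definable_tm L n t \<Longrightarrow> definable L n (\<lambda>F e. arith_sig.least_at (N F) (Z F) (S F) (pl F) (ti F) (t F e))"
  by (erule definable_subst1[rotated], unfold arith_sig.least_at_def, intro intros eqv) auto

lemma canon:
  "definable_tm L n t \<Longrightarrow> definable L n (\<lambda>F e. arith_sig.canon (N F) (Z F) (S F) (pl F) (ti F) (t F e))"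
  by (erule definable_subst1[rotated], unfold arith_sig.canon_def, intro intros eqv shorten least_at) auto

lemma is_union:
  assumes "definable_tm L n t1" "definable_tm L n t2" "definable_tm L n t3"
  shows "definable L n
    (\<lambda>F e. arith_sig.is_union (N F) (Z F) (S F) (pl F) (ti F) (t1 F e) (t2 F e) (t3 F e))"
  by (rule definable_subst3[OF _ assms], unfold arith_sig.is_union_def, intro intros memb) auto

lemma union_dom:
  "definable_tm L n t \<Longrightarrow>
    definable L n (\<lambda>F e. arith_sig.union_dom (N F) (Z F) (S F) (pl F) (ti F) (t F e))"
  by (erule definable_subst1[rotated], unfold arith_sig.union_dom_def, intro intros canon is_union) auto

end

abbreviation Q_zero :: "(Q_sym \<Rightarrow> 'a list \<Rightarrow> 'a) \<Rightarrow> 'a" where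
  "Q_zero F \<equiv> F Zero_sym []"
abbreviation Q_succ :: "(Q_sym \<Rightarrow> 'a list \<Rightarrow> 'a) \<Rightarrow> 'a \<Rightarrow> 'a" where
  "Q_succ F x \<equiv> F Succ_sym [x]"
abbreviation Q_plus :: "(Q_sym \<Rightarrow> 'a list \<Rightarrow> 'a) \<Rightarrow> 'a \<Rightarrow> 'a \<Rightarrow> 'a" where
  "Q_plus F x y \<equiv> F Plus_sym [x, y]"
abbreviation Q_times :: "(Q_sym \<Rightarrow> 'a list \<Rightarrow> 'a) \<Rightarrow> 'a \<Rightarrow> 'a \<Rightarrow> 'a" where
  "Q_times F x y \<equiv> F Times_sym [x, y]"

text \<open>The operations are total already, but their algebraic laws may fail; their graphs are
  fed into the relational construction, which selects a class where the laws hold.\<close>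

definition Q_cut :: "(Q_sym \<Rightarrow> 'a list \<Rightarrow> 'a) \<Rightarrow> 'a \<Rightarrow> bool" where
  "Q_cut F = rel_arith_sig.N (Q_zero F) (Q_succ F) (\<lambda>x y z. z = Q_plus F x y) (\<lambda>x y z. z = Q_times F x y)"

definition Q_ord :: "(Q_sym \<Rightarrow> 'a list \<Rightarrow> 'a) \<Rightarrow> 'a \<Rightarrow> bool" where
  "Q_ord F = arith_sig.shorten (Q_cut F) (Q_plus F) (Q_times F) (arith_sig.linear_at (Q_cut F) (Q_plus F))"

lemma definable_Q_terms:
  "definable_tm Q_lang n (\<lambda>F e. Q_zero F)"
  "definable_tm Q_lang n t \<Longrightarrow> definable_tm Q_lang n (\<lambda>F e. Q_succ F (t F e))"
  "definable_tm Q_lang n t \<Longrightarrow> definable_tm Q_lang n u \<Longrightarrow> definable_tm Q_lang n (\<lambda>F e. Q_plus F (t F e) (u F e))"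
  "definable_tm Q_lang n t \<Longrightarrow> definable_tm Q_lang n u \<Longrightarrow> definable_tm Q_lang n (\<lambda>F e. Q_times F (t F e) (u F e))"
  by (intro definable_tm_Fun0 definable_tm_Fun1 definable_tm_Fun2; simp add: Q_lang_def)+

interpretation Q_definable: rel_arith_definable Q_lang Q_zero Q_succ
  "\<lambda>F x y z. z = Q_plus F x y" "\<lambda>F x y z. z = Q_times F x y"
  by unfold_locales (intro definable_Q_terms definable_eq; assumption)+

interpretation Q_cut_definable: cut_definable Q_lang Q_cut Q_zero Q_succ Q_plus Q_times
  by unfold_locales ((unfold Q_cut_def)?, intro definable_Q_terms Q_definable.N; assumption)+

interpretation Q_ord_definable: cut_definable Q_lang Q_ord Q_zero Q_succ Q_plus Q_times
  by unfold_locales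
    ((unfold Q_ord_def)?, intro definable_Q_terms Q_cut_definable.shorten Q_cut_definable.linear_at; assumption)+

lemma Q_derivable:
  "axs Q_arith \<turnstile> Imp (Eq (q_succ s) (q_succ t)) (Eq s t)"
  "axs Q_arith \<turnstile> Neg (Eq (q_succ t) q_zero)"
proof -
  have "axs Q_arith \<turnstile> Q2_ax" "axs Q_arith \<turnstile> Q1_ax"
    by (auto simp: Q_arith_def intro: deriv.Hyp)
  then show "axs Q_arith \<turnstile> Imp (Eq (q_succ s) (q_succ t)) (Eq s t)" "axs Q_arith \<turnstile> Neg (Eq (q_succ t) q_zero)"
    using forall2_elim[of "axs Q_arith" "Imp (Eq (q_succ (Var 1)) (q_succ (Var 0))) (Eq (Var 1) (Var 0))" t s]
      deriv.AllE[of "axs Q_arith" "Neg (Eq (q_succ (Var 0)) q_zero)" t]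
    by (auto simp: Q_axioms alls_def numeral_2_eq_2 inst_def Let_def)
qed

lemma models_Q:
  assumes "models F Q_arith"
  shows "ordered_cut (Q_ord F) (Q_zero F) (Q_succ F) (Q_plus F) (Q_times F)"
proof -
  obtain R where "\<forall>p\<in>axs Q_arith. \<forall>e. sat UNIV F R e p"
    using assms unfolding models_def by blast
  then have ax: "sat UNIV F R e Q1_ax" "sat UNIV F R e Q2_ax" "sat UNIV F R e Q3_ax"
    "sat UNIV F R e Q4_ax" "sat UNIV F R e Q5_ax" "sat UNIV F R e Q6_ax" "sat UNIV F R e Q7_ax" for e
    by (simp_all add: Q_arith_def)
  have 1: "Q_succ F x \<noteq> Q_zero F" for x
    using ax(1) by (simp add: Q_axioms sat_alls_simps)
  have 2: "Q_succ F x = Q_succ F y \<Longrightarrow> x = y" for x y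
    using ax(2) by (auto simp: Q_axioms sat_alls_simps)
  have 3: "x = Q_zero F \<or> (\<exists>y. x = Q_succ F y)" for x
    using ax(3) by (auto simp: Q_axioms sat_alls_simps)
  have 4: "Q_plus F x (Q_zero F) = x" "Q_plus F x (Q_succ F y) = Q_succ F (Q_plus F x y)" for x y
    using ax(4,5) by (simp_all add: Q_axioms sat_alls_simps)
  have 5: "Q_times F x (Q_zero F) = Q_zero F" "Q_times F x (Q_succ F y) = Q_plus F (Q_times F x y) x" for x y
    using ax(6,7) by (simp_all add: Q_axioms sat_alls_simps)
  \<comment> \<open>The axiom on predecessors leaves only zero and successors as second arguments,
    which yields the recursion equations as equivalences.\<close>
  interpret rel_arith "Q_zero F" "Q_succ F" "\<lambda>x y z. z = Q_plus F x y" "\<lambda>x y z. z = Q_times F x y"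
  proof
    show "z = Q_plus F x y \<longleftrightarrow> y = Q_zero F \<and> z = x \<or>
        (\<exists>y' z'. y = Q_succ F y' \<and> z = Q_succ F z' \<and> z' = Q_plus F x y')" for x y z
      using 3[of y] 1 2 by (auto simp: 4)
    show "z = Q_times F x y \<longleftrightarrow> y = Q_zero F \<and> z = Q_zero F \<or>
        (\<exists>y' z'. y = Q_succ F y' \<and> z' = Q_times F x y' \<and> z = Q_plus F z' x)" for x y z
      using 3[of y] 1 2 by (auto simp: 5)
  qed (use 1 2 in auto)
  have "pl = Q_plus F" "ti = Q_times F"
    by (simp_all add: fun_eq_iff pl_def ti_def)
  then have "comm_semiring_cut (Q_cut F) (Q_zero F) (Q_succ F) (Q_plus F) (Q_times F)"
    using cut.comm_semiring_cut_axioms by (simp add: Q_cut_def)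
  then show ?thesis
    unfolding Q_ord_def by (rule comm_semiring_cut.shorten_linear_at)
qed

theorem F_interpretable_in_Q: "interpretable_in F_c_minus Q_arith"
proof -
  define D where "D F = {x. arith_sig.union_dom (Q_ord F) (Q_zero F) (Q_succ F) (Q_plus F) (Q_times F) x}"
    for F :: "Q_sym \<Rightarrow> nat list \<Rightarrow> nat"
  define mem where "mem F = arith_sig.memb (Q_ord F) (Q_zero F) (Q_succ F) (Q_plus F) (Q_times F)"
    for F :: "Q_sym \<Rightarrow> nat list \<Rightarrow> nat"
  define P where "P f F e = (case f of
        Emp_sym \<Rightarrow> \<forall>u. Q_ord F u \<longrightarrow> \<not> mem F u (e 0)
      | Sing_sym \<Rightarrow> \<forall>u. Q_ord F u \<longrightarrow> (mem F u (e 1) \<longleftrightarrow> u = e 0)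
      | Un_sym \<Rightarrow> \<forall>u. Q_ord F u \<longrightarrow> (mem F u (e 2) \<longleftrightarrow> mem F u (e 0) \<or> mem F u (e 1)))"
    for f and F :: "Q_sym \<Rightarrow> nat list \<Rightarrow> nat" and e :: "nat \<Rightarrow> nat"
  \<comment> \<open>\<open>P\<close> may have further solutions outside \<open>D F\<close>, namely
    other codes of the same set. The choice is therefore made inside the domain, where
    extensionality makes it unique.\<close>
  define G where "G F f xs = (SOME y. y \<in> D F \<and> P f F ((!) (xs @ [y])))"
    for F :: "Q_sym \<Rightarrow> nat list \<Rightarrow> nat" and f xs
  have length: "length xs = 2 \<longleftrightarrow> (\<exists>x y. xs = [x, y])" for xs :: "nat list"
    by (auto simp: numeral_2_eq_2 length_Suc_conv)
  have model: "D F \<noteq> {} \<and>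
      (\<forall>(f, n)\<in>funs F_lang. \<forall>xs. length xs = n \<and> set xs \<subseteq> D F \<longrightarrow>
        G F f xs \<in> D F \<and> (\<forall>y\<in>D F. P f F ((!) (xs @ [y])) \<longleftrightarrow> y = G F f xs)) \<and>
      (\<forall>p\<in>axs F_c_minus. \<forall>R e. sat (D F) (G F) R e p)" if "models F Q_arith" for F
  proof -
    interpret ordered_cut "Q_ord F" "Q_zero F" "Q_succ F" "Q_plus F" "Q_times F"
      using that by (rule models_Q)
    have D: "x \<in> D F \<longleftrightarrow> union_dom x" for x
      by (simp add: D_def)
    have ext: "x = y" if "x \<in> D F" "y \<in> D F" "\<And>u. Q_ord F u \<Longrightarrow> mem F u x \<longleftrightarrow> mem F u y" for x y
      using dom_ext that unfolding D mem_def by blast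
    have ord: "Q_ord F x" if "x \<in> D F" for x
      using that dom_N D by blast
    let ?emp = "G F Emp_sym []" and ?sg = "\<lambda>x. G F Sing_sym [x]" and ?un = "\<lambda>x y. G F Un_sym [x, y]"
    have G: "G F f xs \<in> D F \<and> P f F ((!) (xs @ [G F f xs]))"
      if "\<exists>y. y \<in> D F \<and> P f F ((!) (xs @ [y]))" for f xs
      unfolding G_def using that by (rule someI_ex)
    have emp: "?emp \<in> D F" "Q_ord F u \<Longrightarrow> \<not> mem F u ?emp" for u
      using G[of Emp_sym "[]"] dom_emp by (auto simp: P_def D mem_def)
    have sg: "?sg x \<in> D F" "Q_ord F u \<Longrightarrow> mem F u (?sg x) \<longleftrightarrow> u = x" if "x \<in> D F" for x u
      using G[of Sing_sym "[x]"] dom_sg[of x] that by (auto simp: P_def D mem_def)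
    have un: "?un x y \<in> D F" "Q_ord F u \<Longrightarrow> mem F u (?un x y) \<longleftrightarrow> mem F u x \<or> mem F u y"
      if "x \<in> D F" "y \<in> D F" for x y u
      using G[of Un_sym "[x, y]"] dom_un[of x y] that by (auto simp: P_def D mem_def is_union_def)
    have assoc: "?un (?un x y) z = ?un x (?un y z)" if "x \<in> D F" "y \<in> D F" "z \<in> D F" for x y z
      using that by (intro ext) (simp_all add: un)
    have comm: "?un x y = ?un y x" if "x \<in> D F" "y \<in> D F" for x y
      using that by (intro ext) (auto simp add: un)
    have idem: "?un x x = x" if "x \<in> D F" for x
      using that by (intro ext) (simp_all add: un)
    have un_emp: "?un x ?emp = x" if "x \<in> D F" for x
      using that by (intro ext) (simp_all add: un emp)
    have sg_emp: "?sg x \<noteq> ?emp" if "x \<in> D F" for x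
      using that sg(2)[of x x] emp(2)[of x] ord by auto
    have un_eq_emp: "x = ?emp" if "x \<in> D F" "y \<in> D F" "?un x y = ?emp" for x y
    proof (rule ext)
      show "mem F u x \<longleftrightarrow> mem F u ?emp" if "Q_ord F u" for u
        using that un(2)[OF \<open>x \<in> D F\<close> \<open>y \<in> D F\<close> that] emp(2)[OF that] \<open>?un x y = ?emp\<close> by simp
    qed (use that emp in auto)
    have sg_inj: "x = y" if "x \<in> D F" "y \<in> D F" "?sg x = ?sg y" for x y
      using that sg(2)[of x x] sg(2)[of y x] ord by auto
    \<comment> \<open>If \<open>u\<close> is an element of \<open>z\<close>, then \<open>z\<close>
      itself is the witness, since uniting it with the singleton of \<open>u\<close> changes
      nothing.\<close>
    have mem: "(\<exists>w\<in>D F. z = ?un w (?sg u)) \<longleftrightarrow> mem F u z" if "z \<in> D F" "u \<in> D F" for z u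
    proof
      assume "mem F u z"
      then have "z = ?un z (?sg u)"
        using that by (intro ext) (auto simp: un sg)
      then show "\<exists>w\<in>D F. z = ?un w (?sg u)"
        using that by blast
    qed (use that in \<open>auto simp: un sg ord\<close>)
    have M: "mem F u (?un x (?sg y)) \<longleftrightarrow> mem F u x \<or> u = y" if "x \<in> D F" "y \<in> D F" "u \<in> D F" for x y u
      using that by (simp add: un sg ord)
    have "sat (D F) (G F) R e F1_ax" "sat (D F) (G F) R e F2_ax" "sat (D F) (G F) R e F3_ax"
      "sat (D F) (G F) R e F5_ax" "sat (D F) (G F) R e F6_ax" "sat (D F) (G F) R e F7_ax"
      "sat (D F) (G F) R e Id_ax" for R e
      by (simp_all add: F_axioms sat_alls_simps assoc comm idem un_emp sg_emp) (blast intro: un_eq_emp sg_inj)+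
    moreover have "sat (D F) (G F) R e M_ax" for R e
      by (auto simp: M_ax_def sat_alls_simps mem M un sg)
    ultimately have "sat (D F) (G F) R e p" if "p \<in> axs F_c_minus" for R e p
      using that by (auto simp: F_c_minus_def)
    moreover have "P f F ((!) (xs @ [y])) \<longleftrightarrow> y = G F f xs" "G F f xs \<in> D F"
      if "(f, n) \<in> funs F_lang" "length xs = n" "set xs \<subseteq> D F" "y \<in> D F" for f n xs y
    proof -
      show c: "G F f xs \<in> D F"
        using that by (auto simp: F_lang_def length length_Suc_conv emp sg un)
      have "P f F ((!) (xs @ [G F f xs]))"
        using that by (auto simp: F_lang_def length length_Suc_conv P_def emp sg un)
      moreover have "y = y'" if "P f F ((!) (xs @ [y]))" "P f F ((!) (xs @ [y']))" "y' \<in> D F" for y'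
        using that \<open>(f, n) \<in> funs F_lang\<close> \<open>length xs = n\<close> \<open>y \<in> D F\<close>
        by (intro ext) (auto simp: F_lang_def length length_Suc_conv P_def)
      ultimately show "P f F ((!) (xs @ [y])) \<longleftrightarrow> y = G F f xs"
        using c by metis
    qed
    moreover have "D F \<noteq> {}"
      using emp(1) by blast
    ultimately show ?thesis
      by blast
  qed
  show ?thesis
  proof (rule interpretable_inI[where D = D and G = G and P = P and c = Succ_sym and z = Zero_sym])
    show "definable (lang Q_arith) 1 (\<lambda>F e. e 0 \<in> D F)"
      by (simp add: Q_arith_def D_def) (intro Q_ord_definable.union_dom definable_intros, simp)
    show "definable (lang Q_arith) (Suc n) (P f)" if "(f, n) \<in> funs (lang F_c_minus)" for f n
      using that unfolding P_def mem_def
      by (auto simp: F_c_minus_def Q_arith_def F_lang_def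
          intro!: definable_intros Q_ord_definable.memb Q_ord_definable.N)
  qed (use model Q_derivable wf_F_axioms wf_Q_axioms in \<open>auto simp: F_c_minus_def F_lang_def\<close>)
qed

theorem proposition8p4: "mutually_interpretable F_c_minus Q_arith"
  unfolding mutually_interpretable_def using F_interpretable_in_Q Q_interpretable_in_F ..

end
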